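(* Let $F:X_h\to\mathbb{R}$ be $\alpha$-strongly convex for some $\alpha>0$ and Fréchet differentiable with $\beta$-Lipschitz continuous derivative for some $\beta>0$. For fixed $\tau>0$, the additive Schwarz method for $\min_{\mathbf{p}\in C}\mathcal{F}(\mathbf{p})$ with the space decomposition $W_k=Y_h(S_k)$, $k=1,\dots,N$, given by the overlapping domain decomposition, converges pseudo-linearly at rate $\gamma$ with threshold $\epsilon>0$ such that $\epsilon\lesssim|\Omega|/\delta^2$ and $\gamma$ is independent of $|\Omega|$, $H$, $h$, and $\delta$. Here convergence of the method refers to the scaled energy error $\zeta_n=\alpha\left(\mathcal{F}(\mathbf{p}^{(n)})-\mathcal{F}(\mathbf{p}^* )\right)$, $n\ge0$, where $\mathbf{p}^*$ is a solution of $\min_{\mathbf{p}\in C}\mathcal{F}(\mathbf{p})$.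
   Context: Pseudo-linear convergence. A sequence $\{a_n\}_{n\ge0}$ of positive real numbers converges pseudo-linearly to $0$ at rate $\gamma$ with threshold $\epsilon$ if $a_n\to0$ as $n\to\infty$ and there exist constants $0<\gamma<1$, $c>0$, and $\epsilon>0$ such that $a_n\le\gamma^n c+\epsilon$ for all $n\ge0$. Notation. For positive real numbers $A$, $B$ depending on the parameters $|\Omega|$, $H$, $h$, $\delta$, $A\lesssim B$ means that there is a constant $c>0$, independent of these parameters, with $A\le cB$. Discretization. Let $\Omega=(0,m_1h)\times(0,m_2h)\subset\mathbb{R}^2$ be partitioned into $m_1\times m_2$ square elements of side length $h$; $\mathcal{T}_h$ is the collection of elements and $\mathcal{E}_h$ the collection of interior element edges. $X_h$ is the space of functions in $L^2(\Omega)$ that are constant on each $T\in\mathcal{T}_h$; $(u)_T$ denotes the value of $u\in X_h$ on $T$. $Y_h=\{\mathbf{p}\in H_0(\mathrm{div};\Omega):\mathbf{p}|_T\in\mathcal{RT}_0(T)\ \forall T\in\mathcal{T}_h\}$, where $H_0(\mathrm{div};\Omega)$ is the space of $\mathbf{p}\in(L^2(\Omega))^2$ with $\mathrm{div}\,\mathbf{p}\in L^2(\Omega)$ and zero normal component on $\partial\Omega$, and $\mathcal{RT}_0(T)$ is the set of vector fields on $T$ of the form $(x_1,x_2)\mapsto(a_1+b_1x_1,\ a_2+b_2x_2)$. For $\mathbf{p}\in Y_h$ and $e\in\mathcal{E}_h$, $(\mathbf{p})_e=\frac{1}{|e|}\int_e\mathbf{p}\cdot\mathbf{n}_e\,ds$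 with $\mathbf{n}_e$ a unit normal to $e$. The inner products are $\langle u,v\rangle_{X_h}=h^2\sum_{T\in\mathcal{T}_h}(u)_T(v)_T$ and $\langle\mathbf{p},\mathbf{q}\rangle_{Y_h}=h^2\sum_{e\in\mathcal{E}_h}(\mathbf{p})_e(\mathbf{q})_e$, with induced norms both written $\|\cdot\|$. The operator $\mathrm{div}$ maps $Y_h$ into $X_h$. Let $C=\{\mathbf{p}\in Y_h:|(\mathbf{p})_e|\le1\ \forall e\in\mathcal{E}_h\}$. Functional. $F$ is $\alpha$-strongly convex if $u\mapsto F(u)-\frac{\alpha}{2}\|u\|^2$ is convex; $F'$ is $\beta$-Lipschitz continuous if $\|F'(u)-F'(v)\|\le\beta\|u-v\|$ for all $u,v\in X_h$. $F^*$ is the Legendre–Fenchel conjugate of $F$, and $\mathcal{F}(\mathbf{p})=F^*(\mathrm{div}\,\mathbf{p})$ for $\mathbf{p}\in Y_h$. Overlapping domain decomposition. $\Omega$ is decomposed in a checkerboard fashion into $\mathcal{N}$ disjoint square subdomains $\{\Omega_s\}_{s=1}^{\mathcal{N}}$ of side length $H$. For each $s$, $\Omega_s'$ is the enlarged subdomain consisting of $\Omega_s$ and its surrounding layers of elements with width $\delta$, for some $\delta>0$. The subdomains $\{\Omega_s'\}$ are colored with $N\le4$ colors such that subdomains of the same color are disjoint; $S_k$ is the union of all $\Omega_s'$ of color $k$, and $\mathcal{T}_{h,k}$ is the collection of elements of $\mathcal{T}_h$ in $S_k$. Set $W_k=Y_h(S_k)=\{\mathbf{p}\in H_0(\mathrm{div};S_k):\mathbf{p}|_T\in\mathcal{RT}_0(T)\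 \forall T\in\mathcal{T}_{h,k}\}$, and let $R_k^*:W_k\to Y_h$ be the natural extension operator (extension by zero). Additive Schwarz method. Choose $\mathbf{p}^{(0)}\in C$ and $\tau\in(0,1/N]$. For $n=0,1,2,\dots$: for each $k=1,\dots,N$ let $\mathbf{r}_k^{(n+1)}$ be a minimizer of $\mathcal{F}(\mathbf{p}^{(n)}+R_k^*\mathbf{r}_k)$ over all $\mathbf{r}_k\in W_k$ with $\mathbf{p}^{(n)}+R_k^*\mathbf{r}_k\in C$, and set $\mathbf{p}^{(n+1)}=\mathbf{p}^{(n)}+\tau\sum_{k=1}^N R_k^*\mathbf{r}_k^{(n+1)}$. *)

theory Defs
  imports "HOL-Analysis.Analysis"
begin

section \<open>Pseudo-linear convergence\<close>

text \<open>
  The sequence is only required to be nonnegative: an energy error vanishes as soon as an iterate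
  is a minimizer, so strict positivity cannot be demanded of it.
\<close>

definition converges_pseudo_linearly :: "(nat \<Rightarrow> real) \<Rightarrow> real \<Rightarrow> real \<Rightarrow> bool" where
  "converges_pseudo_linearly a \<gamma> \<epsilon> \<longleftrightarrow>
     (\<forall>n. 0 \<le> a n) \<and> a \<longlonglongrightarrow> 0 \<and> 0 < \<gamma> \<and> \<gamma> < 1 \<and> 0 < \<epsilon> \<and>
     (\<exists>c>0. \<forall>n. a n \<le> \<gamma> ^ n * c + \<epsilon>)"


section \<open>The space \<open>H\<^sub>0(div; S)\<close>\<close>

definition square_integrable_on ::
  "(real \<times> real) set \<Rightarrow> (real \<times> real \<Rightarrow> 'b::euclidean_space) \<Rightarrow> bool" where
  "square_integrable_on S f \<longleftrightarrow>
     f \<in> borel_measurable (lebesgue_on S) \<and> integrable (lebesgue_on S) (\<lambda>x. (norm (f x))\<^sup>2)"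

definition C1_with_gradient ::
  "(real \<times> real) set \<Rightarrow> (real \<times> real \<Rightarrow> real) \<Rightarrow> (real \<times> real \<Rightarrow> real \<times> real) \<Rightarrow> bool" where
  "C1_with_gradient S \<phi> D\<phi> \<longleftrightarrow> (\<forall>x\<in>S. GDERIV \<phi> x :> D\<phi> x) \<and> continuous_on S D\<phi>"

definition weak_divergence ::
  "(real \<times> real) set \<Rightarrow> (real \<times> real \<Rightarrow> real \<times> real) \<Rightarrow> (real \<times> real \<Rightarrow> real) \<Rightarrow> bool" where
  "weak_divergence S p g \<longleftrightarrow>
     (\<forall>\<phi> D\<phi>. C1_with_gradient S \<phi> D\<phi> \<longrightarrow>
        (\<exists>K. compact K \<and> K \<subseteq> S \<and> (\<forall>x\<in>S - K. \<phi> x = 0)) \<longrightarrow>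
        (\<integral>x. p x \<bullet> D\<phi> x \<partial>lebesgue_on S) = - (\<integral>x. g x * \<phi> x \<partial>lebesgue_on S))"

text \<open>
  The normal trace of \<open>p\<close> on the boundary of \<open>S\<close> is the functional given by Green's formula,
  \<open>\<phi> \<mapsto> \<integral>\<^sub>S p \<bullet> \<nabla>\<phi> + (div p) \<phi>\<close>. The test functions below are dense in the Sobolev space \<open>H\<^sup>1(S)\<close>
  when \<open>S\<close> is a finite disjoint union of open rectangles, the only case in which the notion
  is used. They need not extend continuously across a piece of boundary common to two
  rectangles, so the normal component is required to vanish there from either side.
\<close>

definition zero_normal_trace ::
  "(real \<times> real) set \<Rightarrow> (real \<times> real \<Rightarrow> real \<times> real) \<Rightarrow> (real \<times> real \<Rightarrow> real) \<Rightarrow> bool" where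
  "zero_normal_trace S p g \<longleftrightarrow>
     (\<forall>\<phi> D\<phi>. C1_with_gradient S \<phi> D\<phi> \<longrightarrow> bounded (\<phi> ` S) \<longrightarrow> bounded (D\<phi> ` S) \<longrightarrow>
        (\<integral>x. p x \<bullet> D\<phi> x \<partial>lebesgue_on S) + (\<integral>x. g x * \<phi> x \<partial>lebesgue_on S) = 0)"

definition H0div :: "(real \<times> real) set \<Rightarrow> (real \<times> real \<Rightarrow> real \<times> real) set" where
  "H0div S = {p. square_integrable_on S p \<and>
     (\<exists>g. square_integrable_on S g \<and> weak_divergence S p g \<and> zero_normal_trace S p g)}"


section \<open>Discretization\<close>

definition Omega :: "nat \<Rightarrow> nat \<Rightarrow> real \<Rightarrow> (real \<times> real) set" where
  "Omega m1 m2 h = {0<..<real m1 * h} \<times> {0<..<real m2 * h}"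

text \<open>
  Elements are named by the index of their lower left corner. The half-open elements partition
  \<open>\<Omega>\<close> up to a null set, so each class of almost everywhere equal piecewise constant (or
  piecewise \<open>RT\<^sub>0\<close>) fields has exactly one representative that has the prescribed form
  on every half-open element and vanishes off their union. \<open>X_h\<close> and \<open>RT_space\<close> consist of these
  representatives.
\<close>

definition elem :: "real \<Rightarrow> nat \<times> nat \<Rightarrow> (real \<times> real) set" where
  "elem h = (\<lambda>(i, j). {real i * h..<(real i + 1) * h} \<times> {real j * h..<(real j + 1) * h})"

definition elements :: "nat \<Rightarrow> nat \<Rightarrow> (nat \<times> nat) set" where
  "elements m1 m2 = {..<m1} \<times> {..<m2}"

definition X_h :: "nat \<Rightarrow> nat \<Rightarrow> real \<Rightarrow> (real \<times> real \<Rightarrow> real) set" where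
  "X_h m1 m2 h = {u. (\<forall>T\<in>elements m1 m2. \<exists>c. \<forall>x\<in>elem h T. u x = c) \<and>
     (\<forall>x. x \<notin> (\<Union>T\<in>elements m1 m2. elem h T) \<longrightarrow> u x = 0)}"

definition elem_value :: "real \<Rightarrow> (real \<times> real \<Rightarrow> real) \<Rightarrow> nat \<times> nat \<Rightarrow> real" where
  "elem_value h u = (\<lambda>(i, j). u (real i * h, real j * h))"

definition inner_X ::
  "nat \<Rightarrow> nat \<Rightarrow> real \<Rightarrow> (real \<times> real \<Rightarrow> real) \<Rightarrow> (real \<times> real \<Rightarrow> real) \<Rightarrow> real" where
  "inner_X m1 m2 h u v = h\<^sup>2 * (\<Sum>T\<in>elements m1 m2. elem_value h u T * elem_value h v T)"

definition norm_X :: "nat \<Rightarrow> nat \<Rightarrow> real \<Rightarrow> (real \<times> real \<Rightarrow> real) \<Rightarrow> real" where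
  "norm_X m1 m2 h u = sqrt (inner_X m1 m2 h u u)"

definition RT_space ::
  "real \<Rightarrow> (real \<times> real) set \<Rightarrow> (nat \<times> nat) set \<Rightarrow> (real \<times> real \<Rightarrow> real \<times> real) set" where
  "RT_space h S \<T> = {p \<in> H0div S.
     (\<forall>T\<in>\<T>. \<exists>a1 b1 a2 b2. \<forall>(x1, x2)\<in>elem h T. p (x1, x2) = (a1 + b1 * x1, a2 + b2 * x2)) \<and>
     (\<forall>x. x \<notin> (\<Union>T\<in>\<T>. elem h T) \<longrightarrow> p x = 0)}"

definition Y_h :: "nat \<Rightarrow> nat \<Rightarrow> real \<Rightarrow> (real \<times> real \<Rightarrow> real \<times> real) set" where
  "Y_h m1 m2 h = RT_space h (Omega m1 m2 h) (elements m1 m2)"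

definition div_h ::
  "nat \<Rightarrow> nat \<Rightarrow> real \<Rightarrow> (real \<times> real \<Rightarrow> real \<times> real) \<Rightarrow> (real \<times> real \<Rightarrow> real)" where
  "div_h m1 m2 h p = (THE g. g \<in> X_h m1 m2 h \<and> weak_divergence (Omega m1 m2 h) p g)"

text \<open>
  \<open>VEdge i j\<close> is the vertical edge from \<open>(i h, j h)\<close> to \<open>(i h, (j + 1) h)\<close>, with normal \<open>(1, 0)\<close>;
  \<open>HEdge i j\<close> is the horizontal edge from \<open>(i h, j h)\<close> to \<open>((i + 1) h, j h)\<close>, with normal \<open>(0, 1)\<close>.
  On an edge, the representative \<open>p\<close> takes the values of the element to the right of, or
  above, the edge; its normal component there is the one seen from either side.
\<close>

datatype edge = VEdge nat nat | HEdge nat nat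

definition interior_edges :: "nat \<Rightarrow> nat \<Rightarrow> edge set" where
  "interior_edges m1 m2 =
     {VEdge i j |i j. 1 \<le> i \<and> i < m1 \<and> j < m2} \<union> {HEdge i j |i j. i < m1 \<and> 1 \<le> j \<and> j < m2}"

fun edge_value :: "real \<Rightarrow> (real \<times> real \<Rightarrow> real \<times> real) \<Rightarrow> edge \<Rightarrow> real" where
  "edge_value h p (VEdge i j) =
     1 / h * integral {real j * h..(real j + 1) * h} (\<lambda>y. p (real i * h, y) \<bullet> (1, 0))"
| "edge_value h p (HEdge i j) =
     1 / h * integral {real i * h..(real i + 1) * h} (\<lambda>x. p (x, real j * h) \<bullet> (0, 1))"

definition C_h :: "nat \<Rightarrow> nat \<Rightarrow> real \<Rightarrow> (real \<times> real \<Rightarrow> real \<times> real) set" where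
  "C_h m1 m2 h = {p \<in> Y_h m1 m2 h. \<forall>e\<in>interior_edges m1 m2. \<bar>edge_value h p e\<bar> \<le> 1}"


section \<open>The functional\<close>

definition convex_on_X ::
  "nat \<Rightarrow> nat \<Rightarrow> real \<Rightarrow> ((real \<times> real \<Rightarrow> real) \<Rightarrow> real) \<Rightarrow> bool" where
  "convex_on_X m1 m2 h G \<longleftrightarrow>
     (\<forall>u\<in>X_h m1 m2 h. \<forall>v\<in>X_h m1 m2 h. \<forall>t\<in>{0..1}.
        G (\<lambda>x. (1 - t) * u x + t * v x) \<le> (1 - t) * G u + t * G v)"

definition strongly_convex_X ::
  "nat \<Rightarrow> nat \<Rightarrow> real \<Rightarrow> real \<Rightarrow> ((real \<times> real \<Rightarrow> real) \<Rightarrow> real) \<Rightarrow> bool" where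
  "strongly_convex_X m1 m2 h \<alpha> F \<longleftrightarrow>
     convex_on_X m1 m2 h (\<lambda>u. F u - \<alpha> / 2 * (norm_X m1 m2 h u)\<^sup>2)"

text \<open>
  The Frechet derivative of \<open>F\<close> at \<open>u\<close> is identified with its Riesz representative in \<open>X_h\<close>.
\<close>

definition frechet_derivative_X ::
  "nat \<Rightarrow> nat \<Rightarrow> real \<Rightarrow> ((real \<times> real \<Rightarrow> real) \<Rightarrow> real) \<Rightarrow>
     (real \<times> real \<Rightarrow> real) \<Rightarrow> (real \<times> real \<Rightarrow> real) \<Rightarrow> bool" where
  "frechet_derivative_X m1 m2 h F u g \<longleftrightarrow>
     g \<in> X_h m1 m2 h \<and>
     (\<forall>e>0. \<exists>d>0. \<forall>v\<in>X_h m1 m2 h. norm_X m1 m2 h v < d \<longrightarrow>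
        \<bar>F (\<lambda>x. u x + v x) - F u - inner_X m1 m2 h g v\<bar> \<le> e * norm_X m1 m2 h v)"

definition Lipschitz_differentiable_X ::
  "nat \<Rightarrow> nat \<Rightarrow> real \<Rightarrow> real \<Rightarrow> ((real \<times> real \<Rightarrow> real) \<Rightarrow> real) \<Rightarrow> bool" where
  "Lipschitz_differentiable_X m1 m2 h \<beta> F \<longleftrightarrow>
     (\<exists>F'. (\<forall>u\<in>X_h m1 m2 h. frechet_derivative_X m1 m2 h F u (F' u)) \<and>
        (\<forall>u\<in>X_h m1 m2 h. \<forall>v\<in>X_h m1 m2 h.
           norm_X m1 m2 h (\<lambda>x. F' u x - F' v x) \<le> \<beta> * norm_X m1 m2 h (\<lambda>x. u x - v x)))"

text \<open>
  For strongly convex \<open>F\<close> the supremum is over a set that is bounded above, so the real-valued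
  supremum is the Legendre--Fenchel conjugate.
\<close>

definition conjugate_X ::
  "nat \<Rightarrow> nat \<Rightarrow> real \<Rightarrow> ((real \<times> real \<Rightarrow> real) \<Rightarrow> real) \<Rightarrow> (real \<times> real \<Rightarrow> real) \<Rightarrow> real" where
  "conjugate_X m1 m2 h F v = (SUP u\<in>X_h m1 m2 h. inner_X m1 m2 h u v - F u)"

definition dual_energy ::
  "nat \<Rightarrow> nat \<Rightarrow> real \<Rightarrow> ((real \<times> real \<Rightarrow> real) \<Rightarrow> real) \<Rightarrow>
     (real \<times> real \<Rightarrow> real \<times> real) \<Rightarrow> real" where
  "dual_energy m1 m2 h F p = conjugate_X m1 m2 h F (div_h m1 m2 h p)"

definition dual_solution ::
  "nat \<Rightarrow> nat \<Rightarrow> real \<Rightarrow> ((real \<times> real \<Rightarrow> real) \<Rightarrow> real) \<Rightarrow>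
     (real \<times> real \<Rightarrow> real \<times> real) \<Rightarrow> bool" where
  "dual_solution m1 m2 h F p \<longleftrightarrow>
     p \<in> C_h m1 m2 h \<and> (\<forall>q\<in>C_h m1 m2 h. dual_energy m1 m2 h F p \<le> dual_energy m1 m2 h F q)"


section \<open>Overlapping domain decomposition\<close>

definition subdomains :: "nat \<Rightarrow> nat \<Rightarrow> (nat \<times> nat) set" where
  "subdomains n1 n2 = {..<n1} \<times> {..<n2}"

text \<open>
  \<open>\<Omega>\<^sub>s\<close> is the open square of side \<open>H\<close> with lower left corner \<open>(s\<^sub>1 H, s\<^sub>2 H)\<close>; this is \<open>\<Omega>'\<^sub>s\<close>.
\<close>

definition enlarged_subdomain ::
  "nat \<Rightarrow> nat \<Rightarrow> real \<Rightarrow> real \<Rightarrow> real \<Rightarrow> nat \<times> nat \<Rightarrow> (real \<times> real) set" where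
  "enlarged_subdomain m1 m2 h H \<delta> = (\<lambda>(s1, s2). Omega m1 m2 h \<inter>
     ({real s1 * H - \<delta><..<(real s1 + 1) * H + \<delta>} \<times>
      {real s2 * H - \<delta><..<(real s2 + 1) * H + \<delta>}))"

text \<open>
  The subdomains and the layers consist of whole elements, so \<open>H\<close> and \<open>\<delta>\<close> are multiples of \<open>h\<close>.
\<close>

definition overlapping_decomposition ::
  "nat \<Rightarrow> nat \<Rightarrow> real \<Rightarrow> nat \<Rightarrow> nat \<Rightarrow> real \<Rightarrow> real \<Rightarrow> nat \<Rightarrow> (nat \<times> nat \<Rightarrow> nat) \<Rightarrow> bool" where
  "overlapping_decomposition m1 m2 h n1 n2 H \<delta> N col \<longleftrightarrow>
     0 < m1 \<and> 0 < m2 \<and> 0 < h \<and>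
     (\<exists>M>0. H = real M * h \<and> m1 = n1 * M \<and> m2 = n2 * M) \<and>
     (\<exists>d>0. \<delta> = real d * h) \<and>
     1 \<le> N \<and> N \<le> 4 \<and>
     (\<forall>s\<in>subdomains n1 n2. col s \<in> {1..N}) \<and>
     (\<forall>s\<in>subdomains n1 n2. \<forall>t\<in>subdomains n1 n2. s \<noteq> t \<longrightarrow> col s = col t \<longrightarrow>
        enlarged_subdomain m1 m2 h H \<delta> s \<inter> enlarged_subdomain m1 m2 h H \<delta> t = {})"

definition colored_region ::
  "nat \<Rightarrow> nat \<Rightarrow> real \<Rightarrow> nat \<Rightarrow> nat \<Rightarrow> real \<Rightarrow> real \<Rightarrow> (nat \<times> nat \<Rightarrow> nat) \<Rightarrow> nat \<Rightarrow>
     (real \<times> real) set" where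
  "colored_region m1 m2 h n1 n2 H \<delta> col k =
     (\<Union>s\<in>{s \<in> subdomains n1 n2. col s = k}. enlarged_subdomain m1 m2 h H \<delta> s)"

definition elements_in :: "nat \<Rightarrow> nat \<Rightarrow> real \<Rightarrow> (real \<times> real) set \<Rightarrow> (nat \<times> nat) set" where
  "elements_in m1 m2 h S = {T \<in> elements m1 m2. interior (elem h T) \<subseteq> S}"

definition W_k ::
  "nat \<Rightarrow> nat \<Rightarrow> real \<Rightarrow> nat \<Rightarrow> nat \<Rightarrow> real \<Rightarrow> real \<Rightarrow> (nat \<times> nat \<Rightarrow> nat) \<Rightarrow> nat \<Rightarrow>
     (real \<times> real \<Rightarrow> real \<times> real) set" where
  "W_k m1 m2 h n1 n2 H \<delta> col k =
     RT_space h (colored_region m1 m2 h n1 n2 H \<delta> col k)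
       (elements_in m1 m2 h (colored_region m1 m2 h n1 n2 H \<delta> col k))"

definition extend_by_zero ::
  "nat \<Rightarrow> nat \<Rightarrow> real \<Rightarrow> nat \<Rightarrow> nat \<Rightarrow> real \<Rightarrow> real \<Rightarrow> (nat \<times> nat \<Rightarrow> nat) \<Rightarrow> nat \<Rightarrow>
     (real \<times> real \<Rightarrow> real \<times> real) \<Rightarrow> (real \<times> real \<Rightarrow> real \<times> real)" where
  "extend_by_zero m1 m2 h n1 n2 H \<delta> col k r =
     (\<lambda>x. if x \<in> (\<Union>T\<in>elements_in m1 m2 h (colored_region m1 m2 h n1 n2 H \<delta> col k). elem h T)
          then r x else 0)"


section \<open>Additive Schwarz method\<close>

text \<open>
  \<open>p n\<close> is the iterate \<open>p\<^sup>(\<^sup>n\<^sup>)\<close>, and \<open>r n k\<close> is the local correction \<open>r\<^sub>k\<^sup>(\<^sup>n\<^sup>+\<^sup>1\<^sup>)\<close>. Local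
  minimizers need not be unique, hence a predicate on the pair of sequences.
\<close>

definition additive_schwarz ::
  "nat \<Rightarrow> nat \<Rightarrow> real \<Rightarrow> nat \<Rightarrow> nat \<Rightarrow> real \<Rightarrow> real \<Rightarrow> nat \<Rightarrow> (nat \<times> nat \<Rightarrow> nat) \<Rightarrow>
     ((real \<times> real \<Rightarrow> real) \<Rightarrow> real) \<Rightarrow> real \<Rightarrow>
     (nat \<Rightarrow> real \<times> real \<Rightarrow> real \<times> real) \<Rightarrow> (nat \<Rightarrow> nat \<Rightarrow> real \<times> real \<Rightarrow> real \<times> real) \<Rightarrow> bool" where
  "additive_schwarz m1 m2 h n1 n2 H \<delta> N col F \<tau> p r \<longleftrightarrow>
     (let R = extend_by_zero m1 m2 h n1 n2 H \<delta> col;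
          W = W_k m1 m2 h n1 n2 H \<delta> col;
          C = C_h m1 m2 h;
          E = dual_energy m1 m2 h F
      in p 0 \<in> C \<and>
         (\<forall>n. \<forall>k\<in>{1..N}.
            r n k \<in> W k \<and> (\<lambda>x. p n x + R k (r n k) x) \<in> C \<and>
            (\<forall>q\<in>W k. (\<lambda>x. p n x + R k q x) \<in> C \<longrightarrow>
               E (\<lambda>x. p n x + R k (r n k) x) \<le> E (\<lambda>x. p n x + R k q x))) \<and>
         (\<forall>n. p (Suc n) = (\<lambda>x. p n x + \<tau> *\<^sub>R (\<Sum>k = 1..N. R k (r n k) x))))"

end

theory Submission
  imports Defs
begin

text \<open>
  A field in \<open>Y\<^sub>h\<close> is determined by its edge values, and \<open>div\<close> is a difference quotient of these.
  For two feasible fields \<open>p\<close>, \<open>q\<close> and a partition of unity \<open>\<theta>\<^sub>k\<close> on the edges, subordinate to the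
  \<open>S\<^sub>k\<close>, the fields \<open>r\<^sub>k\<close> with edge values \<open>\<theta>\<^sub>k (q - p)\<close> belong to \<open>W\<^sub>k\<close>, sum up to \<open>q - p\<close>, and keep
  \<open>p + t r\<^sub>k\<close> feasible for \<open>0 \<le> t \<le> 1\<close>. As \<open>\<theta>\<^sub>k\<close> has Lipschitz constant \<open>O(1 / \<delta>)\<close> and edge values are
  bounded by one, \<open>\<Sum>\<^sub>k \<parallel>div r\<^sub>k\<parallel>\<^sup>2 \<lesssim> \<parallel>div (q - p)\<parallel>\<^sup>2 + |\<Omega>| / \<delta>\<^sup>2\<close>.

  Strong convexity of \<open>F\<close> makes \<open>\<parallel>\<cdot>\<parallel>\<^sup>2 / (2 \<alpha>) - F\<^sup>*\<close> convex, and Lipschitz continuity of \<open>F'\<close> makes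
  \<open>F\<^sup>* - \<parallel>\<cdot>\<parallel>\<^sup>2 / (2 \<beta>)\<close> convex. Comparing the local minimizers with \<open>t r\<^sub>k\<close> therefore gives
  \<open>\<zeta>\<^sub>n\<^sub>+\<^sub>1 \<le> (1 - \<tau> t) \<zeta>\<^sub>n + O(\<tau> t\<^sup>2 |\<Omega>| / \<delta>\<^sup>2)\<close> for every small \<open>t > 0\<close>: the quadratic gain
  \<open>\<parallel>div (q - p)\<parallel>\<^sup>2 / \<beta>\<close> absorbs the first part of the stability bound.
\<close>

section \<open>Convex analysis on the piecewise constant functions\<close>

text \<open>In general the divergence has a large kernel, so \<open>div (q - p)\<close> does not
  control \<open>q - p\<close>; the edge values are bounded by the constraint alone. The gradient of
  the cut-off therefore costs an additive constant and not a multiple of the energy, which leaves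
  only pseudo-linear convergence. No derivative of the conjugate is used: its two convexity
  properties, applied at the average of the local competitors, replace a linearization.
  \<open>Y_h\<close> is defined by H(div) regularity, so the description by edge values has to be
  derived. One direction is Green's formula for the shape functions of the edges. The other is
  continuity of normal components across grid lines, obtained from Green's formula with shrinking
  test functions; after extension by zero, the boundary condition is a case of this continuity. The
  threshold is \<open>256 * t\<^sub>0\<close> times |\<Omega>| / \<delta>^2: each color contributes
  128, there are at most four colors, and semiconcavity of the conjugate brings a factor 1 /
  2.\<close>

lemma elem_value_simps:
  "elem_value h (\<lambda>x. u x + v x) T = elem_value h u T + elem_value h v T"
  "elem_value h (\<lambda>x. u x - v x) T = elem_value h u T - elem_value h v T"
  "elem_value h (\<lambda>x. c * u x) T = c * elem_value h u T"
  "elem_value h (\<lambda>x. \<Sum>i\<in>I. w i x) T = (\<Sum>i\<in>I. elem_value h (w i) T)"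
  by (cases T; simp add: elem_value_def)+

text \<open>For a squared norm the assumption is the identity
  \<open>inner_X_convex_combination\<close>. Convexity of \<open>f - c q\<close> then amounts to
  Jensen's inequality for \<open>f\<close> with the gain \<open>c t (1 - t) qd\<close>, the form in
  which strong convexity is applied.\<close>

lemma convex_combination_minus_quadratic:
  fixes c q :: real
  assumes "qm = (1 - t) * qv + t * qw - t * (1 - t) * qd"
  shows "fm - c * qm \<le> (1 - t) * (fv - c * qv) + t * (fw - c * qw)
    \<longleftrightarrow> fm \<le> (1 - t) * fv + t * fw - c * (t * (1 - t) * qd)"
proof -
  have "c * qm = (1 - t) * (c * qv) + t * (c * qw) - c * (t * (1 - t) * qd)"
    unfolding assms by (simp add: algebra_simps)
  moreover have "(1 - t) * (fv - c * qv) = (1 - t) * fv - (1 - t) * (c * qv)"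
    "t * (fw - c * qw) = t * fw - t * (c * qw)"
    by (rule right_diff_distrib)+
  ultimately show ?thesis by linarith
qed

context
  fixes m1 m2 :: nat and h :: real
begin

private abbreviation (input) "X \<equiv> X_h m1 m2 h"
private abbreviation (input) "ip \<equiv> inner_X m1 m2 h"
private abbreviation (input) "nX \<equiv> norm_X m1 m2 h"

section \<open>Linear structure and inner product of \<open>X_h\<close>\<close>

lemma X_h_add: "u \<in> X \<Longrightarrow> v \<in> X \<Longrightarrow> (\<lambda>x. u x + v x) \<in> X"
  and X_h_mult: "u \<in> X \<Longrightarrow> (\<lambda>x. c * u x) \<in> X"
  unfolding X_h_def by fastforce+

lemma X_h_diff: "u \<in> X \<Longrightarrow> v \<in> X \<Longrightarrow> (\<lambda>x. u x - v x) \<in> X"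
  unfolding X_h_def by fastforce

lemma X_h_zero: "(\<lambda>x. 0) \<in> X"
  unfolding X_h_def by fastforce

lemma X_h_sum: "(\<And>i. i \<in> I \<Longrightarrow> u i \<in> X) \<Longrightarrow> (\<lambda>x. \<Sum>i\<in>I. u i x) \<in> X"
  by (induction I rule: infinite_finite_induct) (auto simp: X_h_zero intro: X_h_add)

lemma inner_X_commute: "ip u v = ip v u"
  by (simp add: inner_X_def mult.commute)

lemma inner_X_lin:
  "ip (\<lambda>x. u x + v x) w = ip u w + ip v w"
  "ip (\<lambda>x. u x - v x) w = ip u w - ip v w"
  "ip (\<lambda>x. c * u x) w = c * ip u w"
  "ip (\<lambda>x. \<Sum>i\<in>I. z i x) w = (\<Sum>i\<in>I. ip (z i) w)"
proof -
  show "ip (\<lambda>x. u x + v x) w = ip u w + ip v w"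
    "ip (\<lambda>x. u x - v x) w = ip u w - ip v w"
    "ip (\<lambda>x. c * u x) w = c * ip u w"
    by (simp_all add: inner_X_def elem_value_simps algebra_simps sum.distrib sum_subtractf
      flip: sum_distrib_left sum_distrib_right)
  show "ip (\<lambda>x. \<Sum>i\<in>I. z i x) w = (\<Sum>i\<in>I. ip (z i) w)"
    unfolding inner_X_def elem_value_simps sum_distrib_right sum_distrib_left
    by (rule sum.swap)
qed

lemma inner_X_lin_right:
  "ip w (\<lambda>x. u x + v x) = ip w u + ip w v"
  "ip w (\<lambda>x. u x - v x) = ip w u - ip w v"
  "ip w (\<lambda>x. c * u x) = c * ip w u"
  "ip w (\<lambda>x. \<Sum>i\<in>I. z i x) = (\<Sum>i\<in>I. ip w (z i))"
  by (simp_all only: inner_X_commute[of w] inner_X_lin)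

lemma inner_X_ge_zero: "0 \<le> ip u u"
  by (simp add: inner_X_def sum_nonneg)

lemma inner_X_convex_combination:
  "ip (\<lambda>x. (1 - t) * u x + t * v x) (\<lambda>x. (1 - t) * u x + t * v x)
    = (1 - t) * ip u u + t * ip v v - t * (1 - t) * ip (\<lambda>x. u x - v x) (\<lambda>x. u x - v x)"
  by (simp add: inner_X_lin inner_X_lin_right inner_X_commute[of v u] algebra_simps)

lemmas convex_minus_square_iff = convex_combination_minus_quadratic[OF inner_X_convex_combination]

lemma norm_X_square: "(nX u)\<^sup>2 = ip u u"
  by (simp add: norm_X_def inner_X_ge_zero)

lemma norm_X_nonneg: "0 \<le> nX u"
  by (simp add: norm_X_def inner_X_ge_zero)

lemma norm_X_mult: "nX (\<lambda>x. c * u x) = \<bar>c\<bar> * nX u"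
  by (simp add: norm_X_def inner_X_lin inner_X_lin_right real_sqrt_mult flip: mult.assoc)

lemma inner_X_Cauchy_Schwarz: "\<bar>ip u v\<bar> \<le> nX u * nX v"
proof -
  let ?E = "elements m1 m2"
  have n: "nX w = \<bar>h\<bar> * L2_set (elem_value h w) ?E" for w
    by (simp add: norm_X_def inner_X_def L2_set_def real_sqrt_mult power2_eq_square)
  have "\<bar>\<Sum>T\<in>?E. elem_value h u T * elem_value h v T\<bar>
      \<le> (\<Sum>T\<in>?E. \<bar>elem_value h u T\<bar> * \<bar>elem_value h v T\<bar>)"
    unfolding abs_mult[symmetric] by (rule sum_abs)
  also have "\<dots> \<le> L2_set (elem_value h u) ?E * L2_set (elem_value h v) ?E"
    by (rule L2_set_mult_ineq)
  finally have "h\<^sup>2 * \<bar>\<Sum>T\<in>?E. elem_value h u T * elem_value h v T\<bar>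
      \<le> h\<^sup>2 * (L2_set (elem_value h u) ?E * L2_set (elem_value h v) ?E)"
    by (rule mult_left_mono) simp
  then show ?thesis
    by (simp add: inner_X_def n abs_mult power2_eq_square mult_ac)
qed

lemma inner_X_Young:
  assumes "0 < a"
  shows "ip u v \<le> a / 2 * ip u u + 1 / (2 * a) * ip v v"
proof -
  have "0 \<le> ip (\<lambda>x. a * u x - v x) (\<lambda>x. a * u x - v x)"
    by (rule inner_X_ge_zero)
  also have "\<dots> = a\<^sup>2 * ip u u - 2 * a * ip u v + ip v v"
    by (simp add: inner_X_lin inner_X_lin_right inner_X_commute[of v u] power2_eq_square algebra_simps)
  finally have "2 * a * ip u v \<le> a\<^sup>2 * ip u u + ip v v" by simp
  then have "ip u v \<le> (a\<^sup>2 * ip u u + ip v v) / (2 * a)"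
    using assms by (simp add: field_simps)
  also have "\<dots> = a / 2 * ip u u + 1 / (2 * a) * ip v v"
    using assms by (simp add: field_simps power2_eq_square)
  finally show ?thesis .
qed

text \<open>Jensen's inequality by induction: one point is split off and the remaining weights are
  renormalized. If the split-off weight is one, nothing remains to be renormalized and the other
  weights vanish.\<close>

lemma convex_on_X_sum:
  assumes "convex_on_X m1 m2 h G" "finite I" "\<And>i. i \<in> I \<Longrightarrow> u i \<in> X"
    and "\<And>i. i \<in> I \<Longrightarrow> 0 \<le> w i" "(\<Sum>i\<in>I. w i) = 1"
  shows "G (\<lambda>x. \<Sum>i\<in>I. w i * u i x) \<le> (\<Sum>i\<in>I. w i * G (u i))"
  using assms(2-)
proof (induction I arbitrary: w rule: finite_induct)
  case empty
  then show ?case by simp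
next
  case (insert j I)
  show ?case
  proof (cases "w j = 1")
    case True
    then have "sum w I = 0" using insert.prems(3) insert.hyps by simp
    then have "\<forall>i\<in>I. w i = 0"
      using insert.prems(2) insert.hyps by (subst (asm) sum_nonneg_eq_0_iff) auto
    then show ?thesis using True insert.hyps by simp
  next
    case False
    have s: "sum w I = 1 - w j" using insert.prems(3) insert.hyps by simp
    moreover have "0 \<le> sum w I" using insert.prems(2) by (auto intro: sum_nonneg)
    ultimately have lt: "0 < 1 - w j" using False by linarith
    let ?v = "\<lambda>x. \<Sum>i\<in>I. w i / (1 - w j) * u i x"
    have IH: "G ?v \<le> (\<Sum>i\<in>I. w i / (1 - w j) * G (u i))"
      using insert.prems lt s by (intro insert.IH) (auto simp flip: sum_divide_distrib)
    have v: "?v \<in> X" using insert.prems(1) by (intro X_h_sum X_h_mult) auto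
    have scale: "(1 - w j) * (\<Sum>i\<in>I. w i / (1 - w j) * f i) = (\<Sum>i\<in>I. w i * f i)" for f
      using lt by (simp add: sum_distrib_left)
    have "(\<lambda>x. \<Sum>i\<in>insert j I. w i * u i x) = (\<lambda>x. (1 - w j) * ?v x + w j * u j x)"
      by (rule ext) (simp only: scale sum.insert[OF insert.hyps] add.commute)
    then have "G (\<lambda>x. \<Sum>i\<in>insert j I. w i * u i x) = G (\<lambda>x. (1 - w j) * ?v x + w j * u j x)"
      by (rule arg_cong)
    also have "\<dots> \<le> (1 - w j) * G ?v + w j * G (u j)"
      using assms(1) v insert.prems lt unfolding convex_on_X_def by auto
    also have "\<dots> \<le> (1 - w j) * (\<Sum>i\<in>I. w i / (1 - w j) * G (u i)) + w j * G (u j)"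
      using IH lt by simp
    also have "\<dots> = (\<Sum>i\<in>insert j I. w i * G (u i))"
      unfolding scale using insert.hyps by simp
    finally show ?thesis .
  qed
qed

section \<open>Strong convexity and Lipschitz gradients as inequalities on segments\<close>

lemma strongly_convex_XD:
  assumes "strongly_convex_X m1 m2 h \<alpha> F" "u \<in> X" "v \<in> X" "0 \<le> t" "t \<le> 1"
  shows "F (\<lambda>x. (1 - t) * u x + t * v x)
    \<le> (1 - t) * F u + t * F v - \<alpha> / 2 * (t * (1 - t) * ip (\<lambda>x. u x - v x) (\<lambda>x. u x - v x))"
proof -
  let ?z = "\<lambda>x. (1 - t) * u x + t * v x"
  have "F ?z - \<alpha> / 2 * ip ?z ?z
      \<le> (1 - t) * (F u - \<alpha> / 2 * ip u u) + t * (F v - \<alpha> / 2 * ip v v)"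
    using assms by (auto simp: strongly_convex_X_def convex_on_X_def norm_X_square)
  then show ?thesis unfolding convex_minus_square_iff .
qed

lemma frechet_line_DERIV:
  assumes "frechet_derivative_X m1 m2 h F (\<lambda>x. u x + s * w x) g" "w \<in> X"
  shows "((\<lambda>s. F (\<lambda>x. u x + s * w x)) has_real_derivative ip g w) (at s)"
proof -
  let ?f = "\<lambda>s. F (\<lambda>x. u x + s * w x)"
  have "\<exists>d>0. \<forall>t. t \<noteq> 0 \<and> \<bar>t\<bar> < d \<longrightarrow> \<bar>(?f (s + t) - ?f s) / t - ip g w\<bar> < e" if "0 < e" for e
  proof -
    \<comment> \<open>The summand 1 keeps the quotients below meaningful when \<open>w\<close> has
      norm zero.\<close>
    let ?n = "nX w + 1"
    have n: "0 < ?n" using norm_X_nonneg[of w] by simp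
    obtain d where d: "0 < d"
      and D: "\<And>v. v \<in> X \<Longrightarrow> nX v < d \<Longrightarrow>
        \<bar>F (\<lambda>x. (u x + s * w x) + v x) - ?f s - ip g v\<bar> \<le> e / ?n * nX v"
      using assms(1) \<open>0 < e\<close> n unfolding frechet_derivative_X_def by (meson divide_pos_pos)
    show ?thesis
    proof (intro exI[of _ "d / ?n"] conjI allI impI)
      show "0 < d / ?n" using d n by simp
      fix t assume t: "t \<noteq> 0 \<and> \<bar>t\<bar> < d / ?n"
      have "\<bar>t\<bar> * nX w \<le> \<bar>t\<bar> * ?n" by (simp add: mult_left_mono)
      also have "\<dots> < d" using t n by (simp add: field_simps)
      finally have "\<bar>F (\<lambda>x. (u x + s * w x) + t * w x) - ?f s - ip g (\<lambda>x. t * w x)\<bar>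
          \<le> e / ?n * nX (\<lambda>x. t * w x)"
        by (intro D X_h_mult assms(2)) (simp add: norm_X_mult)
      moreover have "(\<lambda>x. (u x + s * w x) + t * w x) = (\<lambda>x. u x + (s + t) * w x)"
        by (simp add: algebra_simps)
      ultimately have "\<bar>?f (s + t) - ?f s - t * ip g w\<bar> \<le> e / ?n * (\<bar>t\<bar> * nX w)"
        by (simp add: inner_X_lin_right norm_X_mult)
      also have "\<dots> < e * \<bar>t\<bar>"
        using t n \<open>0 < e\<close> by (simp add: field_simps)
      finally have "\<bar>(?f (s + t) - ?f s - t * ip g w) / t\<bar> < e"
        using t by (simp add: abs_divide divide_less_eq)
      then show "\<bar>(?f (s + t) - ?f s) / t - ip g w\<bar> < e"
        using t by (simp add: diff_divide_distrib)
    qed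
  qed
  then show ?thesis
    unfolding DERIV_def LIM_def dist_real_def diff_0_right by blast
qed

text \<open>Along the segment from \<open>u\<close> to \<open>u + w\<close>, the difference of the
  two sides has derivative \<open>ip (F' (u + s w) - F' u) w - \<beta> s (ip w w)\<close>, which
  Cauchy-Schwarz and the Lipschitz bound make nonpositive.\<close>

lemma Lipschitz_gradient_upper:
  assumes "\<forall>u\<in>X. frechet_derivative_X m1 m2 h F u (F' u)"
    and L: "\<forall>u\<in>X. \<forall>v\<in>X. nX (\<lambda>x. F' u x - F' v x) \<le> \<beta> * nX (\<lambda>x. u x - v x)"
    and u: "u \<in> X" and w: "w \<in> X"
  shows "F (\<lambda>x. u x + w x) \<le> F u + ip (F' u) w + \<beta> / 2 * ip w w"
proof -
  let ?l = "\<lambda>s x. u x + s * w x"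
  let ?g = "\<lambda>s. F (?l s) - s * ip (F' u) w - \<beta> / 2 * s\<^sup>2 * ip w w"
  have l: "?l s \<in> X" for s using u w by (intro X_h_add X_h_mult)
  have D: "(?g has_real_derivative ip (F' (?l s)) w - ip (F' u) w - \<beta> * s * ip w w) (at s)" for s
    using assms(1) l w
    by (auto intro!: derivative_eq_intros frechet_line_DERIV[of F u s w "F' (?l s)"] simp: power2_eq_square)
  have "?g 1 \<le> ?g 0"
  proof (rule DERIV_nonpos_imp_nonincreasing[of 0 1])
    fix s :: real assume s: "0 \<le> s" "s \<le> 1"
    have "ip (F' (?l s)) w - ip (F' u) w = ip (\<lambda>x. F' (?l s) x - F' u x) w"
      by (simp add: inner_X_lin)
    also have "\<dots> \<le> nX (\<lambda>x. F' (?l s) x - F' u x) * nX w"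
      using inner_X_Cauchy_Schwarz abs_le_D1 by blast
    also have "\<dots> \<le> (\<beta> * nX (\<lambda>x. ?l s x - u x)) * nX w"
      using L l u by (intro mult_right_mono norm_X_nonneg) blast
    also have "\<dots> = \<beta> * s * ip w w"
      using s by (simp add: norm_X_mult power2_eq_square flip: norm_X_square)
    finally show "\<exists>y. (?g has_real_derivative y) (at s) \<and> y \<le> 0" using D by force
  qed simp
  then show ?thesis by simp
qed

text \<open>The quadratic upper bound is taken at the intermediate point \<open>z\<close>, from
  which \<open>u\<close> and \<open>v\<close> lie at the multiples t and t - 1 of
  \<open>u - v\<close>. With weights 1 - t and t the linear terms cancel, leaving an inequality
  without gradients that can be dualized.\<close>

lemma Lipschitz_differentiable_XD:
  assumes "Lipschitz_differentiable_X m1 m2 h \<beta> F" "u \<in> X" "v \<in> X" "0 \<le> t" "t \<le> 1"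
  shows "(1 - t) * F u + t * F v - \<beta> / 2 * (t * (1 - t) * ip (\<lambda>x. u x - v x) (\<lambda>x. u x - v x))
    \<le> F (\<lambda>x. (1 - t) * u x + t * v x)"
proof -
  obtain F' where F': "\<forall>u\<in>X. frechet_derivative_X m1 m2 h F u (F' u)"
      "\<forall>u\<in>X. \<forall>v\<in>X. nX (\<lambda>x. F' u x - F' v x) \<le> \<beta> * nX (\<lambda>x. u x - v x)"
    using assms(1) unfolding Lipschitz_differentiable_X_def by blast
  let ?z = "\<lambda>x. (1 - t) * u x + t * v x"
  let ?d = "\<lambda>x. u x - v x"
  have z: "?z \<in> X" and d: "?d \<in> X" using assms by (auto intro!: X_h_add X_h_mult X_h_diff)
  have up: "F (\<lambda>x. ?z x + c * ?d x) \<le> F ?z + c * ip (F' ?z) ?d + \<beta> / 2 * (c\<^sup>2 * ip ?d ?d)" for c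
    using Lipschitz_gradient_upper[OF F' z X_h_mult[OF d, of c]]
    by (simp add: inner_X_lin(3) inner_X_lin_right(3) power2_eq_square)
  have "(\<lambda>x. ?z x + t * ?d x) = u" "(\<lambda>x. ?z x + (t - 1) * ?d x) = v"
    by (simp_all add: algebra_simps)
  with up[of t] up[of "t - 1"]
  have "F u \<le> F ?z + t * ip (F' ?z) ?d + \<beta> / 2 * (t\<^sup>2 * ip ?d ?d)"
    "F v \<le> F ?z + (t - 1) * ip (F' ?z) ?d + \<beta> / 2 * ((t - 1)\<^sup>2 * ip ?d ?d)" by simp_all
  then have "(1 - t) * F u + t * F v
      \<le> (1 - t) * (F ?z + t * ip (F' ?z) ?d + \<beta> / 2 * (t\<^sup>2 * ip ?d ?d))
        + t * (F ?z + (t - 1) * ip (F' ?z) ?d + \<beta> / 2 * ((t - 1)\<^sup>2 * ip ?d ?d))"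
    using assms by (intro add_mono mult_left_mono) auto
  also have "\<dots> = F ?z + \<beta> / 2 * (t * (1 - t) * ip ?d ?d)"
    by (simp add: power2_eq_square field_simps)
  finally show ?thesis by simp
qed

section \<open>The conjugate of a strongly convex function with Lipschitz gradient\<close>

context
  fixes F \<alpha> \<beta>
  assumes \<alpha>: "0 < \<alpha>" and \<beta>: "0 < \<beta>"
    and sc: "strongly_convex_X m1 m2 h \<alpha> F" and Lip: "Lipschitz_differentiable_X m1 m2 h \<beta> F"
begin

private abbreviation (input) "F\<^sub>c \<equiv> conjugate_X m1 m2 h F"

text \<open>Quadratic growth makes the supremum in \<open>conjugate_X\<close> finite. Strong
  convexity between 0 and \<open>u\<close>, divided by t, bounds the difference quotient of
  \<open>F\<close> at 0; letting t tend to 0 from the right gives the supporting paraboloid.\<close>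

lemma strongly_convex_X_minorant:
  obtains g where "\<And>u. u \<in> X \<Longrightarrow> F (\<lambda>x. 0) + ip g u + \<alpha> / 2 * ip u u \<le> F u"
proof -
  let ?O = "\<lambda>x :: real \<times> real. 0 :: real"
  obtain g where g: "frechet_derivative_X m1 m2 h F ?O g"
    using Lip X_h_zero unfolding Lipschitz_differentiable_X_def by blast
  have "F ?O + ip g u + \<alpha> / 2 * ip u u \<le> F u" if u: "u \<in> X" for u
  proof -
    have "((\<lambda>t. F (\<lambda>x. ?O x + t * u x)) has_real_derivative ip g u) (at 0)"
      using g u by (intro frechet_line_DERIV) auto
    then have D: "((\<lambda>t. (F (\<lambda>x. t * u x) - F ?O) / t) \<longlongrightarrow> ip g u) (at_right 0)"
      unfolding DERIV_def by (auto intro: tendsto_mono[OF at_le])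
    have "((\<lambda>t. F u - F ?O - \<alpha> / 2 * (1 - t) * ip u u) \<longlongrightarrow> F u - F ?O - \<alpha> / 2 * (1 - 0) * ip u u)
        (at_right 0)"
      by (intro tendsto_intros)
    moreover have "\<forall>\<^sub>F t in at_right 0. (F (\<lambda>x. t * u x) - F ?O) / t
        \<le> F u - F ?O - \<alpha> / 2 * (1 - t) * ip u u"
      unfolding eventually_at_right_field
    proof (intro exI[of _ 1] conjI allI impI)
      fix t :: real assume t: "0 < t" "t < 1"
      have "F (\<lambda>x. (1 - t) * ?O x + t * u x)
          \<le> (1 - t) * F ?O + t * F u
            - \<alpha> / 2 * (t * (1 - t) * ip (\<lambda>x. ?O x - u x) (\<lambda>x. ?O x - u x))"
        using t u by (intro strongly_convex_XD[OF sc]) (auto simp: X_h_zero)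
      moreover have "ip (\<lambda>x. ?O x - u x) (\<lambda>x. ?O x - u x) = ip u u"
        unfolding inner_X_lin inner_X_lin_right by (simp add: inner_X_def elem_value_def case_prod_beta)
      ultimately have "F (\<lambda>x. t * u x) - F ?O \<le> t * (F u - F ?O - \<alpha> / 2 * (1 - t) * ip u u)"
        by (simp add: field_simps)
      then show "(F (\<lambda>x. t * u x) - F ?O) / t \<le> F u - F ?O - \<alpha> / 2 * (1 - t) * ip u u"
        using t by (simp add: divide_le_eq mult.commute)
    qed simp
    ultimately have "ip g u \<le> F u - F ?O - \<alpha> / 2 * (1 - 0) * ip u u"
      by (intro tendsto_le[OF _ _ D]) auto
    then show ?thesis by simp
  qed
  then show ?thesis using that by blast
qed

lemma conjugate_X_bdd_above: "bdd_above ((\<lambda>u. ip u v - F u) ` X)"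
proof -
  obtain g where g: "\<And>u. u \<in> X \<Longrightarrow> F (\<lambda>x. 0) + ip g u + \<alpha> / 2 * ip u u \<le> F u"
    using strongly_convex_X_minorant by blast
  let ?d = "\<lambda>x. v x - g x"
  have "ip u v - F u \<le> 1 / (2 * \<alpha>) * ip ?d ?d - F (\<lambda>x. 0)" if "u \<in> X" for u
  proof -
    have "ip u v - F u \<le> ip u ?d - \<alpha> / 2 * ip u u - F (\<lambda>x. 0)"
      using g[OF that] by (simp add: inner_X_lin_right inner_X_commute[of g u])
    then show ?thesis using inner_X_Young[OF \<alpha>, of u ?d] by linarith
  qed
  then show ?thesis unfolding bdd_above_def by blast
qed

lemma conjugate_X_upper: "u \<in> X \<Longrightarrow> ip u v - F u \<le> F\<^sub>c v"
  unfolding conjugate_X_def by (rule cSUP_upper[OF _ conjugate_X_bdd_above])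

lemma conjugate_X_least: "(\<And>u. u \<in> X \<Longrightarrow> ip u v - F u \<le> c) \<Longrightarrow> F\<^sub>c v \<le> c"
  unfolding conjugate_X_def using X_h_zero by (intro cSUP_least) auto

text \<open>A competitor \<open>z\<close> for the intermediate point is split into competitors
  \<open>x\<close> for \<open>v\<close> and \<open>y\<close> for \<open>w\<close>. Their distance
  \<open>e\<close> is chosen to maximize \<open>ip e (v - w) - \<beta> / 2 * ip e e\<close>: the
  pairing gains 1 / \<beta>, the Lipschitz inequality loses 1 / (2 \<beta>), and the rest is the
  modulus.\<close>

lemma conjugate_X_strongly_convex:
  "convex_on_X m1 m2 h (\<lambda>v. F\<^sub>c v - 1 / (2 * \<beta>) * ip v v)"
  unfolding convex_on_X_def
proof (intro ballI)
  fix v w and t :: real assume v: "v \<in> X" and w: "w \<in> X" and "t \<in> {0..1}"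
  then have t: "0 \<le> t" "t \<le> 1" by auto
  let ?d = "\<lambda>x. v x - w x"
  let ?m = "\<lambda>x. (1 - t) * v x + t * w x"
  have "F\<^sub>c ?m \<le> (1 - t) * F\<^sub>c v + t * F\<^sub>c w - 1 / (2 * \<beta>) * (t * (1 - t) * ip ?d ?d)"
  proof (rule conjugate_X_least)
    fix z assume z: "z \<in> X"
    \<comment> \<open>\<open>z = (1 - t) x + t y\<close> with \<open>x - y = (v - w) / \<beta>\<close>\<close>
    define e where "e = (\<lambda>x. 1 / \<beta> * ?d x)"
    let ?x = "\<lambda>x. z x + t * e x"
    let ?y = "\<lambda>x. z x + (t - 1) * e x"
    have e: "e \<in> X" unfolding e_def using v w by (intro X_h_mult X_h_diff)
    have x: "?x \<in> X" using z e by (intro X_h_add X_h_mult)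
    have y: "?y \<in> X" using z e by (intro X_h_add X_h_mult)
    have "(\<lambda>p. (1 - t) * ?x p + t * ?y p) = z" "(\<lambda>p. ?x p - ?y p) = e"
      by (auto simp: algebra_simps)
    then have "(1 - t) * F ?x + t * F ?y
        - \<beta> / 2 * (t * (1 - t) * ip e e) \<le> F z"
      using Lipschitz_differentiable_XD[OF Lip x y t] by (simp only:)
    moreover have ie: "ip e w = 1 / \<beta> * ip ?d w" for w
      unfolding e_def by (rule inner_X_lin)
    have "ip e e = 1 / \<beta> * (1 / \<beta> * ip ?d ?d)"
      unfolding ie unfolding e_def by (simp only: inner_X_lin_right)
    ultimately have F: "(1 - t) * F ?x + t * F ?y - 1 / (2 * \<beta>) * (t * (1 - t) * ip ?d ?d) \<le> F z"
      using \<beta> by simp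
    have "(1 - t) * (ip ?x v - F ?x) + t * (ip ?y w - F ?y) \<le> (1 - t) * F\<^sub>c v + t * F\<^sub>c w"
      using t by (intro add_mono mult_left_mono conjugate_X_upper x y) auto
    moreover have "(1 - t) * ip ?x v + t * ip ?y w
        = (1 - t) * ip z v + t * ip z w + t * (1 - t) * (ip e v - ip e w)"
      by (simp add: inner_X_lin algebra_simps)
    then have "(1 - t) * ip ?x v + t * ip ?y w = ip z ?m + 1 / \<beta> * (t * (1 - t) * ip ?d ?d)"
      by (simp add: ie inner_X_lin_right right_diff_distrib)
    ultimately show "ip z ?m - F z
        \<le> (1 - t) * F\<^sub>c v + t * F\<^sub>c w - 1 / (2 * \<beta>) * (t * (1 - t) * ip ?d ?d)"
      using F by (simp add: algebra_simps)
  qed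
  then show "F\<^sub>c ?m - 1 / (2 * \<beta>) * ip ?m ?m
      \<le> (1 - t) * (F\<^sub>c v - 1 / (2 * \<beta>) * ip v v) + t * (F\<^sub>c w - 1 / (2 * \<beta>) * ip w w)"
    unfolding convex_minus_square_iff .
qed

text \<open>Competitors \<open>x\<close> for \<open>v\<close> and \<open>y\<close> for
  \<open>w\<close> are merged into one competitor for the intermediate point. The cross term
  \<open>ip (x - y) (v - w)\<close> is absorbed by Young's inequality, whose \<open>x - y\<close>
  part is paid for by the strong convexity of \<open>F\<close>.\<close>

lemma conjugate_X_semiconcave:
  "convex_on_X m1 m2 h (\<lambda>v. 1 / (2 * \<alpha>) * ip v v - F\<^sub>c v)"
  unfolding convex_on_X_def
proof (intro ballI)
  fix v w and t :: real assume "v \<in> X" "w \<in> X" "t \<in> {0..1}"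
  then have t: "0 \<le> t" "t \<le> 1" by auto
  let ?d = "\<lambda>x. v x - w x"
  let ?m = "\<lambda>x. (1 - t) * v x + t * w x"
  let ?q = "1 / (2 * \<alpha>) * (t * (1 - t) * ip ?d ?d)"
  have *: "(1 - t) * (ip x v - F x) + t * (ip y w - F y) \<le> F\<^sub>c ?m + ?q"
    if x: "x \<in> X" and y: "y \<in> X" for x y
  proof -
    let ?z = "\<lambda>p. (1 - t) * x p + t * y p"
    let ?e = "\<lambda>p. x p - y p"
    have z: "?z \<in> X" using x y by (intro X_h_add X_h_mult)
    have "t * (1 - t) * ip ?e ?d \<le> t * (1 - t) * (\<alpha> / 2 * ip ?e ?e + 1 / (2 * \<alpha>) * ip ?d ?d)"
      using t by (intro mult_left_mono inner_X_Young \<alpha>) auto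
    also have "\<dots> = \<alpha> / 2 * (t * (1 - t) * ip ?e ?e) + ?q"
      by (simp only: distrib_left mult_ac)
    finally have "t * (1 - t) * ip ?e ?d \<le> \<alpha> / 2 * (t * (1 - t) * ip ?e ?e) + ?q" .
    moreover have "(1 - t) * ip x v + t * ip y w = ip ?z ?m + t * (1 - t) * ip ?e ?d"
      by (simp add: inner_X_lin inner_X_lin_right algebra_simps)
    moreover have "F ?z \<le> (1 - t) * F x + t * F y - \<alpha> / 2 * (t * (1 - t) * ip ?e ?e)"
      by (rule strongly_convex_XD[OF sc x y t])
    ultimately show ?thesis
      using conjugate_X_upper[OF z, of ?m] by (simp add: algebra_simps)
  qed
  have main: "(1 - t) * F\<^sub>c v + t * F\<^sub>c w \<le> F\<^sub>c ?m + ?q"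
  \<comment> \<open>The suprema over \<open>x\<close> and \<open>y\<close> are taken one after the
    other, each time dividing by a weight; hence the separate treatment of the end points.\<close>
  proof (cases "t = 0 \<or> t = 1")
    case True
    then show ?thesis by auto
  next
    case False
    define b where "b = F\<^sub>c ?m + ?q"
    have t': "0 < t" "0 < 1 - t" using False t by auto
    have **: "F\<^sub>c v \<le> (b - t * (ip y w - F y)) / (1 - t)" if "y \<in> X" for y
    proof (rule conjugate_X_least)
      fix x assume "x \<in> X"
      then have "(ip x v - F x) * (1 - t) \<le> b - t * (ip y w - F y)"
        using *[of x y] that by (simp add: b_def mult.commute)
      then show "ip x v - F x \<le> (b - t * (ip y w - F y)) / (1 - t)"
        using t' by (simp only: pos_le_divide_eq)
    qed
    have "F\<^sub>c w \<le> (b - (1 - t) * F\<^sub>c v) / t"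
    proof (rule conjugate_X_least)
      fix y assume "y \<in> X"
      then have "F\<^sub>c v * (1 - t) \<le> b - t * (ip y w - F y)"
        using **[of y] t' by (simp only: pos_le_divide_eq)
      then have "(ip y w - F y) * t \<le> b - (1 - t) * F\<^sub>c v"
        by (simp add: mult.commute)
      then show "ip y w - F y \<le> (b - (1 - t) * F\<^sub>c v) / t"
        using t' by (simp only: pos_le_divide_eq)
    qed
    then have "F\<^sub>c w * t \<le> b - (1 - t) * F\<^sub>c v"
      using t' by (simp only: pos_le_divide_eq)
    then show ?thesis unfolding b_def[symmetric] by (simp add: mult.commute)
  qed
  have "1 / (2 * \<alpha>) * ip ?m ?m
      = (1 - t) * (1 / (2 * \<alpha>) * ip v v) + t * (1 / (2 * \<alpha>) * ip w w) - ?q"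
    unfolding inner_X_convex_combination by (simp only: distrib_left right_diff_distrib mult_ac)
  with main show "1 / (2 * \<alpha>) * ip ?m ?m - F\<^sub>c ?m
      \<le> (1 - t) * (1 / (2 * \<alpha>) * ip v v - F\<^sub>c v) + t * (1 / (2 * \<alpha>) * ip w w - F\<^sub>c w)"
    by (simp only: right_diff_distrib)
qed

lemma conjugate_X_convex: "convex_on_X m1 m2 h F\<^sub>c"
  unfolding convex_on_X_def
proof (intro ballI)
  fix v w and t :: real assume v: "v \<in> X" and w: "w \<in> X" and t: "t \<in> {0..1}"
  let ?d = "\<lambda>x. v x - w x"
  let ?m = "\<lambda>x. (1 - t) * v x + t * w x"
  have "F\<^sub>c ?m - 1 / (2 * \<beta>) * ip ?m ?m
      \<le> (1 - t) * (F\<^sub>c v - 1 / (2 * \<beta>) * ip v v) + t * (F\<^sub>c w - 1 / (2 * \<beta>) * ip w w)"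
    using conjugate_X_strongly_convex v w t unfolding convex_on_X_def by blast
  then have "F\<^sub>c ?m \<le> (1 - t) * F\<^sub>c v + t * F\<^sub>c w - 1 / (2 * \<beta>) * (t * (1 - t) * ip ?d ?d)"
    unfolding convex_minus_square_iff .
  moreover have "0 \<le> 1 / (2 * \<beta>) * (t * (1 - t) * ip ?d ?d)"
    using \<beta> t inner_X_ge_zero by simp
  ultimately show "F\<^sub>c ?m \<le> (1 - t) * F\<^sub>c v + t * F\<^sub>c w" by linarith
qed

text \<open>The mean of the points \<open>v + t d k\<close> lies on the segment from
  \<open>v\<close> to \<open>w\<close>. Semiconcavity bounds the sum of the energies by N times the
  energy of the mean plus the variance of the points; strong convexity along the segment then bounds
  the energy of the mean.\<close>

lemma conjugate_X_parallel_step: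
  assumes I: "finite I" "I \<noteq> {}" and v: "v \<in> X" and w: "w \<in> X"
    and d: "\<And>k. k \<in> I \<Longrightarrow> d k \<in> X" and sum_d: "\<And>x. (\<Sum>k\<in>I. d k x) = w x - v x"
    and t: "0 \<le> t" "t \<le> 1"
  shows "(\<Sum>k\<in>I. F\<^sub>c (\<lambda>x. v x + t * d k x))
    \<le> real (card I) * F\<^sub>c v + t * (F\<^sub>c w - F\<^sub>c v)
      - t * (1 - t / real (card I)) / (2 * \<beta>) * ip (\<lambda>x. w x - v x) (\<lambda>x. w x - v x)
      + t\<^sup>2 / (2 * \<alpha>) * (\<Sum>k\<in>I. ip (d k) (d k))"
proof -
  define N where "N = real (card I)"
  have N: "1 \<le> N" unfolding N_def using I by (simp add: Suc_le_eq card_gt_0_iff)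
  let ?v = "\<lambda>k x. v x + t * d k x"
  let ?e = "\<lambda>x. w x - v x"
  \<comment> \<open>Averaging N steps that sum up to \<open>t (w - v)\<close> moves by the fraction
    t / N only.\<close>
  define s where "s = t / N"
  have s: "0 \<le> s" "s \<le> 1" using t N by (auto simp: s_def divide_le_eq)
  let ?m = "\<lambda>x. (1 - s) * v x + s * w x"
  have "(\<lambda>x. \<Sum>k\<in>I. 1 / N * ?v k x) = ?m"
  proof
    fix x
    have "(\<Sum>k\<in>I. 1 / N * ?v k x) = 1 / N * (N * v x + t * (\<Sum>k\<in>I. d k x))"
      by (simp only: flip: sum_distrib_left) (simp add: sum.distrib N_def sum_distrib_left)
    then show "(\<Sum>k\<in>I. 1 / N * ?v k x) = ?m x"
      using N by (simp add: sum_d s_def field_simps)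
  qed
  then have "1 / (2 * \<alpha>) * ip ?m ?m - F\<^sub>c ?m
      \<le> (\<Sum>k\<in>I. 1 / N * (1 / (2 * \<alpha>) * ip (?v k) (?v k) - F\<^sub>c (?v k)))"
    using convex_on_X_sum[OF conjugate_X_semiconcave I(1), of ?v "\<lambda>_. 1 / N"] N v d
    by (simp add: X_h_add X_h_mult N_def)
  then have "N * (1 / (2 * \<alpha>) * ip ?m ?m - F\<^sub>c ?m)
      \<le> N * (1 / N * (\<Sum>k\<in>I. 1 / (2 * \<alpha>) * ip (?v k) (?v k) - F\<^sub>c (?v k)))"
    using N by (intro mult_left_mono) (auto simp: sum_distrib_left)
  then have 1: "N * (1 / (2 * \<alpha>) * ip ?m ?m - F\<^sub>c ?m)
      \<le> 1 / (2 * \<alpha>) * (\<Sum>k\<in>I. ip (?v k) (?v k)) - (\<Sum>k\<in>I. F\<^sub>c (?v k))"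
    using N by (simp add: sum_subtractf sum_distrib_left)
  have "ip (?v k) (?v k) = ip v v + 2 * t * ip v (d k) + t\<^sup>2 * ip (d k) (d k)" for k
    by (simp add: inner_X_lin inner_X_lin_right inner_X_commute[of "d k" v] power2_eq_square algebra_simps)
  then have "(\<Sum>k\<in>I. ip (?v k) (?v k))
      = (\<Sum>k\<in>I. ip v v + 2 * t * ip v (d k) + t\<^sup>2 * ip (d k) (d k))"
    by (simp only:)
  also have "\<dots> = N * ip v v + 2 * t * (\<Sum>k\<in>I. ip v (d k)) + t\<^sup>2 * (\<Sum>k\<in>I. ip (d k) (d k))"
    by (simp add: sum.distrib sum_distrib_left N_def)
  also have "(\<Sum>k\<in>I. ip v (d k)) = ip v ?e"
    by (simp add: sum_d flip: inner_X_lin_right(4))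
  finally have sum_v: "(\<Sum>k\<in>I. ip (?v k) (?v k))
      = N * ip v v + 2 * t * ip v ?e + t\<^sup>2 * (\<Sum>k\<in>I. ip (d k) (d k))" .
  have m: "ip ?m ?m = ip v v + 2 * s * ip v ?e + s * (s * ip ?e ?e)"
    by (simp add: inner_X_lin inner_X_lin_right inner_X_commute[of w v] algebra_simps)
  have tN: "t = N * s" using N by (simp add: s_def)
  \<comment> \<open>The variance of the points: the terms in \<open>v\<close> cancel because
    \<open>t = N s\<close> and the \<open>d k\<close> sum up to \<open>w - v\<close>.\<close>
  have 2: "(\<Sum>k\<in>I. ip (?v k) (?v k)) - N * ip ?m ?m
      = t\<^sup>2 * (\<Sum>k\<in>I. ip (d k) (d k)) - t * s * ip ?e ?e"
    unfolding sum_v m by (simp add: tN distrib_left mult_ac)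
  have "F\<^sub>c ?m - 1 / (2 * \<beta>) * ip ?m ?m
      \<le> (1 - s) * (F\<^sub>c v - 1 / (2 * \<beta>) * ip v v) + s * (F\<^sub>c w - 1 / (2 * \<beta>) * ip w w)"
    using conjugate_X_strongly_convex v w s unfolding convex_on_X_def by auto
  then have "F\<^sub>c ?m \<le> (1 - s) * F\<^sub>c v + s * F\<^sub>c w
      - 1 / (2 * \<beta>) * (s * (1 - s) * ip (\<lambda>x. v x - w x) (\<lambda>x. v x - w x))"
    unfolding convex_minus_square_iff .
  also have "ip (\<lambda>x. v x - w x) (\<lambda>x. v x - w x) = ip ?e ?e"
    by (simp add: inner_X_lin inner_X_lin_right)
  finally have "F\<^sub>c ?m \<le> (1 - s) * F\<^sub>c v + s * F\<^sub>c w - s * (1 - s) / (2 * \<beta>) * ip ?e ?e"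
    by simp
  then have "N * F\<^sub>c ?m \<le> N * ((1 - s) * F\<^sub>c v + s * F\<^sub>c w - s * (1 - s) / (2 * \<beta>) * ip ?e ?e)"
    using N by simp
  also have "\<dots> = N * F\<^sub>c v + t * (F\<^sub>c w - F\<^sub>c v) - t * (1 - s) / (2 * \<beta>) * ip ?e ?e"
    unfolding tN by (simp add: algebra_simps diff_divide_distrib)
  finally have 3: "N * F\<^sub>c ?m \<le> N * F\<^sub>c v + t * (F\<^sub>c w - F\<^sub>c v) - t * (1 - s) / (2 * \<beta>) * ip ?e ?e" .
  have "(\<Sum>k\<in>I. F\<^sub>c (?v k)) \<le> N * F\<^sub>c ?m
      + 1 / (2 * \<alpha>) * ((\<Sum>k\<in>I. ip (?v k) (?v k)) - N * ip ?m ?m)"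
    using 1 by (simp add: algebra_simps)
  also have "\<dots> = N * F\<^sub>c ?m + t\<^sup>2 / (2 * \<alpha>) * (\<Sum>k\<in>I. ip (d k) (d k))
      - t * s / (2 * \<alpha>) * ip ?e ?e"
    unfolding 2 by (simp add: algebra_simps diff_divide_distrib)
  also have "\<dots> \<le> N * F\<^sub>c ?m + t\<^sup>2 / (2 * \<alpha>) * (\<Sum>k\<in>I. ip (d k) (d k))"
    using t s \<alpha> inner_X_ge_zero by simp
  finally show ?thesis using 3 unfolding s_def N_def by linarith
qed

end

end

section \<open>Raviart--Thomas fields\<close>

lemma lborel_integral_eq_0_fst:
  fixes f :: "real \<times> real \<Rightarrow> real"
  assumes f: "integrable lborel f" and s: "\<And>y. y \<noteq> c \<Longrightarrow> ((\<lambda>x. f (x, y)) has_integral 0) UNIV"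
  shows "integral\<^sup>L lborel f = 0"
proof -
  have i: "integrable (lborel \<Otimes>\<^sub>M lborel) (case_prod (\<lambda>x y. f (x, y)))"
    using f by (simp add: lborel_prod)
  have "integral\<^sup>L lborel f = (\<integral>y. (\<integral>x. f (x, y) \<partial>lborel) \<partial>lborel)"
    using lborel_pair.integral_snd[OF i] by (simp add: lborel_prod)
  also have "\<dots> = 0"
  proof (rule integral_eq_zero_AE)
    show "AE y in lborel. (\<integral>x. f (x, y) \<partial>lborel) = 0"
      using lborel_pair.AE_integrable_snd[OF i] AE_lborel_singleton[of c]
    proof eventually_elim
      case (elim y)
      then have "integrable lborel (\<lambda>x. f (x, y))" by simp
      then show ?case using s[of y] elim by (metis has_integral_integral_lborel has_integral_unique)
    qed
  qed
  finally show ?thesis .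
qed

lemma lborel_integral_eq_0_snd:
  fixes f :: "real \<times> real \<Rightarrow> real"
  assumes f: "integrable lborel f" and s: "\<And>x. x \<noteq> c \<Longrightarrow> ((\<lambda>y. f (x, y)) has_integral 0) UNIV"
  shows "integral\<^sup>L lborel f = 0"
proof -
  have i: "integrable (lborel \<Otimes>\<^sub>M lborel) (case_prod (\<lambda>x y. f (x, y)))"
    using f by (simp add: lborel_prod)
  have "integral\<^sup>L lborel f = (\<integral>x. (\<integral>y. f (x, y) \<partial>lborel) \<partial>lborel)"
    using lborel_pair.integral_fst[OF i] by (simp add: lborel_prod)
  also have "\<dots> = 0"
  proof (rule integral_eq_zero_AE)
    show "AE x in lborel. (\<integral>y. f (x, y) \<partial>lborel) = 0"
      using lborel_pair.AE_integrable_fst[OF i] AE_lborel_singleton[of c]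
    proof eventually_elim
      case (elim x)
      then have "integrable lborel (\<lambda>y. f (x, y))" by simp
      then show ?case using s[of x] elim by (metis has_integral_integral_lborel has_integral_unique)
    qed
  qed
  finally show ?thesis .
qed

text \<open>Passage from Lebesgue integrals on \<open>S\<close> to Borel integrals over the plane,
  where Fubini applies. A test function is continuous on \<open>S\<close> only, so the indicator is
  first moved onto it to obtain a Borel function.\<close>

lemma inner_lebesgue_on:
  fixes q \<psi> :: "real \<times> real \<Rightarrow> 'b::euclidean_space"
  assumes S: "open S" "emeasure lborel S < \<infinity>" and \<psi>: "continuous_on S \<psi>" "bounded (\<psi> ` S)"
    and q: "q \<in> borel_measurable borel" "bounded (range q)"
  shows "integrable lborel (\<lambda>x. indicator S x * (q x \<bullet> \<psi> x))"
    and "integrable (lebesgue_on S) (\<lambda>x. q x \<bullet> \<psi> x)"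
    and "(\<integral>x. q x \<bullet> \<psi> x \<partial>lebesgue_on S) = (\<integral>x. indicator S x * (q x \<bullet> \<psi> x) \<partial>lborel)"
proof -
  have S': "S \<in> sets borel" using S by simp
  have eq: "indicator S x * (q x \<bullet> \<psi> x) = q x \<bullet> (indicator S x *\<^sub>R \<psi> x)" for x
    by simp
  have m: "(\<lambda>x. indicator S x * (q x \<bullet> \<psi> x)) \<in> borel_measurable borel"
    unfolding eq using borel_measurable_continuous_on_indicator[OF S' \<psi>(1)] q(1)
    by (intro borel_measurable_inner)
  obtain B where B: "\<And>x. x \<in> S \<Longrightarrow> norm (\<psi> x) \<le> B" using \<psi>(2) unfolding bounded_iff by auto
  obtain Q where Q: "\<And>x. norm (q x) \<le> Q" using q(2) unfolding bounded_iff by auto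
  show i: "integrable lborel (\<lambda>x. indicator S x * (q x \<bullet> \<psi> x))"
  proof (rule integrableI_bounded_set[where A = S and B = "Q * B"])
    show "AE x\<in>S in lborel. norm (indicator S x * (q x \<bullet> \<psi> x)) \<le> Q * B"
    proof (intro AE_I2 impI)
      fix x assume "x \<in> S"
      moreover have "\<bar>q x \<bullet> \<psi> x\<bar> \<le> norm (q x) * norm (\<psi> x)" by (rule Cauchy_Schwarz_ineq2)
      moreover have "\<dots> \<le> Q * B"
        using Q[of x] B[OF \<open>x \<in> S\<close>] by (intro mult_mono) (auto intro: order_trans[OF norm_ge_zero])
      ultimately show "norm (indicator S x * (q x \<bullet> \<psi> x)) \<le> Q * B" by simp
    qed
  qed (use S S' m in auto)
  show "integrable (lebesgue_on S) (\<lambda>x. q x \<bullet> \<psi> x)"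
    using i m S' by (subst integrable_restrict_space) (auto simp: integrable_completion)
  show "(\<integral>x. q x \<bullet> \<psi> x \<partial>lebesgue_on S) = (\<integral>x. indicator S x * (q x \<bullet> \<psi> x) \<partial>lborel)"
    using m S' by (subst integral_restrict_space) (auto simp: integral_completion)
qed

lemma square_integrable_on_bounded:
  fixes q :: "real \<times> real \<Rightarrow> 'b::euclidean_space"
  assumes S: "open S" "emeasure lborel S < \<infinity>"
    and q: "q \<in> borel_measurable borel" "bounded (range q)"
  shows "square_integrable_on S q"
proof -
  obtain Q where Q: "\<And>x. norm (q x) \<le> Q" using q(2) unfolding bounded_iff by auto
  have b: "bounded (range (\<lambda>x. (norm (q x))\<^sup>2))"
    unfolding bounded_iff by (rule exI[of _ "Q\<^sup>2"]) (auto intro!: power_mono Q)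
  have "integrable (lebesgue_on S) (\<lambda>x. (norm (q x))\<^sup>2 \<bullet> 1)"
    using q(1) b by (intro inner_lebesgue_on(2) S) (auto simp: bounded_iff)
  moreover have "q \<in> borel_measurable (lebesgue_on S)"
    using q(1) by (intro measurable_restrict_space1 measurable_completion) simp
  ultimately show ?thesis unfolding square_integrable_on_def by simp
qed

lemma C1_with_gradient_continuous:
  assumes "C1_with_gradient S \<phi> D\<phi>"
  shows "continuous_on S \<phi>" and "continuous_on S D\<phi>"
  using assms unfolding C1_with_gradient_def gderiv_def
  by (auto intro!: continuous_at_imp_continuous_on has_derivative_continuous)

text \<open>Compactly supported test functions are admissible in Green's formula: off
  \<open>K\<close> the gradient vanishes, because \<phi> is zero on an open set, and on
  \<open>K\<close> continuity bounds both.\<close>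

lemma weak_divergence_if_zero_normal_trace:
  assumes S: "open S" and "zero_normal_trace S p g"
  shows "weak_divergence S p g"
  unfolding weak_divergence_def
proof (intro allI impI)
  fix \<phi> D\<phi>
  assume C1: "C1_with_gradient S \<phi> D\<phi>" and "\<exists>K. compact K \<and> K \<subseteq> S \<and> (\<forall>x\<in>S - K. \<phi> x = 0)"
  then obtain K where K: "compact K" "K \<subseteq> S" "\<And>x. x \<in> S - K \<Longrightarrow> \<phi> x = 0" by blast
  have "D\<phi> x = 0" if x: "x \<in> S - K" for x
  proof -
    have "((\<lambda>x. 0) has_derivative (\<lambda>d. d \<bullet> 0)) (at x)" by simp
    then have "(\<phi> has_derivative (\<lambda>d. d \<bullet> 0)) (at x)"
    proof (rule has_derivative_transform_within_open)
      show "open (S - K)" using S K by (simp add: open_Diff compact_imp_closed)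
    qed (use K(3) x in simp_all)
    moreover have "(\<phi> has_derivative (\<lambda>d. d \<bullet> D\<phi> x)) (at x)"
      using C1 x unfolding C1_with_gradient_def gderiv_def by auto
    ultimately have "(\<lambda>d. d \<bullet> D\<phi> x) = (\<lambda>d. d \<bullet> 0)" by (rule has_derivative_unique[rotated])
    then show ?thesis by (metis inner_eq_zero_iff inner_zero_right)
  qed
  then have "\<phi> ` S \<subseteq> insert 0 (\<phi> ` K)" "D\<phi> ` S \<subseteq> insert 0 (D\<phi> ` K)"
    using K(3) by (fastforce simp del: split_paired_All)+
  moreover have "bounded (\<phi> ` K)" "bounded (D\<phi> ` K)"
    using C1_with_gradient_continuous[OF C1] K(1,2)
    by (auto intro!: compact_imp_bounded compact_continuous_image intro: continuous_on_subset)
  ultimately have "bounded (\<phi> ` S)" "bounded (D\<phi> ` S)"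
    by (meson bounded_insert bounded_subset)+
  then show "(\<integral>x. p x \<bullet> D\<phi> x \<partial>lebesgue_on S) = - (\<integral>x. g x * \<phi> x \<partial>lebesgue_on S)"
    using assms(2) C1 unfolding zero_normal_trace_def by (simp add: eq_neg_iff_add_eq_0)
qed

section \<open>Shape functions of the edges\<close>

definition tent :: "real \<Rightarrow> real \<Rightarrow> real \<Rightarrow> real" where
  "tent h c x = max 0 (1 - \<bar>x - c\<bar> / h)"

text \<open>At the three kinks the right-hand slope is taken, which fits the half-open elements and
  makes \<open>basis_div\<close> constant on each of them.\<close>

definition tent_slope :: "real \<Rightarrow> real \<Rightarrow> real \<Rightarrow> real" where
  "tent_slope h c x = (if c - h \<le> x \<and> x < c then 1 / h else if c \<le> x \<and> x < c + h then - 1 / h else 0)"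

lemma tent_bounds: "0 < h \<Longrightarrow> 0 \<le> tent h c x" "0 < h \<Longrightarrow> tent h c x \<le> 1"
  by (auto simp: tent_def)

lemma tent_eq_0: "0 < h \<Longrightarrow> x \<notin> {c - h<..<c + h} \<Longrightarrow> tent h c x = 0"
  by (auto simp: tent_def abs_if field_simps max_def split: if_splits)

lemma continuous_tent: "0 < h \<Longrightarrow> continuous_on UNIV (tent h c)"
  unfolding tent_def by (intro continuous_intros) auto

lemma tent_has_derivative:
  assumes h: "0 < h" and x: "x \<in> {c - h<..<c + h}" "x \<noteq> c"
  shows "(tent h c has_real_derivative tent_slope h c x) (at x)"
proof (cases "x < c")
  case True
  have "((\<lambda>y. 1 - (c - y) / h) has_real_derivative 1 / h) (at x)"
    using h by (auto intro!: derivative_eq_intros)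
  then have "(tent h c has_real_derivative 1 / h) (at x)"
  proof (rule has_field_derivative_transform_within_open[where S = "{c - h<..<c}"])
    show "1 - (c - y) / h = tent h c y" if "y \<in> {c - h<..<c}" for y
    using that h by (auto simp: tent_def field_simps max_def)
  qed (use x True in auto)
  then show ?thesis using x True by (simp add: tent_slope_def)
next
  case False
  have "((\<lambda>y. 1 - (y - c) / h) has_real_derivative - 1 / h) (at x)"
    using h by (auto intro!: derivative_eq_intros)
  then have "(tent h c has_real_derivative - 1 / h) (at x)"
  proof (rule has_field_derivative_transform_within_open[where S = "{c<..<c + h}"])
    show "1 - (y - c) / h = tent h c y" if "y \<in> {c<..<c + h}" for y
    using that h by (auto simp: tent_def field_simps max_def)
  qed (use x False in auto)
  then show ?thesis using x False by (simp add: tent_slope_def)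
qed

text \<open>
  The product of a tent with a bounded function extends continuously by zero, so nothing is
  assumed of \<open>f\<close> at the end points.
\<close>

lemma tent_integral_by_parts:
  assumes h: "0 < h" and f: "\<And>x. x \<in> {c - h<..<c + h} \<Longrightarrow> (f has_real_derivative f' x) (at x)"
    and B: "\<And>x. x \<in> {c - h<..<c + h} \<Longrightarrow> \<bar>f x\<bar> \<le> B"
    and g: "\<And>x. x \<in> {c - h<..<c + h} \<Longrightarrow> g x = tent h c x * f' x + tent_slope h c x * f x"
    and g0: "\<And>x. x \<notin> {c - h..c + h} \<Longrightarrow> g x = 0"
  shows "(g has_integral 0) UNIV"
proof -
  let ?I = "{c - h<..<c + h}"
  define k where "k = (\<lambda>x. if x \<in> ?I then tent h c x * f x else 0)"
  have k_eq: "k x = tent h c x * f x" if "x \<in> ?I" for x using that by (simp add: k_def)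
  have kb: "norm (k x) \<le> tent h c x * \<bar>B\<bar>" for x
  proof (cases "x \<in> ?I")
    case True
    then have "\<bar>f x\<bar> \<le> \<bar>B\<bar>" using B[of x] by linarith
    then show ?thesis using True h by (simp add: k_def abs_mult tent_bounds mult_left_mono)
  next
    case False
    then have "k x = 0" unfolding k_def by (rule if_not_P)
    then show ?thesis by (simp add: tent_bounds h)
  qed
  have cont: "continuous_on {c - h..c + h} k"
    unfolding continuous_on_eq_continuous_within
  proof
    fix x assume x: "x \<in> {c - h..c + h}"
    have tc: "isCont (tent h c) x" using continuous_tent[OF h] continuous_on_eq_continuous_at by blast
    show "continuous (at x within {c - h..c + h}) k"
    proof (cases "x \<in> ?I")
      case True
      have "isCont (\<lambda>x. tent h c x * f x) x"
        using tc f[OF True] by (intro continuous_mult) (auto intro: DERIV_isCont)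
      then have "isCont k x"
        using True k_eq by (subst isCont_cong[of k]) (auto intro!: eventually_nhds_in_open simp: eventually_nhds)
      then show ?thesis by (rule continuous_at_imp_continuous_within)
    next
      case False
      then have "k x = 0" "tent h c x = 0"
        using tent_eq_0[OF h] unfolding k_def by (auto simp only: if_False)
      moreover have "((\<lambda>y. tent h c y * \<bar>B\<bar>) \<longlongrightarrow> tent h c x * \<bar>B\<bar>) (at x)"
        using tc by (intro tendsto_intros) (auto simp: isCont_def)
      ultimately have "(k \<longlongrightarrow> k x) (at x)"
        using kb Lim_null_comparison[of k "\<lambda>y. tent h c y * \<bar>B\<bar>" "at x"] by simp
      then show ?thesis unfolding continuous_within by (rule tendsto_within_subset) simp
    qed
  qed
  have "(g has_integral (k (c + h) - k (c - h))) {c - h..c + h}"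
  proof (rule fundamental_theorem_of_calculus_interior_strong[of "{c}"])
    fix x assume "x \<in> {c - h<..<c + h} - {c}"
    then have x: "x \<in> ?I" "x \<noteq> c" by auto
    have "((\<lambda>x. tent h c x * f x) has_real_derivative tent_slope h c x * f x + f' x * tent h c x) (at x)"
      by (rule DERIV_mult[OF tent_has_derivative[OF h x] f[OF x(1)]])
    then have "(k has_real_derivative tent_slope h c x * f x + f' x * tent h c x) (at x)"
      by (rule has_field_derivative_transform_within_open[where S = ?I]) (use x k_eq in auto)
    then show "(k has_vector_derivative g x) (at x)"
      using g[OF x(1)] by (simp add: has_real_derivative_iff_has_vector_derivative algebra_simps)
  qed (use h cont in auto)
  moreover have "k (c + h) = 0" "k (c - h) = 0" by (simp_all add: k_def)
  ultimately have "(g has_integral 0) {c - h..c + h}" by simp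
  then show ?thesis by (rule has_integral_on_superset) (use g0 in auto)
qed

text \<open>The lowest-order Raviart-Thomas shape function of an edge: a tent in the normal
  direction, of height one on the edge, cut off sharply in the tangential direction, where H(div)
  permits jumps.\<close>

fun basis :: "real \<Rightarrow> edge \<Rightarrow> real \<times> real \<Rightarrow> real \<times> real" where
  "basis h (VEdge i j) (x, y) =
     (if real j * h \<le> y \<and> y < (real j + 1) * h then tent h (real i * h) x else 0, 0)"
| "basis h (HEdge i j) (x, y) =
     (0, if real i * h \<le> x \<and> x < (real i + 1) * h then tent h (real j * h) y else 0)"

fun basis_div :: "real \<Rightarrow> edge \<Rightarrow> real \<times> real \<Rightarrow> real" where
  "basis_div h (VEdge i j) (x, y) =
     (if real j * h \<le> y \<and> y < (real j + 1) * h then tent_slope h (real i * h) x else 0)"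
| "basis_div h (HEdge i j) (x, y) =
     (if real i * h \<le> x \<and> x < (real i + 1) * h then tent_slope h (real j * h) y else 0)"

text \<open>The open rectangle formed by the two elements next to an edge and the edge between them.
  Its inclusion in \<open>S\<close> says that the edge is interior to \<open>S\<close>, so that test
  functions on \<open>S\<close> are C1 across it.\<close>

fun patch :: "real \<Rightarrow> edge \<Rightarrow> (real \<times> real) set" where
  "patch h (VEdge i j) = {real i * h - h<..<real i * h + h} \<times> {real j * h<..<(real j + 1) * h}"
| "patch h (HEdge i j) = {real i * h<..<(real i + 1) * h} \<times> {real j * h - h<..<real j * h + h}"

lemma borel_measurable_tent [measurable]: "tent h c \<in> borel_measurable borel"
  and borel_measurable_tent_slope [measurable]: "tent_slope h c \<in> borel_measurable borel"
  unfolding tent_def tent_slope_def by measurable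

lemma borel_measurable_basis:
  assumes "0 < h"
  shows "basis h e \<in> borel_measurable borel" "basis_div h e \<in> borel_measurable borel"
proof -
  have p: "borel = (borel \<Otimes>\<^sub>M borel :: (real \<times> real) measure)" by (simp add: borel_prod)
  have "basis h e = (\<lambda>p. basis h e (fst p, snd p))" "basis_div h e = (\<lambda>p. basis_div h e (fst p, snd p))"
    by simp_all
  then show "basis h e \<in> borel_measurable borel" "basis_div h e \<in> borel_measurable borel"
    by (cases e; simp only: basis.simps basis_div.simps; unfold p; measurable)+
qed

lemma bounded_basis:
  assumes "0 < h"
  shows "bounded (range (basis h e))" "bounded (range (basis_div h e))"
proof -
  have "norm (basis h e x) \<le> 1" for x
    using assms tent_bounds[OF assms] by (cases e; cases x) (auto simp: norm_Pair)
  then show "bounded (range (basis h e))" unfolding bounded_iff by auto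
  have "norm (basis_div h e x) \<le> 1 / h" for x
    using assms by (cases e; cases x) (auto simp: tent_slope_def)
  then show "bounded (range (basis_div h e))" unfolding bounded_iff by auto
qed

lemma GDERIV_DERIV_fst:
  assumes "GDERIV \<phi> (x, y) :> D"
  shows "((\<lambda>x. \<phi> (x, y)) has_real_derivative fst D) (at x)"
proof -
  have "((\<lambda>x. (x, y)) has_derivative (\<lambda>d. (d, 0))) (at x)"
    by (auto intro!: derivative_eq_intros)
  then have "((\<lambda>x. \<phi> (x, y)) has_derivative (\<lambda>d. (d, 0) \<bullet> D)) (at x)"
    using assms unfolding gderiv_def by (rule has_derivative_compose)
  then show ?thesis
    unfolding has_field_derivative_def by (cases D) (simp add: mult_commute_abs)
qed

lemma GDERIV_DERIV_snd:
  assumes "GDERIV \<phi> (x, y) :> D"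
  shows "((\<lambda>y. \<phi> (x, y)) has_real_derivative snd D) (at y)"
proof -
  have "((\<lambda>y. (x, y)) has_derivative (\<lambda>d. (0, d))) (at y)"
    by (auto intro!: derivative_eq_intros)
  then have "((\<lambda>y. \<phi> (x, y)) has_derivative (\<lambda>d. (0, d) \<bullet> D)) (at y)"
    using assms unfolding gderiv_def by (rule has_derivative_compose)
  then show ?thesis
    unfolding has_field_derivative_def by (cases D) (simp add: mult_commute_abs)
qed

text \<open>Fubini along the normal of the edge: on each such line the integrand is the derivative
  of the tent times \<phi>, and this product vanishes at both ends of the patch.\<close>

lemma zero_normal_trace_basis:
  assumes h: "0 < h" and S: "open S" "emeasure lborel S < \<infinity>" and e: "patch h e \<subseteq> S"
  shows "zero_normal_trace S (basis h e) (basis_div h e)"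
  unfolding zero_normal_trace_def
proof (intro allI impI)
  fix \<phi> D\<phi> assume C1: "C1_with_gradient S \<phi> D\<phi>" and b: "bounded (\<phi> ` S)" "bounded (D\<phi> ` S)"
  note c = C1_with_gradient_continuous[OF C1]
  have D: "GDERIV \<phi> p :> D\<phi> p" if "p \<in> S" for p
    using C1 that unfolding C1_with_gradient_def by blast
  obtain B where B: "\<And>p. p \<in> S \<Longrightarrow> \<bar>\<phi> p\<bar> \<le> B" using b(1) unfolding bounded_iff by auto
  note 1 = inner_lebesgue_on[OF S c(2) b(2) borel_measurable_basis(1)[OF h] bounded_basis(1)[OF h]]
  note 2 = inner_lebesgue_on[OF S c(1) b(1) borel_measurable_basis(2)[OF h] bounded_basis(2)[OF h],
      unfolded inner_real_def]
  let ?f = "\<lambda>p. indicator S p * (basis h e p \<bullet> D\<phi> p) + indicator S p * (basis_div h e p * \<phi> p)"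
  have i: "integrable lborel ?f" by (rule Bochner_Integration.integrable_add[OF 1(1) 2(1)])
  have "integral\<^sup>L lborel ?f = 0"
  proof (cases e)
    case (VEdge i j)
    show ?thesis
    \<comment> \<open>The strip is half-open but the patch is open: on the excluded line the shape
      function is nonzero although the line need not meet \<open>S\<close> in a full
      segment.\<close>
    proof (rule lborel_integral_eq_0_fst[OF i, of "real j * h"])
      fix y assume y: "y \<noteq> real j * h"
      show "((\<lambda>x. ?f (x, y)) has_integral 0) UNIV"
      proof (cases "real j * h < y \<and> y < (real j + 1) * h")
        case True
        let ?c = "real i * h"
        have in_S: "(x, y) \<in> S" if "x \<in> {?c - h<..<?c + h}" for x
          using e that True VEdge by auto
        have f: "?f (x, y) = indicator S (x, y) * (tent h ?c x * fst (D\<phi> (x, y))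
            + tent_slope h ?c x * \<phi> (x, y))" for x
          using True VEdge by (simp add: inner_prod_def distrib_left)
        show ?thesis
        proof (rule tent_integral_by_parts[OF h, of ?c "\<lambda>x. \<phi> (x, y)" "\<lambda>x. fst (D\<phi> (x, y))" B])
          fix x assume x: "x \<in> {?c - h<..<?c + h}"
          show "((\<lambda>x. \<phi> (x, y)) has_real_derivative fst (D\<phi> (x, y))) (at x)"
            by (intro GDERIV_DERIV_fst D in_S x)
          show "\<bar>\<phi> (x, y)\<bar> \<le> B" by (intro B in_S x)
          show "?f (x, y) = tent h ?c x * fst (D\<phi> (x, y)) + tent_slope h ?c x * \<phi> (x, y)"
            unfolding f using in_S[OF x] by simp
        next
          fix x assume x: "x \<notin> {?c - h..?c + h}"
          then have "tent h ?c x = 0" "tent_slope h ?c x = 0"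
            by (auto intro!: tent_eq_0[OF h] simp: tent_slope_def)
          then show "?f (x, y) = 0" unfolding f by simp
        qed
      next
        case False
        then have "?f (x, y) = 0" for x using y VEdge by (auto simp: inner_prod_def)
        then show ?thesis by (simp only: has_integral_0)
      qed
    qed
  next
    case (HEdge i j)
    show ?thesis
    proof (rule lborel_integral_eq_0_snd[OF i, of "real i * h"])
      fix x assume x: "x \<noteq> real i * h"
      show "((\<lambda>y. ?f (x, y)) has_integral 0) UNIV"
      proof (cases "real i * h < x \<and> x < (real i + 1) * h")
        case True
        let ?c = "real j * h"
        have in_S: "(x, y) \<in> S" if "y \<in> {?c - h<..<?c + h}" for y
          using e that True HEdge by auto
        have f: "?f (x, y) = indicator S (x, y) * (tent h ?c y * snd (D\<phi> (x, y))
            + tent_slope h ?c y * \<phi> (x, y))" for y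
          using True HEdge by (simp add: inner_prod_def distrib_left)
        show ?thesis
        proof (rule tent_integral_by_parts[OF h, of ?c "\<lambda>y. \<phi> (x, y)" "\<lambda>y. snd (D\<phi> (x, y))" B])
          fix y assume y: "y \<in> {?c - h<..<?c + h}"
          show "((\<lambda>y. \<phi> (x, y)) has_real_derivative snd (D\<phi> (x, y))) (at y)"
            by (intro GDERIV_DERIV_snd D in_S y)
          show "\<bar>\<phi> (x, y)\<bar> \<le> B" by (intro B in_S y)
          show "?f (x, y) = tent h ?c y * snd (D\<phi> (x, y)) + tent_slope h ?c y * \<phi> (x, y)"
            unfolding f using in_S[OF y] by simp
        next
          fix y assume y: "y \<notin> {?c - h..?c + h}"
          then have "tent h ?c y = 0" "tent_slope h ?c y = 0"
            by (auto intro!: tent_eq_0[OF h] simp: tent_slope_def)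
          then show "?f (x, y) = 0" unfolding f by simp
        qed
      next
        case False
        then have "?f (x, y) = 0" for y using x HEdge by (auto simp: inner_prod_def)
        then show ?thesis by (simp only: has_integral_0)
      qed
    qed
  qed
  then show "(\<integral>x. basis h e x \<bullet> D\<phi> x \<partial>lebesgue_on S) + (\<integral>x. basis_div h e x * \<phi> x \<partial>lebesgue_on S) = 0"
    by (simp only: 1(3) 2(3) Bochner_Integration.integral_add[OF 1(1) 2(1)])
qed

section \<open>Fields and divergences assembled from edge coefficients\<close>

definition RT_field :: "nat \<Rightarrow> nat \<Rightarrow> real \<Rightarrow> (edge \<Rightarrow> real) \<Rightarrow> real \<times> real \<Rightarrow> real \<times> real" where
  "RT_field m1 m2 h a x = (\<Sum>e\<in>interior_edges m1 m2. a e *\<^sub>R basis h e x)"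

definition RT_div :: "nat \<Rightarrow> nat \<Rightarrow> real \<Rightarrow> (edge \<Rightarrow> real) \<Rightarrow> real \<times> real \<Rightarrow> real" where
  "RT_div m1 m2 h a x = (\<Sum>e\<in>interior_edges m1 m2. a e * basis_div h e x)"

text \<open>Makes the four-edge formulas on an element hold next to the boundary too, where some of
  the four edges carry no coefficient.\<close>

definition zero_boundary :: "nat \<Rightarrow> nat \<Rightarrow> (edge \<Rightarrow> real) \<Rightarrow> edge \<Rightarrow> real" where
  "zero_boundary m1 m2 a e = (if e \<in> interior_edges m1 m2 then a e else 0)"

fun elem_edges :: "nat \<times> nat \<Rightarrow> edge set" where
  "elem_edges (i, j) = {VEdge i j, VEdge (Suc i) j, HEdge i j, HEdge i (Suc j)}"

text \<open>The truncated subtraction is never felt, as interior edges have positive index in the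
  normal direction.\<close>

fun edge_elems :: "edge \<Rightarrow> (nat \<times> nat) set" where
  "edge_elems (VEdge i j) = {(i - 1, j), (i, j)}"
| "edge_elems (HEdge i j) = {(i, j - 1), (i, j)}"

lemma finite_interior_edges [simp]: "finite (interior_edges m1 m2)"
proof -
  have "interior_edges m1 m2
      \<subseteq> (\<lambda>(i, j). VEdge i j) ` ({..<m1} \<times> {..<m2}) \<union> (\<lambda>(i, j). HEdge i j) ` ({..<m1} \<times> {..<m2})"
    unfolding interior_edges_def by auto
  then show ?thesis by (rule finite_subset) auto
qed

lemma VEdge_interior [simp]: "VEdge i j \<in> interior_edges m1 m2 \<longleftrightarrow> 1 \<le> i \<and> i < m1 \<and> j < m2"
  and HEdge_interior [simp]: "HEdge i j \<in> interior_edges m1 m2 \<longleftrightarrow> i < m1 \<and> 1 \<le> j \<and> j < m2"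
  unfolding interior_edges_def by auto

lemma bounded_sum_range:
  fixes f :: "'i \<Rightarrow> 'a \<Rightarrow> 'b::real_normed_vector"
  assumes "\<And>i. i \<in> I \<Longrightarrow> bounded (range (f i))"
  shows "bounded (range (\<lambda>x. \<Sum>i\<in>I. f i x))"
  using assms
proof (induction I rule: infinite_finite_induct)
  case (insert i I)
  then have "bounded (range (\<lambda>x. f i x + (\<Sum>i\<in>I. f i x)))"
    by (intro bounded_plus_comp) auto
  then show ?case using insert.hyps by simp
qed (auto simp: image_constant_conv)

context
  fixes h :: real
  assumes h: "0 < h"
begin

lemma cell_unique:
  assumes "real i * h \<le> x" "x < (real i + 1) * h" "real j * h \<le> x" "x < (real j + 1) * h"
  shows "i = j"
proof -
  have "real i * h < (real j + 1) * h" "real j * h < (real i + 1) * h" using assms by linarith+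
  then have "real i < real j + 1" "real j < real i + 1" using h by simp_all
  then show ?thesis by linarith
qed

text \<open>On cell i only the tents at its two ends survive; in the local coordinate
  \<open>s = x / h - real i\<close> they are the nodal functions 1 - s and s.\<close>

lemma tent_on_cell:
  assumes x: "real i * h \<le> x" "x < (real i + 1) * h"
  shows "tent h (real k * h) x
      = (if k = i then 1 - (x / h - real i) else if k = Suc i then x / h - real i else 0)"
    and "tent_slope h (real k * h) x = (if k = i then - 1 / h else if k = Suc i then 1 / h else 0)"
proof -
  define s where "s = x / h - real i"
  have s: "0 \<le> s" "s < 1" and x_eq: "x = (real i + s) * h"
    using x h by (auto simp: s_def field_simps)
  have d: "(x - real k * h) / h = real i + s - real k"
    using h by (simp add: x_eq field_simps)
  have "\<bar>x - real k * h\<bar> / h = \<bar>(x - real k * h) / h\<bar>" using h by simp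
  then have "tent h (real k * h) x = max 0 (1 - \<bar>real i + s - real k\<bar>)"
    unfolding tent_def d by simp
  then show "tent h (real k * h) x
      = (if k = i then 1 - (x / h - real i) else if k = Suc i then x / h - real i else 0)"
    using s by (auto simp: max_def abs_if simp flip: s_def)
  have k: "real k * h - h = (real k - 1) * h" "real k * h + h = (real k + 1) * h"
    by (simp_all add: algebra_simps)
  have c: "real k * h - h \<le> x \<longleftrightarrow> real k \<le> real i + s + 1" "x < real k * h \<longleftrightarrow> real i + s < real k"
    "real k * h \<le> x \<longleftrightarrow> real k \<le> real i + s" "x < real k * h + h \<longleftrightarrow> real i + s < real k + 1"
    unfolding x_eq k mult_le_cancel_right mult_less_cancel_right using h by auto
  show "tent_slope h (real k * h) x = (if k = i then - 1 / h else if k = Suc i then 1 / h else 0)"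
    using s unfolding tent_slope_def c by auto
qed

lemma tent_nonzero_cell:
  assumes "tent h (real k * h) x \<noteq> 0 \<or> tent_slope h (real k * h) x \<noteq> 0" "1 \<le> k"
  obtains i where "i = k - 1 \<or> i = k" "real i * h \<le> x" "x < (real i + 1) * h"
proof -
  have x: "real k * h - h \<le> x" "x < real k * h + h"
    using assms(1) tent_eq_0[OF h, of x "real k * h"] h
    by (auto simp: tent_slope_def split: if_splits)
  show ?thesis
  proof (cases "real k * h \<le> x")
    case True
    then show ?thesis using x that[of k] by (simp add: algebra_simps)
  next
    case False
    have "real (k - 1) = real k - 1" using assms(2) by simp
    then show ?thesis using False x that[of "k - 1"] by (simp add: algebra_simps)
  qed
qed

lemma basis_off_elems:
  assumes e: "e \<in> interior_edges m1 m2" and x: "x \<notin> (\<Union>T\<in>edge_elems e. elem h T)"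
  shows "basis h e x = 0" "basis_div h e x = 0"
proof -
  obtain x1 x2 where x_eq: "x = (x1, x2)" by (cases x)
  have "basis h e x = 0 \<and> basis_div h e x = 0"
  proof (cases e)
    case (VEdge i j)
    then have i: "1 \<le> i" using e by simp
    have "tent h (real i * h) x1 = 0 \<and> tent_slope h (real i * h) x1 = 0"
      if y: "real j * h \<le> x2" "x2 < (real j + 1) * h"
    proof (rule ccontr)
      assume "\<not> ?thesis"
      then obtain k where "k = i - 1 \<or> k = i" "real k * h \<le> x1" "x1 < (real k + 1) * h"
        using tent_nonzero_cell[OF _ i, of x1] by blast
      then have "(k, j) \<in> edge_elems e" "x \<in> elem h (k, j)"
        using y by (auto simp: VEdge x_eq elem_def)
      then show False using x by blast
    qed
    then show ?thesis by (auto simp: VEdge x_eq zero_prod_def)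
  next
    case (HEdge i j)
    then have j: "1 \<le> j" using e by simp
    have "tent h (real j * h) x2 = 0 \<and> tent_slope h (real j * h) x2 = 0"
      if y: "real i * h \<le> x1" "x1 < (real i + 1) * h"
    proof (rule ccontr)
      assume "\<not> ?thesis"
      then obtain k where "k = j - 1 \<or> k = j" "real k * h \<le> x2" "x2 < (real k + 1) * h"
        using tent_nonzero_cell[OF _ j, of x2] by blast
      then have "(i, k) \<in> edge_elems e" "x \<in> elem h (i, k)"
        using y by (auto simp: HEdge x_eq elem_def)
      then show False using x by blast
    qed
    then show ?thesis by (auto simp: HEdge x_eq zero_prod_def)
  qed
  then show "basis h e x = 0" "basis_div h e x = 0" by auto
qed

lemma sum_elem_edges:
  fixes f :: "edge \<Rightarrow> 'b::real_vector"
  assumes "\<And>e. e \<in> interior_edges m1 m2 - elem_edges (i, j) \<Longrightarrow> f e = 0"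
  shows "(\<Sum>e\<in>interior_edges m1 m2. a e *\<^sub>R f e)
    = zero_boundary m1 m2 a (VEdge i j) *\<^sub>R f (VEdge i j)
      + zero_boundary m1 m2 a (VEdge (Suc i) j) *\<^sub>R f (VEdge (Suc i) j)
      + zero_boundary m1 m2 a (HEdge i j) *\<^sub>R f (HEdge i j)
      + zero_boundary m1 m2 a (HEdge i (Suc j)) *\<^sub>R f (HEdge i (Suc j))"
proof -
  let ?z = "zero_boundary m1 m2 a"
  have "(\<Sum>e\<in>interior_edges m1 m2. a e *\<^sub>R f e)
      = (\<Sum>e\<in>interior_edges m1 m2 \<inter> elem_edges (i, j). ?z e *\<^sub>R f e)"
    using assms
    by (intro sum.mono_neutral_cong_right) (auto simp: zero_boundary_def simp del: elem_edges.simps)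
  also have "\<dots> = (\<Sum>e\<in>elem_edges (i, j). ?z e *\<^sub>R f e)"
    by (intro sum.mono_neutral_left) (auto simp: zero_boundary_def)
  also have "\<dots> = ?z (VEdge i j) *\<^sub>R f (VEdge i j) + ?z (VEdge (Suc i) j) *\<^sub>R f (VEdge (Suc i) j)
      + ?z (HEdge i j) *\<^sub>R f (HEdge i j) + ?z (HEdge i (Suc j)) *\<^sub>R f (HEdge i (Suc j))"
    by (simp add: add.assoc)
  finally show ?thesis .
qed

lemma basis_on_elem:
  assumes "(x, y) \<in> elem h (i, j)"
  shows "basis h (VEdge k l) (x, y) = (if l = j then
      (if k = i then 1 - (x / h - real i) else if k = Suc i then x / h - real i else 0) else 0, 0)"
    and "basis h (HEdge l k) (x, y) = (0, if l = i then
      (if k = j then 1 - (y / h - real j) else if k = Suc j then y / h - real j else 0) else 0)"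
    and "basis_div h (VEdge k l) (x, y) = (if l = j then
      (if k = i then - 1 / h else if k = Suc i then 1 / h else 0) else 0)"
    and "basis_div h (HEdge l k) (x, y) = (if l = i then
      (if k = j then - 1 / h else if k = Suc j then 1 / h else 0) else 0)"
proof -
  have x: "real i * h \<le> x" "x < (real i + 1) * h" and y: "real j * h \<le> y" "y < (real j + 1) * h"
    using assms by (auto simp: elem_def)
  have "real l * h \<le> x \<and> x < (real l + 1) * h \<longleftrightarrow> l = i" "real l * h \<le> y \<and> y < (real l + 1) * h \<longleftrightarrow> l = j" for l
    using x y cell_unique by blast+
  then show "basis h (VEdge k l) (x, y) = (if l = j then
      (if k = i then 1 - (x / h - real i) else if k = Suc i then x / h - real i else 0) else 0, 0)"
    "basis h (HEdge l k) (x, y) = (0, if l = i then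
      (if k = j then 1 - (y / h - real j) else if k = Suc j then y / h - real j else 0) else 0)"
    "basis_div h (VEdge k l) (x, y) = (if l = j then
      (if k = i then - 1 / h else if k = Suc i then 1 / h else 0) else 0)"
    "basis_div h (HEdge l k) (x, y) = (if l = i then
      (if k = j then - 1 / h else if k = Suc j then 1 / h else 0) else 0)"
    unfolding basis.simps basis_div.simps tent_on_cell[OF x] tent_on_cell[OF y] by (simp_all only:)
qed

lemma RT_field_on_elem:
  fixes m1 m2 :: nat and a :: "edge \<Rightarrow> real"
  assumes xy: "(x, y) \<in> elem h (i, j)"
  defines "z \<equiv> zero_boundary m1 m2 a"
  shows "RT_field m1 m2 h a (x, y)
    = (z (VEdge i j) * (1 - (x / h - real i)) + z (VEdge (Suc i) j) * (x / h - real i),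
       z (HEdge i j) * (1 - (y / h - real j)) + z (HEdge i (Suc j)) * (y / h - real j))"
proof -
  have "basis h e (x, y) = 0" if "e \<in> interior_edges m1 m2 - elem_edges (i, j)" for e
    using that by (cases e) (auto simp: basis_on_elem[OF xy] zero_prod_def simp del: basis.simps)
  then show ?thesis
    unfolding RT_field_def z_def by (subst sum_elem_edges) (auto simp: basis_on_elem[OF xy] simp del: basis.simps)
qed

lemma RT_div_on_elem:
  fixes m1 m2 :: nat and a :: "edge \<Rightarrow> real"
  assumes xy: "(x, y) \<in> elem h (i, j)"
  defines "z \<equiv> zero_boundary m1 m2 a"
  shows "RT_div m1 m2 h a (x, y)
    = (z (VEdge (Suc i) j) - z (VEdge i j) + (z (HEdge i (Suc j)) - z (HEdge i j))) / h"
proof -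
  have "basis_div h e (x, y) = 0" if "e \<in> interior_edges m1 m2 - elem_edges (i, j)" for e
    using that by (cases e) (auto simp: basis_on_elem[OF xy] simp del: basis_div.simps)
  then have "RT_div m1 m2 h a (x, y) = z (VEdge i j) * basis_div h (VEdge i j) (x, y)
      + z (VEdge (Suc i) j) * basis_div h (VEdge (Suc i) j) (x, y)
      + z (HEdge i j) * basis_div h (HEdge i j) (x, y)
      + z (HEdge i (Suc j)) * basis_div h (HEdge i (Suc j)) (x, y)"
    using sum_elem_edges[of m1 m2 i j "\<lambda>e. basis_div h e (x, y)" a] by (simp add: RT_div_def z_def)
  then show ?thesis by (simp add: basis_on_elem[OF xy] del: basis_div.simps) (simp add: diff_divide_distrib add_divide_distrib)
qed

lemma corner_in_elem: "(real i * h, real j * h) \<in> elem h (i, j)"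
  using h by (simp add: elem_def)

lemma elem_value_RT_div:
  "elem_value h (RT_div m1 m2 h a) (i, j)
    = (zero_boundary m1 m2 a (VEdge (Suc i) j) - zero_boundary m1 m2 a (VEdge i j)
      + (zero_boundary m1 m2 a (HEdge i (Suc j)) - zero_boundary m1 m2 a (HEdge i j))) / h"
  using RT_div_on_elem[OF corner_in_elem] by (simp add: elem_value_def)

lemma edge_elems_interior:
  "e \<in> interior_edges m1 m2 \<Longrightarrow> edge_elems e \<subseteq> elements m1 m2"
  by (cases e) (auto simp: elements_def)

lemma RT_div_in_X_h: "RT_div m1 m2 h a \<in> X_h m1 m2 h"
  unfolding X_h_def
proof (intro CollectI conjI ballI allI impI)
  fix T :: "nat \<times> nat" show "\<exists>c. \<forall>x\<in>elem h T. RT_div m1 m2 h a x = c"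
    by (cases T) (auto simp: RT_div_on_elem)
next
  fix x assume x: "x \<notin> (\<Union>T\<in>elements m1 m2. elem h T)"
  show "RT_div m1 m2 h a x = 0"
    unfolding RT_div_def
  proof (intro sum.neutral ballI)
    fix e assume e: "e \<in> interior_edges m1 m2"
    then have "x \<notin> (\<Union>T\<in>edge_elems e. elem h T)" using x edge_elems_interior by blast
    then show "a e * basis_div h e x = 0" using basis_off_elems[OF e] by simp
  qed
qed

lemma zero_normal_trace_RT_field:
  assumes S: "open S" "emeasure lborel S < \<infinity>"
    and a: "\<And>e. e \<in> interior_edges m1 m2 \<Longrightarrow> a e \<noteq> 0 \<Longrightarrow> patch h e \<subseteq> S"
  shows "zero_normal_trace S (RT_field m1 m2 h a) (RT_div m1 m2 h a)"
  unfolding zero_normal_trace_def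
proof (intro allI impI)
  let ?E = "interior_edges m1 m2"
  fix \<phi> D\<phi> assume C1: "C1_with_gradient S \<phi> D\<phi>" and b: "bounded (\<phi> ` S)" "bounded (D\<phi> ` S)"
  note c = C1_with_gradient_continuous[OF C1]
  have i1: "integrable (lebesgue_on S) (\<lambda>x. basis h e x \<bullet> D\<phi> x)" for e
    by (rule inner_lebesgue_on(2)[OF S c(2) b(2) borel_measurable_basis(1)[OF h] bounded_basis(1)[OF h]])
  have i2: "integrable (lebesgue_on S) (\<lambda>x. basis_div h e x * \<phi> x)" for e
    using inner_lebesgue_on(2)[OF S c(1) b(1) borel_measurable_basis(2)[OF h] bounded_basis(2)[OF h]]
    by simp
  have "(\<integral>x. RT_field m1 m2 h a x \<bullet> D\<phi> x \<partial>lebesgue_on S)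
      = (\<integral>x. (\<Sum>e\<in>?E. a e * (basis h e x \<bullet> D\<phi> x)) \<partial>lebesgue_on S)"
    by (simp add: RT_field_def inner_sum_left)
  also have "\<dots> = (\<Sum>e\<in>?E. a e * (\<integral>x. basis h e x \<bullet> D\<phi> x \<partial>lebesgue_on S))"
    using i1 by (subst Bochner_Integration.integral_sum) auto
  finally have 1: "(\<integral>x. RT_field m1 m2 h a x \<bullet> D\<phi> x \<partial>lebesgue_on S)
      = (\<Sum>e\<in>?E. a e * (\<integral>x. basis h e x \<bullet> D\<phi> x \<partial>lebesgue_on S))" .
  have "(\<integral>x. RT_div m1 m2 h a x * \<phi> x \<partial>lebesgue_on S)
      = (\<integral>x. (\<Sum>e\<in>?E. a e * (basis_div h e x * \<phi> x)) \<partial>lebesgue_on S)"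
    by (simp add: RT_div_def sum_distrib_right mult.assoc)
  also have "\<dots> = (\<Sum>e\<in>?E. a e * (\<integral>x. basis_div h e x * \<phi> x \<partial>lebesgue_on S))"
    using i2 by (subst Bochner_Integration.integral_sum) auto
  finally have 2: "(\<integral>x. RT_div m1 m2 h a x * \<phi> x \<partial>lebesgue_on S)
      = (\<Sum>e\<in>?E. a e * (\<integral>x. basis_div h e x * \<phi> x \<partial>lebesgue_on S))" .
  have "a e * (\<integral>x. basis h e x \<bullet> D\<phi> x \<partial>lebesgue_on S)
      + a e * (\<integral>x. basis_div h e x * \<phi> x \<partial>lebesgue_on S) = 0" if e: "e \<in> ?E" for e
  proof (cases "a e = 0")
    case False
    have "(\<integral>x. basis h e x \<bullet> D\<phi> x \<partial>lebesgue_on S) + (\<integral>x. basis_div h e x * \<phi> x \<partial>lebesgue_on S) = 0"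
      using zero_normal_trace_basis[OF h S a[OF e False]] C1 b unfolding zero_normal_trace_def by blast
    then show ?thesis by (simp flip: distrib_left)
  qed simp
  then show "(\<integral>x. RT_field m1 m2 h a x \<bullet> D\<phi> x \<partial>lebesgue_on S)
      + (\<integral>x. RT_div m1 m2 h a x * \<phi> x \<partial>lebesgue_on S) = 0"
    unfolding 1 2 sum.distrib[symmetric] by (intro sum.neutral) blast
qed

lemma RT_field_measurable_bounded:
  "RT_field m1 m2 h a \<in> borel_measurable borel" "bounded (range (RT_field m1 m2 h a))"
  "RT_div m1 m2 h a \<in> borel_measurable borel" "bounded (range (RT_div m1 m2 h a))"
proof -
  show "RT_field m1 m2 h a \<in> borel_measurable borel"
    unfolding RT_field_def[abs_def]
    by (intro borel_measurable_sum borel_measurable_scaleR borel_measurable_const borel_measurable_basis h)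
  show "RT_div m1 m2 h a \<in> borel_measurable borel"
    unfolding RT_div_def[abs_def]
    by (intro borel_measurable_sum borel_measurable_times borel_measurable_const borel_measurable_basis h)
  show "bounded (range (RT_field m1 m2 h a))"
    unfolding RT_field_def[abs_def]
    by (intro bounded_sum_range bounded_scaleR_comp bounded_basis h)
  show "bounded (range (RT_div m1 m2 h a))"
    unfolding RT_div_def[abs_def] real_scaleR_def[symmetric]
    by (intro bounded_sum_range bounded_scaleR_comp bounded_basis h)
qed

text \<open>One statement for \<Omega> and for the colored regions. Only edges interior to
  \<open>S\<close> may carry a coefficient: the others would violate the zero normal trace or leave
  support outside the given elements.\<close>

lemma RT_field_in_RT_space:
  assumes S: "open S" "emeasure lborel S < \<infinity>"
    and a: "\<And>e. e \<in> interior_edges m1 m2 \<Longrightarrow> a e \<noteq> 0 \<Longrightarrow> patch h e \<subseteq> S \<and> edge_elems e \<subseteq> \<T>"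
  shows "RT_field m1 m2 h a \<in> RT_space h S \<T>"
  unfolding RT_space_def
proof (intro CollectI conjI ballI allI impI)
  have "zero_normal_trace S (RT_field m1 m2 h a) (RT_div m1 m2 h a)"
    using a by (intro zero_normal_trace_RT_field S) auto
  then show "RT_field m1 m2 h a \<in> H0div S"
    unfolding H0div_def using RT_field_measurable_bounded
    by (auto intro!: exI[of _ "RT_div m1 m2 h a"] square_integrable_on_bounded S
        weak_divergence_if_zero_normal_trace)
next
  fix T :: "nat \<times> nat"
  obtain i j where T: "T = (i, j)" by (cases T)
  let ?z = "zero_boundary m1 m2 a"
  have "RT_field m1 m2 h a (x, y)
      = ((1 + real i) * ?z (VEdge i j) - real i * ?z (VEdge (Suc i) j)
          + (?z (VEdge (Suc i) j) - ?z (VEdge i j)) / h * x,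
        (1 + real j) * ?z (HEdge i j) - real j * ?z (HEdge i (Suc j))
          + (?z (HEdge i (Suc j)) - ?z (HEdge i j)) / h * y)"
    if "(x, y) \<in> elem h T" for x y
    using RT_field_on_elem[of x y i j m1 m2 a] that unfolding T by (simp add: algebra_simps diff_divide_distrib)
  then show "\<exists>a1 b1 a2 b2. \<forall>(x1, x2)\<in>elem h T. RT_field m1 m2 h a (x1, x2) = (a1 + b1 * x1, a2 + b2 * x2)"
    by blast
next
  fix x assume x: "x \<notin> (\<Union>T\<in>\<T>. elem h T)"
  have "a e *\<^sub>R basis h e x = 0" if e: "e \<in> interior_edges m1 m2" for e
    using basis_off_elems(1)[OF e, of x] a[OF e] x by (cases "a e = 0") auto
  then show "RT_field m1 m2 h a x = 0" unfolding RT_field_def by (intro sum.neutral) blast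
qed

end

section \<open>Discrete divergence and edge values\<close>

definition bump :: "real \<Rightarrow> real" where
  "bump t = (max 0 (1 - t\<^sup>2))\<^sup>2"

definition bump_deriv :: "real \<Rightarrow> real" where
  "bump_deriv t = - 4 * t * max 0 (1 - t\<^sup>2)"

text \<open>The outer square in \<open>bump\<close> removes the corner of the positive part; the
  test functions need not be smoother than C1.\<close>

lemma DERIV_max_0_square: "((\<lambda>y. (max 0 y)\<^sup>2) has_real_derivative 2 * max 0 y) (at y)"
proof (cases y "0 :: real" rule: linorder_cases)
  case less
  have "((\<lambda>y. 0) has_real_derivative 0) (at y)" by simp
  then have "((\<lambda>y. (max 0 y)\<^sup>2) has_real_derivative 0) (at y)"
    by (rule has_field_derivative_transform_within_open[where S = "{..<0}"]) (use less in auto)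
  then show ?thesis using less by simp
next
  case greater
  have "((\<lambda>y. y\<^sup>2) has_real_derivative 2 * y) (at y)"
    by (auto intro!: derivative_eq_intros)
  then have "((\<lambda>y. (max 0 y)\<^sup>2) has_real_derivative 2 * y) (at y)"
    by (rule has_field_derivative_transform_within_open[where S = "{0<..}"]) (use greater in auto)
  then show ?thesis using greater by simp
next
  case equal
  have "((\<lambda>d :: real. (max 0 d)\<^sup>2 / d) \<longlongrightarrow> 0) (at 0)"
  proof (rule Lim_null_comparison[OF always_eventually])
    show "\<forall>d :: real. norm ((max 0 d)\<^sup>2 / d) \<le> \<bar>d\<bar>"
      by (auto simp: max_def power2_eq_square)
    show "((\<lambda>d :: real. \<bar>d\<bar>) \<longlongrightarrow> 0) (at 0)" by (auto intro!: tendsto_eq_intros)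
  qed
  then show ?thesis using equal by (simp add: DERIV_def)
qed

lemma DERIV_bump: "(bump has_real_derivative bump_deriv t) (at t)"
proof -
  have "((\<lambda>t. 1 - t\<^sup>2) has_real_derivative - (2 * t)) (at t)"
    by (auto intro!: derivative_eq_intros)
  from DERIV_chain2[OF DERIV_max_0_square this] show ?thesis
    unfolding bump_def[abs_def] bump_deriv_def by (simp add: mult_ac)
qed

lemma continuous_bump: "continuous_on UNIV bump" "continuous_on UNIV bump_deriv"
  unfolding bump_def[abs_def] bump_deriv_def[abs_def] by (intro continuous_intros)+

lemma bump_outside: "1 \<le> \<bar>t\<bar> \<Longrightarrow> bump t = 0" "1 \<le> \<bar>t\<bar> \<Longrightarrow> bump_deriv t = 0"
proof -
  assume "1 \<le> \<bar>t\<bar>"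
  then have "1 \<le> t\<^sup>2" using power_mono[of 1 "\<bar>t\<bar>" 2] by simp
  then show "bump t = 0" "bump_deriv t = 0" by (simp_all add: bump_def bump_deriv_def)
qed

text \<open>The last bound is invariant under rescaling of the argument: it keeps (x - c) times the
  derivative bounded for bumps around c whose width tends to zero.\<close>

lemma bump_bounds: "0 \<le> bump t" "bump t \<le> 1" "\<bar>bump_deriv t\<bar> \<le> 4" "\<bar>t * bump_deriv t\<bar> \<le> 4"
proof -
  have m: "0 \<le> max 0 (1 - t\<^sup>2)" "max 0 (1 - t\<^sup>2) \<le> 1" by auto
  show "0 \<le> bump t" "bump t \<le> 1" using m by (auto simp: bump_def intro: power_le_one)
  have "\<bar>bump_deriv t\<bar> \<le> 4 \<and> \<bar>t * bump_deriv t\<bar> \<le> 4"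
  proof (cases "1 \<le> \<bar>t\<bar>")
    case False
    have "\<bar>bump_deriv t\<bar> = 4 * (\<bar>t\<bar> * max 0 (1 - t\<^sup>2))"
      using m by (simp add: bump_deriv_def abs_mult)
    also have "\<dots> \<le> 4 * (1 * 1)" using False m by (intro mult_left_mono mult_mono) auto
    finally have *: "\<bar>bump_deriv t\<bar> \<le> 4" by simp
    then have "\<bar>t\<bar> * \<bar>bump_deriv t\<bar> \<le> 1 * 4" using False by (intro mult_mono) auto
    with * show ?thesis by (simp add: abs_mult)
  qed (simp add: bump_outside)
  then show "\<bar>bump_deriv t\<bar> \<le> 4" "\<bar>t * bump_deriv t\<bar> \<le> 4" by auto
qed

lemma bump_pos: "\<bar>t\<bar> < 1 \<Longrightarrow> 0 < bump t"
  using power_strict_mono[of "\<bar>t\<bar>" 1 2] by (simp add: bump_def)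

lemma DERIV_scaled_bump:
  "((\<lambda>x. bump ((x - c) * l)) has_real_derivative l * bump_deriv ((x - c) * l)) (at x)"
proof -
  have "((\<lambda>x. (x - c) * l) has_real_derivative l) (at x)"
    by (auto intro!: derivative_eq_intros)
  from DERIV_chain2[OF DERIV_bump this] show ?thesis by (simp add: mult.commute)
qed

lemma continuous_scaled_bump:
  "continuous_on UNIV (\<lambda>x. bump ((x - c) * l))"
  "continuous_on UNIV (\<lambda>x. l * bump_deriv ((x - c) * l))"
  by (intro continuous_intros continuous_on_compose2[OF continuous_bump(1)]
      continuous_on_compose2[OF continuous_bump(2)]; simp)+

lemma C1_with_gradient_product:
  assumes u: "\<And>x. (u has_real_derivative u' x) (at x)" "continuous_on UNIV u'"
    and v: "\<And>x. (v has_real_derivative v' x) (at x)" "continuous_on UNIV v'"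
  shows "C1_with_gradient S (\<lambda>(x, y). u x * v y) (\<lambda>(x, y). (u' x * v y, u x * v' y))"
  unfolding C1_with_gradient_def
proof
  have "GDERIV (\<lambda>(x, y). u x * v y) z :> (case z of (x, y) \<Rightarrow> (u' x * v y, u x * v' y))" for z
  proof -
    have fst: "((\<lambda>z. u (fst z)) has_derivative (\<lambda>d. fst d * u' (fst z))) (at z)"
      using has_derivative_compose[OF has_derivative_fst[OF has_derivative_ident]
          u(1)[unfolded has_field_derivative_def]] by (simp add: mult.commute)
    have snd: "((\<lambda>z. v (snd z)) has_derivative (\<lambda>d. snd d * v' (snd z))) (at z)"
      using has_derivative_compose[OF has_derivative_snd[OF has_derivative_ident]
          v(1)[unfolded has_field_derivative_def]] by (simp add: mult.commute)
    show ?thesis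
      unfolding gderiv_def using has_derivative_mult[OF fst snd]
      by (cases z) (simp add: case_prod_beta' inner_prod_def algebra_simps)
  qed
  then show "\<forall>z\<in>S. GDERIV (\<lambda>(x, y). u x * v y) z :> (case z of (x, y) \<Rightarrow> (u' x * v y, u x * v' y))"
    by blast
  have c: "continuous_on S (\<lambda>z. k (fst z))" "continuous_on S (\<lambda>z. k (snd z))"
    if "continuous_on UNIV k" for k :: "real \<Rightarrow> real"
    by (rule continuous_on_compose2[OF that]; simp add: continuous_on_fst continuous_on_snd)+
  have "continuous_on UNIV u" "continuous_on UNIV v"
    by (intro continuous_at_imp_continuous_on ballI DERIV_isCont[OF u(1)] DERIV_isCont[OF v(1)])+
  then show "continuous_on S (\<lambda>(x, y). (u' x * v y, u x * v' y))"
    unfolding case_prod_beta' using u(2) v(2)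
    by (intro continuous_on_Pair continuous_on_mult c)
qed

lemma lborel_integral_pos:
  fixes f :: "real \<times> real \<Rightarrow> real"
  assumes f: "integrable lborel f" "\<And>x. 0 \<le> f x" and U: "open U" "U \<noteq> {}" "\<And>x. x \<in> U \<Longrightarrow> 0 < f x"
  shows "0 < integral\<^sup>L lborel f"
proof -
  have "integral\<^sup>L lborel f \<noteq> 0"
  proof
    assume "integral\<^sup>L lborel f = 0"
    then have "AE x in lborel. f x = 0"
      using f by (subst (asm) integral_nonneg_eq_0_iff_AE) auto
    then have "AE x in lborel. x \<notin> U" by eventually_elim (use U(3) in force)
    then have "U \<in> null_sets lborel"
      using U(1) by (subst (asm) AE_iff_null_sets[symmetric]) auto
    then have "negligible U"
      using negligible_iff_null_sets null_sets_completionI by blast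
    then show False using open_not_negligible[OF U(1,2)] by blast
  qed
  moreover have "0 \<le> integral\<^sup>L lborel f" using f(2) by (intro Bochner_Integration.integral_nonneg) auto
  ultimately show ?thesis by simp
qed

section \<open>Uniqueness of the piecewise constant weak divergence\<close>

lemma open_Omega: "open (Omega m1 m2 h)"
  by (simp add: Omega_def open_Times)

lemma emeasure_Omega: "emeasure lborel (Omega m1 m2 h) < \<infinity>"
proof -
  have "bounded (Omega m1 m2 h)" unfolding Omega_def by (intro bounded_Times) simp_all
  then show ?thesis using emeasure_bounded_finite by auto
qed

lemma cell_subset_Omega:
  assumes "0 < h" "i < m1" "j < m2"
  shows "{real i * h<..<(real i + 1) * h} \<times> {real j * h<..<(real j + 1) * h} \<subseteq> Omega m1 m2 h"
proof -
  have "(real i + 1) * h \<le> real m1 * h" "(real j + 1) * h \<le> real m2 * h"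
    using assms by (auto intro!: mult_right_mono)
  moreover have "0 \<le> real i * h" "0 \<le> real j * h" using assms by auto
  ultimately show ?thesis unfolding Omega_def by auto
qed

lemma X_h_eqI:
  assumes "0 < h" "u \<in> X_h m1 m2 h" "v \<in> X_h m1 m2 h"
    and "\<And>T. T \<in> elements m1 m2 \<Longrightarrow> elem_value h u T = elem_value h v T"
  shows "u = v"
proof
  fix x
  have val: "w x = elem_value h w T" if w: "w \<in> X_h m1 m2 h" and T: "T \<in> elements m1 m2" and x: "x \<in> elem h T" for w T
  proof -
    obtain i j where ij: "T = (i, j)" by (cases T)
    obtain c where "\<forall>x\<in>elem h T. w x = c" using w T unfolding X_h_def by blast
    then show ?thesis using corner_in_elem[OF assms(1), of i j] x by (simp add: ij elem_value_def)
  qed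
  show "u x = v x"
  proof (cases "x \<in> (\<Union>T\<in>elements m1 m2. elem h T)")
    case True
    then obtain T where "T \<in> elements m1 m2" "x \<in> elem h T" by blast
    then show ?thesis using val[OF assms(2)] val[OF assms(3)] assms(4) by simp
  next
    case False
    then have "u x = 0" "v x = 0" using assms(2,3) unfolding X_h_def by blast+
    then show ?thesis by simp
  qed
qed

text \<open>Justifies the description operator in \<open>div_h\<close>. A bump supported inside one
  element sees the candidates there as constants and has positive integral.\<close>

lemma weak_divergence_X_h_unique:
  assumes h: "0 < h" and u: "u \<in> X_h m1 m2 h" "weak_divergence (Omega m1 m2 h) p u"
    and v: "v \<in> X_h m1 m2 h" "weak_divergence (Omega m1 m2 h) p v"
  shows "u = v"
proof (rule X_h_eqI[OF h u(1) v(1)])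
  fix T assume T: "T \<in> elements m1 m2"
  obtain i j where ij: "T = (i, j)" by (cases T)
  then have lt: "i < m1" "j < m2" using T by (auto simp: elements_def)
  let ?\<Omega> = "Omega m1 m2 h"
  \<comment> \<open>Center of the element and scaling to half-width h / 4, which keeps the closed
    support inside the open element.\<close>
  let ?a = "(real i + 1 / 2) * h" and ?b = "(real j + 1 / 2) * h" and ?l = "4 / h"
  let ?\<phi> = "\<lambda>(x, y). bump ((x - ?a) * ?l) * bump ((y - ?b) * ?l)"
  let ?D\<phi> = "\<lambda>(x, y). (?l * bump_deriv ((x - ?a) * ?l) * bump ((y - ?b) * ?l),
    bump ((x - ?a) * ?l) * (?l * bump_deriv ((y - ?b) * ?l)))"
  let ?K = "{?a - h / 4..?a + h / 4} \<times> {?b - h / 4..?b + h / 4}"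
  have C1: "C1_with_gradient ?\<Omega> ?\<phi> ?D\<phi>"
    by (intro C1_with_gradient_product DERIV_scaled_bump continuous_scaled_bump)
  have zero: "bump ((x - c) * ?l) = 0" if "x \<notin> {c - h / 4..c + h / 4}" for x c
    using that h by (intro bump_outside) (auto simp: abs_if field_simps)
  have K0: "?\<phi> x = 0" if "x \<notin> ?K" for x
    using that zero by (cases x) auto
  have Kcell: "?K \<subseteq> {real i * h<..<(real i + 1) * h} \<times> {real j * h<..<(real j + 1) * h}"
    using h by (auto simp: algebra_simps)
  have K: "compact ?K" "?K \<subseteq> ?\<Omega>"
    using Kcell cell_subset_Omega[OF h lt] by (auto intro!: compact_Times)
  have Kelem: "?K \<subseteq> elem h T" using Kcell by (fastforce simp: ij elem_def)
  have eq: "(\<integral>x. w x * ?\<phi> x \<partial>lebesgue_on ?\<Omega>) = elem_value h w T * (\<integral>x. ?\<phi> x \<partial>lebesgue_on ?\<Omega>)"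
    if w: "w \<in> X_h m1 m2 h" for w
  proof -
    obtain c where c: "\<And>x. x \<in> elem h T \<Longrightarrow> w x = c" using w T unfolding X_h_def by blast
    have "elem_value h w T = c"
      using c[of "(real i * h, real j * h)"] corner_in_elem[OF h, of i j] by (simp add: ij elem_value_def)
    then have "w x = elem_value h w T" if "x \<in> ?K" for x
      using c[of x] Kelem that by blast
    then have "w x * ?\<phi> x = elem_value h w T * ?\<phi> x" for x
      using K0[of x] by (cases "x \<in> ?K") (simp_all only: mult_zero_right not_False_eq_True simp_thms)
    then show ?thesis by (simp only: integral_mult_right_zero)
  qed
  have b: "bounded (?\<phi> ` ?\<Omega>)"
  proof -
    have "norm (?\<phi> x) \<le> 1" for x
      using bump_bounds(1,2) by (cases x) (auto simp: abs_mult intro!: mult_le_one)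
    then show ?thesis unfolding bounded_iff by blast
  qed
  have b1: "(\<lambda>x. 1 :: real) \<in> borel_measurable borel" "bounded (range (\<lambda>x :: real \<times> real. 1 :: real))"
    by (auto simp: image_constant_conv)
  note i = inner_lebesgue_on[OF open_Omega emeasure_Omega
      C1_with_gradient_continuous(1)[OF C1] b b1, unfolded inner_real_def mult_1]
  have "0 < (\<integral>x. indicator ?\<Omega> x * ?\<phi> x \<partial>lborel)"
  proof (rule lborel_integral_pos[OF i(1)])
    show "0 \<le> indicator ?\<Omega> x * ?\<phi> x" for x using bump_bounds(1) by (cases x) auto
    let ?U = "{?a - h / 4<..<?a + h / 4} \<times> {?b - h / 4<..<?b + h / 4}"
    show "open ?U" by (intro open_Times) auto
    show "?U \<noteq> {}" using h by auto
    fix x assume x: "x \<in> ?U"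
    then have "x \<in> ?\<Omega>" using K(2) by fastforce
    moreover have "0 < bump ((x - c) * ?l)" if "x \<in> {c - h / 4<..<c + h / 4}" for x c
      using that h by (intro bump_pos) (auto simp: abs_if field_simps)
    ultimately show "0 < indicator ?\<Omega> x * ?\<phi> x" using x by (cases x) auto
  qed
  then have pos: "0 < (\<integral>x. ?\<phi> x \<partial>lebesgue_on ?\<Omega>)" using i(3) by simp
  have "(\<integral>x. u x * ?\<phi> x \<partial>lebesgue_on ?\<Omega>) = (\<integral>x. v x * ?\<phi> x \<partial>lebesgue_on ?\<Omega>)"
  proof -
    have "\<exists>K. compact K \<and> K \<subseteq> ?\<Omega> \<and> (\<forall>x\<in>?\<Omega> - K. ?\<phi> x = 0)" using K K0 by blast
    then have "(\<integral>x. p x \<bullet> ?D\<phi> x \<partial>lebesgue_on ?\<Omega>) = - (\<integral>x. u x * ?\<phi> x \<partial>lebesgue_on ?\<Omega>)"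
      "(\<integral>x. p x \<bullet> ?D\<phi> x \<partial>lebesgue_on ?\<Omega>) = - (\<integral>x. v x * ?\<phi> x \<partial>lebesgue_on ?\<Omega>)"
      using u(2) v(2) C1 unfolding weak_divergence_def by blast+
    then show ?thesis by simp
  qed
  then show "elem_value h u T = elem_value h v T"
    unfolding eq[OF u(1)] eq[OF v(1)] using pos by simp
qed

section \<open>Divergence and edge values of assembled fields\<close>

lemma patch_subset_Omega:
  assumes h: "0 < h" and e: "e \<in> interior_edges m1 m2"
  shows "patch h e \<subseteq> Omega m1 m2 h"
proof (cases e)
  case (VEdge i j)
  then have b: "1 * h \<le> real i * h" "(real i + 1) * h \<le> real m1 * h"
    "(real j + 1) * h \<le> real m2 * h" "0 \<le> real j * h"
    using e h by (auto intro!: mult_right_mono)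
  show ?thesis
  proof
    fix x assume "x \<in> patch h e"
    note x = this[unfolded VEdge patch.simps mem_Times_iff greaterThanLessThan_iff]
    show "x \<in> Omega m1 m2 h"
      unfolding Omega_def mem_Times_iff greaterThanLessThan_iff using x b by (simp only: distrib_right) linarith
  qed
next
  case (HEdge i j)
  then have b: "1 * h \<le> real j * h" "(real i + 1) * h \<le> real m1 * h"
    "(real j + 1) * h \<le> real m2 * h" "0 \<le> real i * h"
    using e h by (auto intro!: mult_right_mono)
  show ?thesis
  proof
    fix x assume "x \<in> patch h e"
    note x = this[unfolded HEdge patch.simps mem_Times_iff greaterThanLessThan_iff]
    show "x \<in> Omega m1 m2 h"
      unfolding Omega_def mem_Times_iff greaterThanLessThan_iff using x b by (simp only: distrib_right) linarith
  qed
qed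

lemma RT_field_in_Y_h:
  assumes "0 < h"
  shows "RT_field m1 m2 h a \<in> Y_h m1 m2 h"
  unfolding Y_h_def
  using patch_subset_Omega[OF assms] edge_elems_interior
  by (intro RT_field_in_RT_space assms open_Omega emeasure_Omega) (blast intro: assms)+

lemma div_h_RT_field:
  assumes h: "0 < h"
  shows "div_h m1 m2 h (RT_field m1 m2 h a) = RT_div m1 m2 h a"
  unfolding div_h_def
proof (rule the_equality)
  have "weak_divergence (Omega m1 m2 h) (RT_field m1 m2 h a) (RT_div m1 m2 h a)"
    using patch_subset_Omega[OF h]
    by (intro weak_divergence_if_zero_normal_trace zero_normal_trace_RT_field h open_Omega emeasure_Omega)
  then show *: "RT_div m1 m2 h a \<in> X_h m1 m2 h
      \<and> weak_divergence (Omega m1 m2 h) (RT_field m1 m2 h a) (RT_div m1 m2 h a)"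
    using RT_div_in_X_h[OF h] by blast
  show "g = RT_div m1 m2 h a"
    if "g \<in> X_h m1 m2 h \<and> weak_divergence (Omega m1 m2 h) (RT_field m1 m2 h a) g" for g
    using weak_divergence_X_h_unique[OF h] * that by blast
qed

text \<open>The value is known on the half-open edge only, since its upper end point belongs to the
  next element; one point does not affect the integral.\<close>

lemma edge_value_VEdge:
  assumes h: "0 < h" and p: "\<And>y. real j * h \<le> y \<Longrightarrow> y < (real j + 1) * h \<Longrightarrow> fst (p (real i * h, y)) = c"
  shows "edge_value h p (VEdge i j) = c"
proof -
  let ?I = "{real j * h..(real j + 1) * h}"
  have "((\<lambda>_. c) has_integral h * c) ?I"
    using has_integral_const_real[of c "real j * h" "(real j + 1) * h"] h by (simp add: algebra_simps)
  then have "((\<lambda>y. p (real i * h, y) \<bullet> (1, 0)) has_integral h * c) ?I"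
    by (rule has_integral_spike_finite[of "{(real j + 1) * h}", rotated -1])
      (use p in \<open>auto simp: inner_prod_def\<close>)
  then have "integral ?I (\<lambda>y. p (real i * h, y) \<bullet> (1, 0)) = h * c"
    by (rule integral_unique)
  then show ?thesis using h by simp
qed

lemma edge_value_HEdge:
  assumes h: "0 < h" and p: "\<And>x. real i * h \<le> x \<Longrightarrow> x < (real i + 1) * h \<Longrightarrow> snd (p (x, real j * h)) = c"
  shows "edge_value h p (HEdge i j) = c"
proof -
  let ?I = "{real i * h..(real i + 1) * h}"
  have "((\<lambda>_. c) has_integral h * c) ?I"
    using has_integral_const_real[of c "real i * h" "(real i + 1) * h"] h by (simp add: algebra_simps)
  then have "((\<lambda>x. p (x, real j * h) \<bullet> (0, 1)) has_integral h * c) ?I"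
    by (rule has_integral_spike_finite[of "{(real i + 1) * h}", rotated -1])
      (use p in \<open>auto simp: inner_prod_def\<close>)
  then have "integral ?I (\<lambda>x. p (x, real j * h) \<bullet> (0, 1)) = h * c"
    by (rule integral_unique)
  then show ?thesis using h by simp
qed

lemma edge_value_RT_field:
  assumes h: "0 < h" and e: "e \<in> interior_edges m1 m2"
  shows "edge_value h (RT_field m1 m2 h a) e = a e"
proof (cases e)
  case (VEdge i j)
  have "fst (RT_field m1 m2 h a (real i * h, y)) = a e" if "real j * h \<le> y" "y < (real j + 1) * h" for y
  proof -
    have "(real i * h, y) \<in> elem h (i, j)" using that h by (simp add: elem_def)
    then show ?thesis using e h by (simp add: RT_field_on_elem[OF h] zero_boundary_def VEdge)
  qed
  then show ?thesis unfolding VEdge by (intro edge_value_VEdge[OF h])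
next
  case (HEdge i j)
  have "snd (RT_field m1 m2 h a (x, real j * h)) = a e" if "real i * h \<le> x" "x < (real i + 1) * h" for x
  proof -
    have "(x, real j * h) \<in> elem h (i, j)" using that h by (simp add: elem_def)
    then show ?thesis using e h by (simp add: RT_field_on_elem[OF h] zero_boundary_def HEdge)
  qed
  then show ?thesis unfolding HEdge by (intro edge_value_HEdge[OF h])
qed

section \<open>Continuity of normal components across grid lines\<close>

lemma integrable_lborel_bounded:
  fixes f :: "real \<times> real \<Rightarrow> real"
  assumes "f \<in> borel_measurable borel" "\<And>x. \<bar>f x\<bar> \<le> B" "bounded A" "A \<in> sets borel" "\<And>x. x \<notin> A \<Longrightarrow> f x = 0"
  shows "integrable lborel f"
proof (rule integrableI_bounded_set[where A = A and B = B])
  show "emeasure lborel A < \<infinity>" using assms(3) by (rule emeasure_bounded_finite)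
qed (use assms in auto)

lemma integrable_mult_bounded:
  fixes f g :: "real \<times> real \<Rightarrow> real"
  assumes "integrable lborel f" "g \<in> borel_measurable borel" "\<And>x. \<bar>g x\<bar> \<le> B"
  shows "integrable lborel (\<lambda>x. f x * g x)"
proof (rule Bochner_Integration.integrable_bound)
  show "integrable lborel (\<lambda>x. B * f x)" using assms(1) by simp
  show "(\<lambda>x. f x * g x) \<in> borel_measurable lborel"
    using assms(1,2) by (intro borel_measurable_times) auto
  have "\<bar>f x\<bar> * \<bar>g x\<bar> \<le> \<bar>B\<bar> * \<bar>f x\<bar>" for x
    using assms(3)[of x] by (subst mult.commute) (intro mult_right_mono; simp)
  then show "AE x in lborel. norm (f x * g x) \<le> norm (B * f x)"
    by (simp add: abs_mult)
qed

lemma borel_measurable_fst_snd: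
  fixes k :: "real \<Rightarrow> real"
  assumes "k \<in> borel_measurable borel"
  shows "(\<lambda>x. k (fst x)) \<in> borel_measurable (borel :: (real \<times> real) measure)"
    and "(\<lambda>x. k (snd x)) \<in> borel_measurable (borel :: (real \<times> real) measure)"
proof -
  show "(\<lambda>x. k (fst x)) \<in> borel_measurable (borel :: (real \<times> real) measure)"
    by (rule measurable_compose[OF borel_measurable_continuous_onI assms]) (intro continuous_intros)
  show "(\<lambda>x. k (snd x)) \<in> borel_measurable (borel :: (real \<times> real) measure)"
    by (rule measurable_compose[OF borel_measurable_continuous_onI assms]) (intro continuous_intros)
qed

lemma abs_mult_le: "\<bar>a\<bar> \<le> A \<Longrightarrow> \<bar>b\<bar> \<le> B \<Longrightarrow> \<bar>a * b\<bar> \<le> A * (B :: real)"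
  by (simp add: abs_mult mult_mono')

text \<open>The derivative of the bump integrates to 1 left of c and to -1 right of c, whatever the
  width. Tested against a step function it therefore returns the jump, without any limit.\<close>

lemma bump_jump_integral:
  assumes l: "0 < l"
  shows "((\<lambda>x. (if x < c then cl else cr) * (l * bump_deriv ((x - c) * l))) has_integral (cl - cr)) UNIV"
proof -
  let ?u = "\<lambda>x. bump ((x - c) * l)" and ?u' = "\<lambda>x. l * bump_deriv ((x - c) * l)"
  let ?f = "\<lambda>x. (if x < c then cl else cr) * ?u' x"
  let ?a = "c - 1 / l" and ?b = "c + 1 / l"
  have ab: "?a \<le> c" "c \<le> ?b" using l by auto
  have u0: "?u ?a = 0" "?u ?b = 0" "?u c = 1" "?u' c = 0"
    using l by (simp_all add: bump_outside) (simp_all add: bump_def bump_deriv_def)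
  have D: "(?u has_vector_derivative ?u' x) (at x within S)" for x S
    using DERIV_scaled_bump[of c l x]
    by (simp add: has_real_derivative_iff_has_vector_derivative has_vector_derivative_at_within)
  have 1: "((\<lambda>x. cl * ?u' x) has_integral cl * (?u c - ?u ?a)) {?a..c}"
    by (intro has_integral_mult_right fundamental_theorem_of_calculus ab D)
  have "(?f has_integral cl * (?u c - ?u ?a)) {?a..c}"
    by (rule has_integral_eq[OF _ 1]) (use u0 in \<open>auto simp: less_le\<close>)
  then have 1: "(?f has_integral cl) {?a..c}" using u0 by simp
  have 2: "((\<lambda>x. cr * ?u' x) has_integral cr * (?u ?b - ?u c)) {c..?b}"
    by (intro has_integral_mult_right fundamental_theorem_of_calculus ab D)
  have "(?f has_integral cr * (?u ?b - ?u c)) {c..?b}"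
    by (rule has_integral_eq[OF _ 2]) auto
  then have 2: "(?f has_integral - cr) {c..?b}" using u0 by simp
  have "(?f has_integral (cl + - cr)) {?a..?b}"
    by (rule has_integral_combine[OF ab 1 2])
  then have "(?f has_integral (cl - cr)) {?a..?b}" by simp
  moreover have "?f x = 0" if "x \<notin> {?a..?b}" for x
  proof -
    have "1 / l \<le> \<bar>x - c\<bar>" using that by auto
    then have "1 \<le> \<bar>(x - c) * l\<bar>" using l by (simp add: abs_mult divide_le_eq)
    then show ?thesis by (simp add: bump_outside)
  qed
  ultimately show ?thesis by (rule has_integral_on_superset) auto
qed

text \<open>Green's formula over the whole plane for a field with components \<open>P\<close> and
  \<open>Q\<close> and divergence \<open>G\<close>. Being free of a domain, it treats boundary lines
  like interior ones; separate components allow the axes to be exchanged.\<close>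

definition product_weak_divergence ::
  "(real \<times> real \<Rightarrow> real) \<Rightarrow> (real \<times> real \<Rightarrow> real) \<Rightarrow> (real \<times> real \<Rightarrow> real) \<Rightarrow> bool" where
  "product_weak_divergence P Q G \<longleftrightarrow> (\<forall>u u' v v'.
     (\<forall>x. (u has_real_derivative u' x) (at x)) \<longrightarrow> continuous_on UNIV u' \<longrightarrow>
     (\<forall>y. (v has_real_derivative v' y) (at y)) \<longrightarrow> continuous_on UNIV v' \<longrightarrow>
     bounded (range u) \<longrightarrow> bounded (range u') \<longrightarrow> bounded (range v) \<longrightarrow> bounded (range v') \<longrightarrow>
     (\<integral>(x, y). P (x, y) * (u' x * v y) + Q (x, y) * (u x * v' y) + G (x, y) * (u x * v y) \<partial>lborel) = 0)"

lemma product_weak_divergenceD: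
  assumes "product_weak_divergence P Q G"
    and "\<And>x. (u has_real_derivative u' x) (at x)" "continuous_on UNIV u'"
    and "\<And>y. (v has_real_derivative v' y) (at y)" "continuous_on UNIV v'"
    and "bounded (range u)" "bounded (range u')" "bounded (range v)" "bounded (range v')"
  shows "(\<integral>(x, y). P (x, y) * (u' x * v y) + Q (x, y) * (u x * v' y) + G (x, y) * (u x * v y) \<partial>lborel) = 0"
  using assms unfolding product_weak_divergence_def by blast

text \<open>
  Testing with \<open>u(x) v(y)\<close>, where \<open>u\<close> is a bump of height one and width tending to zero around the
  line \<open>x = c\<close>, isolates the jump of \<open>P\<close> across that line: all other contributions vanish in the
  limit by dominated convergence.
\<close>

lemma no_jump:
  fixes P Q G :: "real \<times> real \<Rightarrow> real"
  assumes h: "0 < h" and P: "integrable lborel P" and Q: "integrable lborel Q" and G: "integrable lborel G"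
    and div: "product_weak_divergence P Q G"
    and right: "\<And>x y. c < x \<Longrightarrow> x < c + h \<Longrightarrow> d < y \<Longrightarrow> y < d + h \<Longrightarrow> P (x, y) = pr + br * (x - c)"
    and left: "\<And>x y. c - h < x \<Longrightarrow> x < c \<Longrightarrow> d < y \<Longrightarrow> y < d + h \<Longrightarrow> P (x, y) = pl + bl * (x - c)"
  shows "pl = pr"
proof -
  \<comment> \<open>Half-width \<open>h / real (Suc n)\<close>: never more than h, so that the bump
    stays within the two columns where \<open>P\<close> is known.\<close>
  define l where "l n = real (Suc n) / h" for n
  have l: "0 < l n" "1 / l n \<le> h" for n using h by (simp_all add: l_def divide_le_eq)
  define u where "u n x = bump ((x - c) * l n)" for n x
  define u' where "u' n x = l n * bump_deriv ((x - c) * l n)" for n x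
  define v where "v y = bump ((y - (d + h / 2)) * (2 / h))" for y
  define v' where "v' y = 2 / h * bump_deriv ((y - (d + h / 2)) * (2 / h))" for y
  have du: "(u n has_real_derivative u' n x) (at x)" "continuous_on UNIV (u n)" "continuous_on UNIV (u' n)" for n x
    unfolding u_def[abs_def] u'_def[abs_def]
    by (rule DERIV_scaled_bump continuous_scaled_bump)+
  have dv: "(v has_real_derivative v' y) (at y)" "continuous_on UNIV v" "continuous_on UNIV v'" for y
    unfolding v_def[abs_def] v'_def[abs_def]
    by (rule DERIV_scaled_bump continuous_scaled_bump)+
  have bu: "0 \<le> u n x" "u n x \<le> 1" "\<bar>u' n x\<bar> \<le> l n * 4" "\<bar>u n x\<bar> \<le> 1" for n x
    using bump_bounds l(1)[of n] by (simp_all add: u_def u'_def abs_mult)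
  have bu': "\<bar>(x - c) * u' n x\<bar> \<le> 4" for n x
    using bump_bounds(4)[of "(x - c) * l n"] by (simp add: u'_def mult_ac)
  have bv: "0 \<le> v y" "v y \<le> 1" "\<bar>v' y\<bar> \<le> 2 / h * 4" "\<bar>v y\<bar> \<le> 1" for y
  proof -
    show "0 \<le> v y" "v y \<le> 1" "\<bar>v y\<bar> \<le> 1" using bump_bounds by (simp_all add: v_def)
    have "\<bar>2 / h\<bar> \<le> 2 / h" using h by simp
    then show "\<bar>v' y\<bar> \<le> 2 / h * 4" unfolding v'_def by (rule abs_mult_le) (rule bump_bounds)
  qed
  have v0: "v y = 0" if "\<not> (d < y \<and> y < d + h)" for y
    unfolding v_def using that h by (intro bump_outside(1)) (auto simp: abs_if field_simps)
  have u0: "u n x = 0" "u' n x = 0" if "1 / l n \<le> \<bar>x - c\<bar>" for n x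
  proof -
    have "1 \<le> \<bar>(x - c) * l n\<bar>" using that l(1)[of n] by (simp add: abs_mult divide_le_eq)
    then show "u n x = 0" "u' n x = 0" by (simp_all add: u_def u'_def bump_outside)
  qed
  have meas: "u n \<in> borel_measurable borel" "u' n \<in> borel_measurable borel"
    "v \<in> borel_measurable borel" "v' \<in> borel_measurable borel" for n
    using du dv by (auto intro: borel_measurable_continuous_onI)
  note m = meas(1,2)[THEN borel_measurable_fst_snd(1)] meas(3,4)[THEN borel_measurable_fst_snd(2)]
  define T where "T n z = P z * (u' n (fst z) * v (snd z)) + Q z * (u n (fst z) * v' (snd z))
      + G z * (u n (fst z) * v (snd z))" for n z
  \<comment> \<open>\<open>J\<close> is the singular part of \<open>T\<close>, with the one-sided
    limits of \<open>P\<close> in place of \<open>P\<close>. In \<open>W\<close>, the function of x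
    has mass one, so the integral of \<open>J\<close> is \<open>pl - pr\<close> times that of
    \<open>W\<close> for every n, while \<open>T\<close> integrates to 0 and \<open>T - J\<close>
    tends to 0.\<close>
  define J where "J n z = (if fst z < c then pl else pr) * u' n (fst z) * v (snd z)" for n z
  define W where "W z = indicator {c..c + 1} (fst z) * v (snd z)" for z :: "real \<times> real"
  let ?box = "{c - h..c + h} \<times> {d..d + h}"
  have box: "bounded ?box" "?box \<in> sets borel"
    by (auto intro!: bounded_Times borel_closed closed_Times)
  have ind: "(\<lambda>z. indicator {c..c + 1} (fst z) :: real) \<in> borel_measurable (borel :: (real \<times> real) measure)"
    by (rule borel_measurable_fst_snd(1)) simp
  have W: "integrable lborel W"
  proof (rule integrable_lborel_bounded[where B = 1 and A = "{c..c + 1} \<times> {d..d + h}"])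
    show "W \<in> borel_measurable borel"
      unfolding W_def[abs_def] by (intro borel_measurable_times ind m)
    show "\<bar>W z\<bar> \<le> 1" for z using bv by (simp add: W_def indicator_def)
    show "W z = 0" if "z \<notin> {c..c + 1} \<times> {d..d + h}" for z
      using that v0[of "snd z"] by (cases z) (auto simp: W_def indicator_def)
  qed (auto intro!: bounded_Times borel_closed closed_Times)
  have "0 < integral\<^sup>L lborel W"
  proof (rule lborel_integral_pos[OF W, where U = "{c<..<c + 1} \<times> {d<..<d + h}"])
    show "0 \<le> W z" for z using bv by (simp add: W_def indicator_def)
    show "open ({c<..<c + 1} \<times> {d<..<d + h})" by (intro open_Times) auto
    show "{c<..<c + 1} \<times> {d<..<d + h} \<noteq> {}" using h by simp
    fix z assume z: "z \<in> {c<..<c + 1} \<times> {d<..<d + h}"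
    then have "\<bar>(snd z - (d + h / 2)) * (2 / h)\<bar> < 1" using h by (auto simp: abs_if field_simps)
    then have "0 < v (snd z)" unfolding v_def by (rule bump_pos)
    then show "0 < W z" using z by (auto simp: W_def)
  qed
  moreover have "(pl - pr) * integral\<^sup>L lborel W = 0"
  proof -
    have iT: "integrable lborel (T n)" "integral\<^sup>L lborel (T n) = 0" for n
    proof -
      have "integrable lborel (\<lambda>z. P z * (u' n (fst z) * v (snd z)))"
        by (rule integrable_mult_bounded[OF P borel_measurable_times[OF m(2,3)] abs_mult_le[OF bu(3) bv(4)]])
      moreover have "integrable lborel (\<lambda>z. Q z * (u n (fst z) * v' (snd z)))"
        by (rule integrable_mult_bounded[OF Q borel_measurable_times[OF m(1,4)] abs_mult_le[OF bu(4) bv(3)]])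
      moreover have "integrable lborel (\<lambda>z. G z * (u n (fst z) * v (snd z)))"
        by (rule integrable_mult_bounded[OF G borel_measurable_times[OF m(1,3)] abs_mult_le[OF bu(4) bv(4)]])
      ultimately show "integrable lborel (T n)"
        unfolding T_def[abs_def] by (intro Bochner_Integration.integrable_add)
      have "bounded (range (u n))" unfolding bounded_iff using bu by (intro exI[of _ 1]) auto
      moreover have "bounded (range (u' n))" unfolding bounded_iff using bu by (intro exI[of _ "l n * 4"]) auto
      moreover have "bounded (range v)" unfolding bounded_iff using bv by (intro exI[of _ 1]) auto
      moreover have "bounded (range v')" unfolding bounded_iff using bv by (intro exI[of _ "2 / h * 4"]) auto
      ultimately show "integral\<^sup>L lborel (T n) = 0"
        using product_weak_divergenceD[OF div du(1,3)[of n] dv(1,3)] by (simp add: T_def[abs_def] case_prod_beta')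
    qed
    have iJ: "integrable lborel (J n)" for n
    proof (rule integrable_lborel_bounded[OF _ _ box])
      have "(\<lambda>z. (if fst z < c then pl else pr)) \<in> borel_measurable (borel :: (real \<times> real) measure)"
        by (rule borel_measurable_fst_snd(1)) simp
      then show "J n \<in> borel_measurable borel"
        unfolding J_def[abs_def] by (intro borel_measurable_times m)
      show "\<bar>J n z\<bar> \<le> (\<bar>pl\<bar> + \<bar>pr\<bar>) * (l n * 4) * 1" for z
        unfolding J_def by (intro abs_mult_le bu bv) auto
      show "J n z = 0" if "z \<notin> ?box" for z
      proof -
        have "h \<le> \<bar>fst z - c\<bar> \<or> \<not> (d < snd z \<and> snd z < d + h)"
          using that by (cases z) (auto simp: abs_if)
        then show ?thesis using u0(2)[of n "fst z"] v0[of "snd z"] l(2)[of n] by (auto simp: J_def)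
      qed
    qed
    have JW: "integral\<^sup>L lborel (J n) = (pl - pr) * integral\<^sup>L lborel W" for n
    proof -
      have "(\<integral>z. J n z - (pl - pr) * W z \<partial>lborel) = 0"
      proof (rule lborel_integral_eq_0_fst[where c = 0])
        show "integrable lborel (\<lambda>z. J n z - (pl - pr) * W z)" using iJ W by simp
        fix y
        have "((\<lambda>x. if x \<in> {c..c + 1} then 1 else 0) has_integral (1 :: real)) UNIV"
          using has_integral_const_real[of "1 :: real" c "c + 1"]
          by (simp only: has_integral_restrict_UNIV) simp
        then have "((\<lambda>x. indicator {c..c + 1} x) has_integral (1 :: real)) UNIV"
          by (simp only: indicator_def of_bool_def)
        from has_integral_mult_right[OF this, of "pl - pr"]
        have "((\<lambda>x. (if x < c then pl else pr) * (l n * bump_deriv ((x - c) * l n))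
            - (pl - pr) * indicator {c..c + 1} x) has_integral (pl - pr) - (pl - pr) * 1) UNIV"
          by (intro has_integral_diff bump_jump_integral l)
        from has_integral_mult_left[OF this, of "v y"]
        show "((\<lambda>x. J n (x, y) - (pl - pr) * W (x, y)) has_integral 0) UNIV"
          by (simp add: J_def W_def u'_def algebra_simps)
      qed
      then show ?thesis using iJ W by simp
    qed
    have "(\<lambda>n. \<integral>z. T n z - J n z \<partial>lborel) \<longlonglongrightarrow> (\<integral>z. 0 \<partial>(lborel :: (real \<times> real) measure))"
    proof (rule integral_dominated_convergence)
      \<comment> \<open>What remains of \<open>P\<close> after removing its limit is linear in x - c
        and tames the growing derivative \<open>u'\<close>; \<open>Q\<close> and \<open>G\<close>
        meet only the bounded factors \<open>u\<close>, \<open>v\<close> and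
        \<open>v'\<close>.\<close>
      let ?w = "\<lambda>z. (\<bar>bl\<bar> + \<bar>br\<bar>) * 4 * indicator ?box z + \<bar>Q z\<bar> * (2 / h * 4) + \<bar>G z\<bar>"
      show "integrable lborel ?w"
        using Q G box by (intro Bochner_Integration.integrable_add integrable_mult_right
            integrable_mult_left integrable_abs integrable_real_indicator emeasure_bounded_finite) auto
      show "(\<lambda>z. T n z - J n z) \<in> borel_measurable lborel" for n
        using iT iJ by (intro borel_measurable_diff) auto
      \<comment> \<open>On the line x = c itself \<open>P\<close> is not prescribed and the bumps
        keep the value 1.\<close>
      have line: "AE z in (lborel :: (real \<times> real) measure). fst z \<noteq> c"
      proof -
        have "negligible {z :: real \<times> real. (1, 0) \<bullet> z = c}" by (rule negligible_hyperplane) (simp add: zero_prod_def)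
        then have "{z :: real \<times> real. fst z = c} \<in> null_sets lebesgue"
          by (simp add: negligible_iff_null_sets inner_prod_def)
        moreover have "closed {z :: real \<times> real. fst z = c}"
          by (intro closed_Collect_eq continuous_intros)
        ultimately have "{z :: real \<times> real. fst z = c} \<in> null_sets lborel"
          by (auto simp: null_sets_def)
        then show ?thesis by (rule AE_I') auto
      qed
      show "AE z in lborel. (\<lambda>n. T n z - J n z) \<longlonglongrightarrow> 0"
        using line
      proof eventually_elim
        case (elim z)
        have "\<forall>\<^sub>F n in sequentially. h / \<bar>fst z - c\<bar> \<le> real n"
          using filterlim_real_sequentially unfolding filterlim_at_top by blast
        then have "\<forall>\<^sub>F n in sequentially. T n z - J n z = 0"
        proof eventually_elim
          case (elim n)
          then have "h \<le> real (Suc n) * \<bar>fst z - c\<bar>"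
            using \<open>fst z \<noteq> c\<close> by (simp add: divide_le_eq algebra_simps)
          then have "1 / l n \<le> \<bar>fst z - c\<bar>" using h by (simp add: l_def divide_le_eq mult.commute)
          then show ?case using u0 by (simp add: T_def J_def)
        qed
        then show ?case by (rule tendsto_eventually)
      qed
      show "AE z in lborel. norm (T n z - J n z) \<le> ?w z" for n
        using line
      proof eventually_elim
        case (elim z)
        obtain x y where z: "z = (x, y)" by (cases z)
        have 1: "\<bar>P z * (u' n x * v y) - J n z\<bar> \<le> (\<bar>bl\<bar> + \<bar>br\<bar>) * 4 * indicator ?box z"
        proof (cases "1 / l n \<le> \<bar>x - c\<bar> \<or> \<not> (d < y \<and> y < d + h)")
          case True
          then have "u' n x * v y = 0" using u0 v0 by auto
          then show ?thesis by (simp add: J_def z) (auto simp: indicator_def)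
        next
          case False
          then have xy: "\<bar>x - c\<bar> < h" "d < y" "y < d + h" "x \<noteq> c" using l(2)[of n] elim z by auto
          then obtain b where b: "\<bar>b\<bar> \<le> \<bar>bl\<bar> + \<bar>br\<bar>"
            and Pz: "P z = (if x < c then pl else pr) + b * (x - c)"
            using left[of x y] right[of x y] unfolding z
            by (cases "x < c") (force simp: abs_if split: if_splits)+
          have "P z * (u' n x * v y) - J n z = b * ((x - c) * u' n x) * v y"
            unfolding Pz J_def by (simp add: z algebra_simps)
          also have "\<bar>\<dots>\<bar> \<le> (\<bar>bl\<bar> + \<bar>br\<bar>) * 4 * 1"
            by (intro abs_mult_le b bu' bv)
          also have "\<dots> = (\<bar>bl\<bar> + \<bar>br\<bar>) * 4 * indicator ?box z"
            using xy by (auto simp: z indicator_def abs_if split: if_splits)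
          finally show ?thesis .
        qed
        have 2: "\<bar>Q z * (u n x * v' y)\<bar> \<le> \<bar>Q z\<bar> * (1 * (2 / h * 4))"
          by (intro abs_mult_le bu bv order_refl)
        have 3: "\<bar>G z * (u n x * v y)\<bar> \<le> \<bar>G z\<bar> * (1 * 1)"
          by (intro abs_mult_le bu bv order_refl)
        have "T n z - J n z = (P z * (u' n x * v y) - J n z) + Q z * (u n x * v' y) + G z * (u n x * v y)"
          by (simp add: T_def z)
        also have "\<bar>\<dots>\<bar> \<le> ?w z" using 1 2 3 by linarith
        finally show ?case by simp
      qed
    qed simp
    moreover have "(\<integral>z. T n z - J n z \<partial>lborel) = - ((pl - pr) * integral\<^sup>L lborel W)" for n
      using iT iJ JW by simp
    ultimately show ?thesis using LIMSEQ_unique[OF tendsto_const] by fastforce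
  qed
  ultimately show ?thesis by simp
qed

section \<open>Recovery of a field in \<open>Y_h\<close> from its edge values\<close>

lemma elem_unique:
  assumes "0 < h" "x \<in> elem h T" "x \<in> elem h T'"
  shows "T = T'"
  using assms cell_unique[OF assms(1)]
  by (cases T; cases T'; cases x) (auto simp: elem_def)

lemma elem_in_borel: "elem h T \<in> sets borel"
proof -
  have "{a..<b} \<times> {c..<d} \<in> sets (borel :: (real \<times> real) measure)" for a b c d :: real
    unfolding borel_prod[symmetric] by (intro pair_measureI) auto
  then show ?thesis by (cases T) (simp add: elem_def)
qed

lemma piecewise_measurable_bounded:
  fixes p :: "real \<times> real \<Rightarrow> real \<times> real"
  assumes h: "0 < h" and fin: "finite \<T>"
    and q: "\<And>T. T \<in> \<T> \<Longrightarrow> continuous_on UNIV (q T)" "\<And>T x. T \<in> \<T> \<Longrightarrow> x \<in> elem h T \<Longrightarrow> p x = q T x"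
    and p0: "\<And>x. x \<notin> (\<Union>T\<in>\<T>. elem h T) \<Longrightarrow> p x = 0"
  shows "p \<in> borel_measurable borel" "bounded (range p)"
proof -
  have p_eq: "p = (\<lambda>x. \<Sum>T\<in>\<T>. indicator (elem h T) x *\<^sub>R q T x)"
  proof
    fix x
    show "p x = (\<Sum>T\<in>\<T>. indicator (elem h T) x *\<^sub>R q T x)"
    proof (cases "x \<in> (\<Union>T\<in>\<T>. elem h T)")
      case True
      then obtain T where T: "T \<in> \<T>" "x \<in> elem h T" by blast
      have "(\<Sum>T'\<in>\<T>. indicator (elem h T') x *\<^sub>R q T' x) = (\<Sum>T'\<in>\<T>. if T' = T then q T x else 0)"
      proof (rule sum.cong)
        fix T' show "indicator (elem h T') x *\<^sub>R q T' x = (if T' = T then q T x else 0)"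
        proof (cases "x \<in> elem h T'")
          case True
          then have "T' = T" using T(2) by (rule elem_unique[OF h])
          then show ?thesis using True by simp
        next
          case False
          then have "T' \<noteq> T" using T(2) by blast
          then show ?thesis using False by simp
        qed
      qed simp
      then show ?thesis using T fin q(2) by (simp add: sum.delta)
    next
      case False
      then have "(\<Sum>T\<in>\<T>. indicator (elem h T) x *\<^sub>R q T x) = 0"
        by (intro sum.neutral) (auto simp: indicator_def)
      then show ?thesis using p0[OF False] by simp
    qed
  qed
  show "p \<in> borel_measurable borel"
    unfolding p_eq
    by (intro borel_measurable_sum borel_measurable_scaleR borel_measurable_indicator elem_in_borel
        borel_measurable_continuous_onI q(1))
  show "bounded (range p)"
    unfolding p_eq
  proof (rule bounded_sum_range)
    fix T assume T: "T \<in> \<T>"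
    obtain i j where ij: "T = (i, j)" by (cases T)
    let ?K = "{real i * h..(real i + 1) * h} \<times> {real j * h..(real j + 1) * h}"
    have "elem h T \<subseteq> ?K" by (auto simp: ij elem_def)
    then have "range (\<lambda>x. indicator (elem h T) x *\<^sub>R q T x) \<subseteq> insert 0 (q T ` ?K)"
      by (force simp: indicator_def)
    moreover have "bounded (q T ` ?K)"
      using q(1)[OF T] by (intro compact_imp_bounded compact_continuous_image compact_Times)
        (auto intro: continuous_on_subset)
    ultimately show "bounded (range (\<lambda>x. indicator (elem h T) x *\<^sub>R q T x))"
      by (meson bounded_insert bounded_subset)
  qed
qed

lemma square_integrable_on_imp_integrable:
  fixes g :: "real \<times> real \<Rightarrow> real"
  assumes S: "open S" "emeasure lborel S < \<infinity>" and g: "square_integrable_on S g"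
  shows "integrable (lebesgue_on S) g"
proof (rule Bochner_Integration.integrable_bound)
  have "finite_measure (lebesgue_on S)"
    using S by (intro finite_measureI) (simp add: emeasure_restrict_space)
  then show "integrable (lebesgue_on S) (\<lambda>x. 1 + (norm (g x))\<^sup>2)"
    using g unfolding square_integrable_on_def
    by (intro Bochner_Integration.integrable_add finite_measure.integrable_const) auto
  have "\<bar>y\<bar> \<le> 1 + y\<^sup>2" for y :: real
    using sum_squares_bound[of "\<bar>y\<bar>" 1] by simp
  then show "AE x in lebesgue_on S. norm (g x) \<le> norm (1 + (norm (g x))\<^sup>2)"
    by (simp add: abs_of_nonneg)
qed (use g in \<open>simp add: square_integrable_on_def\<close>)

text \<open>The divergence provided by \<open>H0div\<close> is Lebesgue measurable and matters on
  \<open>S\<close> only; \<open>G\<close> is a Borel representative of its extension by zero. The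
  zero normal trace is invoked rather than the weak divergence, so that products need not vanish
  near the boundary of \<open>S\<close>.\<close>

lemma H0div_product_test:
  assumes S: "open S" "emeasure lborel S < \<infinity>" and p: "p \<in> H0div S"
    and pm: "p \<in> borel_measurable borel" "bounded (range p)"
  obtains G where "integrable lborel G"
    and "product_weak_divergence (\<lambda>z. indicator S z * fst (p z)) (\<lambda>z. indicator S z * snd (p z)) G"
proof -
  obtain g where g: "square_integrable_on S g" "zero_normal_trace S p g"
    using p unfolding H0div_def by blast
  have Sb: "S \<in> sets borel" using S by simp
  have "integrable (lebesgue_on S) g" by (rule square_integrable_on_imp_integrable[OF S g(1)])
  then have Sg: "integrable lebesgue (\<lambda>x. indicator S x * g x)"
    using Sb by (subst (asm) integrable_restrict_space) auto
  then obtain G where G: "G \<in> borel_measurable lborel" and "AE x in lborel. indicator S x * g x = G x"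
    using completion_ex_borel_measurable_real[OF borel_measurable_integrable[OF Sg]] by blast
  then have eq: "AE x in lebesgue. indicator S x * g x = G x" by (intro AE_completion)
  have Gl: "G \<in> borel_measurable lebesgue" using G by (rule measurable_completion)
  have "integrable lebesgue G"
    using Sg integrable_cong_AE[OF borel_measurable_integrable[OF Sg] Gl eq] by simp
  then have Gi: "integrable lborel G" using integrable_completion[OF G] by simp
  show ?thesis
  proof (rule that[OF Gi], unfold product_weak_divergence_def, intro allI impI)
    fix u u' v v' :: "real \<Rightarrow> real"
    assume u: "\<forall>x. (u has_real_derivative u' x) (at x)" "continuous_on UNIV u'"
      and v: "\<forall>y. (v has_real_derivative v' y) (at y)" "continuous_on UNIV v'"
      and bd: "bounded (range u)" "bounded (range u')" "bounded (range v)" "bounded (range v')"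
    let ?\<phi> = "\<lambda>(x, y). u x * v y" and ?D = "\<lambda>(x, y). (u' x * v y, u x * v' y)"
    note C1 = C1_with_gradient_product[OF u(1)[rule_format] u(2) v(1)[rule_format] v(2)]
    obtain Bu Bu' Bv Bv' where B: "\<And>x. \<bar>u x\<bar> \<le> Bu" "\<And>x. \<bar>u' x\<bar> \<le> Bu'" "\<And>y. \<bar>v y\<bar> \<le> Bv" "\<And>y. \<bar>v' y\<bar> \<le> Bv'"
      using bd unfolding bounded_iff by auto
    have b\<phi>: "\<bar>?\<phi> z\<bar> \<le> Bu * Bv" for z
      using abs_mult_le[OF B(1,3)] by (cases z) simp
    have bD: "norm (?D z) \<le> Bu' * Bv + Bu * Bv'" for z
    proof -
      obtain x y where z: "z = (x, y)" by (cases z)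
      have "norm (?D z) \<le> norm (u' x * v y) + norm (u x * v' y)"
        unfolding z by (simp add: norm_Pair sqrt_sum_squares_le_sum_abs)
      then show ?thesis using abs_mult_le[OF B(2,3), of x y] abs_mult_le[OF B(1,4), of x y] by simp
    qed
    have b: "bounded (?\<phi> ` S)" "bounded (?D ` S)"
    proof -
      have "norm (?\<phi> z) \<le> Bu * Bv" for z using b\<phi>[of z] by (simp only: real_norm_def)
      then show "bounded (?\<phi> ` S)" unfolding bounded_iff by blast
      show "bounded (?D ` S)" unfolding bounded_iff using bD by blast
    qed
    have \<phi>m: "?\<phi> \<in> borel_measurable borel"
      using C1_with_gradient_continuous(1)[OF C1] by (intro borel_measurable_continuous_onI)
    have G\<phi>: "integrable lborel (\<lambda>z. G z * ?\<phi> z)"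
      by (rule integrable_mult_bounded[OF Gi \<phi>m b\<phi>])
    have "(\<integral>x. g x * ?\<phi> x \<partial>lebesgue_on S) = (\<integral>x. (indicator S x * g x) * ?\<phi> x \<partial>lebesgue)"
      using Sb by (subst integral_restrict_space) (auto simp: mult.assoc)
    also have "\<dots> = (\<integral>x. G x * ?\<phi> x \<partial>lebesgue)"
    proof (rule integral_cong_AE)
      have \<phi>l: "?\<phi> \<in> borel_measurable lebesgue" using \<phi>m by (intro measurable_completion) simp
      show "(\<lambda>x. (indicator S x * g x) * ?\<phi> x) \<in> borel_measurable lebesgue"
        by (rule borel_measurable_times[OF borel_measurable_integrable[OF Sg] \<phi>l])
      show "(\<lambda>x. G x * ?\<phi> x) \<in> borel_measurable lebesgue"
        by (rule borel_measurable_times[OF Gl \<phi>l])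
      show "AE x in lebesgue. (indicator S x * g x) * ?\<phi> x = G x * ?\<phi> x"
        using eq by eventually_elim simp
    qed
    also have "\<dots> = (\<integral>x. G x * ?\<phi> x \<partial>lborel)"
      using G\<phi> by (intro integral_completion) auto
    finally have 1: "(\<integral>x. g x * ?\<phi> x \<partial>lebesgue_on S) = (\<integral>x. G x * ?\<phi> x \<partial>lborel)" .
    note 2 = inner_lebesgue_on[OF S C1_with_gradient_continuous(2)[OF C1] b(2) pm]
    have "(\<integral>x. p x \<bullet> ?D x \<partial>lebesgue_on S) + (\<integral>x. g x * ?\<phi> x \<partial>lebesgue_on S) = 0"
      using g(2) C1 b unfolding zero_normal_trace_def by blast
    then have "(\<integral>z. indicator S z * (p z \<bullet> ?D z) + G z * ?\<phi> z \<partial>lborel) = 0"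
      by (simp only: 1 2(3) Bochner_Integration.integral_add[OF 2(1) G\<phi>])
    moreover have "indicator S z * (p z \<bullet> ?D z) + G z * ?\<phi> z = (case z of (x, y) \<Rightarrow>
        indicator S (x, y) * fst (p (x, y)) * (u' x * v y)
        + indicator S (x, y) * snd (p (x, y)) * (u x * v' y) + G (x, y) * (u x * v y))" for z
      by (cases z) (simp add: inner_prod_def algebra_simps)
    ultimately show "(\<integral>(x, y). indicator S (x, y) * fst (p (x, y)) * (u' x * v y)
        + indicator S (x, y) * snd (p (x, y)) * (u x * v' y) + G (x, y) * (u x * v y) \<partial>lborel) = 0"
      by (simp only:)
  qed
qed

lemma lborel_integrable_swap:
  fixes f :: "real \<times> real \<Rightarrow> real"
  assumes "integrable lborel f"
  shows "integrable lborel (\<lambda>(x, y). f (y, x))"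
proof -
  have f: "integrable (lborel \<Otimes>\<^sub>M lborel) f" using assms by (simp add: lborel_prod)
  show ?thesis using lborel_pair.integrable_product_swap[OF f] by (simp add: lborel_prod)
qed

text \<open>Exchanging the coordinates lets \<open>no_jump\<close>, formulated for vertical lines,
  serve the horizontal ones.\<close>

lemma product_weak_divergence_swap:
  assumes div: "product_weak_divergence P Q G"
    and i: "integrable lborel P" "integrable lborel Q" "integrable lborel G"
  shows "product_weak_divergence (\<lambda>(x, y). Q (y, x)) (\<lambda>(x, y). P (y, x)) (\<lambda>(x, y). G (y, x))"
  unfolding product_weak_divergence_def
proof (intro allI impI)
  fix u u' v v' :: "real \<Rightarrow> real"
  assume u: "\<forall>x. (u has_real_derivative u' x) (at x)" "continuous_on UNIV u'"
    and v: "\<forall>y. (v has_real_derivative v' y) (at y)" "continuous_on UNIV v'"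
    and b: "bounded (range u)" "bounded (range u')" "bounded (range v)" "bounded (range v')"
  let ?f = "\<lambda>(x, y). P (x, y) * (v' x * u y) + Q (x, y) * (v x * u' y) + G (x, y) * (v x * u y)"
  have "integral\<^sup>L lborel ?f = 0"
    by (rule product_weak_divergenceD[OF div v(1)[rule_format] v(2) u(1)[rule_format] u(2) b(3,4,1,2)])
  moreover have "?f \<in> borel_measurable (lborel \<Otimes>\<^sub>M lborel)"
  proof -
    have k: "k \<in> borel_measurable borel" if "continuous_on UNIV k" for k :: "real \<Rightarrow> real"
      using that by (rule borel_measurable_continuous_onI)
    have "continuous_on UNIV u" "continuous_on UNIV v"
      by (intro continuous_at_imp_continuous_on ballI DERIV_isCont[OF u(1)[rule_format]]
          DERIV_isCont[OF v(1)[rule_format]])+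
    note k = this[THEN k] u(2)[THEN k] v(2)[THEN k]
    note k1 = k[THEN borel_measurable_fst_snd(1)] and k2 = k[THEN borel_measurable_fst_snd(2)]
    have "P \<in> borel_measurable borel" "Q \<in> borel_measurable borel" "G \<in> borel_measurable borel"
      using i by auto
    then have "?f \<in> borel_measurable borel"
      unfolding case_prod_beta' prod.collapse
      by (intro borel_measurable_add borel_measurable_times k1 k2)
    then show ?thesis by (simp add: lborel_prod)
  qed
  from lborel_pair.integral_product_swap[OF this]
  have "(\<integral>(x, y). ?f (y, x) \<partial>lborel) = integral\<^sup>L lborel ?f" by (simp add: lborel_prod)
  ultimately show "(\<integral>(x, y). (case (x, y) of (x, y) \<Rightarrow> Q (y, x)) * (u' x * v y)
      + (case (x, y) of (x, y) \<Rightarrow> P (y, x)) * (u x * v' y)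
      + (case (x, y) of (x, y) \<Rightarrow> G (y, x)) * (u x * v y) \<partial>lborel) = 0"
    by (simp add: mult_ac add_ac)
qed

text \<open>On each element four numbers determine the field, and they are the normal components on
  its four sides. Two neighbors see the same number on a common side by \<open>no_jump\<close>, and
  on the boundary of \<Omega> it is zero.\<close>

lemma Y_h_eq_RT_field:
  assumes h: "0 < h" and p: "p \<in> Y_h m1 m2 h"
  shows "p = RT_field m1 m2 h (edge_value h p)"
proof -
  let ?\<Omega> = "Omega m1 m2 h"
  have H: "p \<in> H0div ?\<Omega>" and p0: "\<And>x. x \<notin> (\<Union>T\<in>elements m1 m2. elem h T) \<Longrightarrow> p x = 0"
    using p unfolding Y_h_def RT_space_def by blast+
  have "\<forall>T\<in>elements m1 m2. \<exists>c. \<forall>x\<in>elem h T.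
      p x = (fst (fst c) + snd (fst c) * fst x, fst (snd c) + snd (snd c) * snd x)"
  proof
    fix T assume "T \<in> elements m1 m2"
    then obtain a1 b1 a2 b2 where "\<forall>(x1, x2)\<in>elem h T. p (x1, x2) = (a1 + b1 * x1, a2 + b2 * x2)"
      using p unfolding Y_h_def RT_space_def by blast
    then show "\<exists>c. \<forall>x\<in>elem h T. p x = (fst (fst c) + snd (fst c) * fst x, fst (snd c) + snd (snd c) * snd x)"
      by (intro exI[of _ "((a1, b1), (a2, b2))"]) auto
  qed
  from bchoice[OF this] obtain c where c: "\<And>T x. T \<in> elements m1 m2 \<Longrightarrow> x \<in> elem h T \<Longrightarrow>
      p x = (fst (fst (c T)) + snd (fst (c T)) * fst x, fst (snd (c T)) + snd (snd (c T)) * snd x)"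
    by blast
  define A1 B1 A2 B2 where coef: "A1 i j = fst (fst (c (i, j)))" "B1 i j = snd (fst (c (i, j)))"
    "A2 i j = fst (snd (c (i, j)))" "B2 i j = snd (snd (c (i, j)))" for i j
  have p_elem: "p (x, y) = (A1 i j + B1 i j * x, A2 i j + B2 i j * y)"
    if "i < m1" "j < m2" "(x, y) \<in> elem h (i, j)" for i j x y
    using c[of "(i, j)" "(x, y)"] that by (simp add: coef elements_def)
  have pm: "p \<in> borel_measurable borel" "bounded (range p)"
  proof -
    let ?q = "\<lambda>T x. (fst (fst (c T)) + snd (fst (c T)) * fst x, fst (snd (c T)) + snd (snd (c T)) * snd x)"
    have fin: "finite (elements m1 m2)" by (simp add: elements_def)
    have cont: "continuous_on UNIV (?q T)" for T by (intro continuous_intros)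
    show "p \<in> borel_measurable borel" "bounded (range p)"
      using piecewise_measurable_bounded[where q = ?q, OF h fin cont c p0] by simp_all
  qed
  define P1 P2 where P: "P1 = (\<lambda>z. indicator ?\<Omega> z * fst (p z))" "P2 = (\<lambda>z. indicator ?\<Omega> z * snd (p z))"
  obtain G where G: "integrable lborel G" and div: "product_weak_divergence P1 P2 G"
    unfolding P using H0div_product_test[OF open_Omega emeasure_Omega H pm] by blast
  have P1: "integrable lborel P1" and P2: "integrable lborel P2"
  proof -
    have "integrable lborel (\<lambda>x. indicator ?\<Omega> x * (p x \<bullet> e))" for e
      by (rule inner_lebesgue_on(1)[OF open_Omega emeasure_Omega _ _ pm])
        (auto simp: bounded_iff intro!: continuous_intros)
    from this[of "(1, 0)"] this[of "(0, 1)"] show "integrable lborel P1" "integrable lborel P2"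
      by (simp_all add: P inner_prod_def)
  qed
  have off: "P1 (x, y) = 0 \<and> P2 (x, y) = 0"
    if "x \<le> 0 \<or> real m1 * h \<le> x \<or> y \<le> 0 \<or> real m2 * h \<le> y" for x y
    using that by (auto simp: P Omega_def)
  have on: "P1 (x, y) = A1 i j + B1 i j * x \<and> P2 (x, y) = A2 i j + B2 i j * y"
    if "i < m1" "j < m2" "real i * h < x" "x < (real i + 1) * h" "real j * h < y" "y < (real j + 1) * h"
    for i j x y
  proof -
    have "(x, y) \<in> ?\<Omega>" using cell_subset_Omega[OF h that(1,2)] that by auto
    moreover have "(x, y) \<in> elem h (i, j)" using that by (simp add: elem_def)
    ultimately show ?thesis using p_elem[OF that(1,2)] by (simp add: P)
  qed
  \<comment> \<open>the one-sided normal components on the vertical line \<open>x = i h\<close> and the horizontal line \<open>y = j h\<close>\<close>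
  define V_right V_left where "V_right i j = (if i < m1 then A1 i j + B1 i j * (real i * h) else 0)"
    and "V_left i j = (if 1 \<le> i then A1 (i - 1) j + B1 (i - 1) j * (real i * h) else 0)" for i j
  define H_up H_down where "H_up i j = (if j < m2 then A2 i j + B2 i j * (real j * h) else 0)"
    and "H_down i j = (if 1 \<le> j then A2 i (j - 1) + B2 i (j - 1) * (real j * h) else 0)" for i j
  \<comment> \<open>The values i = 0 and i = m1 are included: there one side lies outside \<Omega>,
    where the field is extended by zero, so that the equation is the boundary condition.\<close>
  have V: "V_left i j = V_right i j" if i: "i \<le> m1" and j: "j < m2" for i j
  proof (rule no_jump[OF h P1 P2 G, of "real i * h" "real j * h" _ "if i < m1 then B1 i j else 0"
        _ "if 1 \<le> i then B1 (i - 1) j else 0"])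
    fix x y assume y: "real j * h < y" "y < real j * h + h"
    then have y': "y < (real j + 1) * h" by (simp add: algebra_simps)
    {
      assume x: "real i * h < x" "x < real i * h + h"
      show "P1 (x, y) = V_right i j + (if i < m1 then B1 i j else 0) * (x - real i * h)"
      proof (cases "i < m1")
        case True
        then show ?thesis using on[OF True j, of x y] x y y' by (simp add: V_right_def algebra_simps)
      next
        case False
        then show ?thesis using off[of x y] x i by (simp add: V_right_def)
      qed
    next
      assume x: "real i * h - h < x" "x < real i * h"
      show "P1 (x, y) = V_left i j + (if 1 \<le> i then B1 (i - 1) j else 0) * (x - real i * h)"
      proof (cases "1 \<le> i")
        case True
        then have "i - 1 < m1" "real (i - 1) = real i - 1" using i by auto
        then show ?thesis using on[of "i - 1" j x y] x y y' True j
          by (simp add: V_left_def algebra_simps)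
      next
        case False
        then have "i = 0" by simp
        then show ?thesis using off[of x y] x by (simp add: V_left_def)
      qed
    }
  qed (rule div)
  have H: "H_down i j = H_up i j" if i: "i < m1" and j: "j \<le> m2" for i j
  proof (rule no_jump[OF h lborel_integrable_swap[OF P2] lborel_integrable_swap[OF P1]
        lborel_integrable_swap[OF G], of "real j * h" "real i * h" _ "if j < m2 then B2 i j else 0"
        _ "if 1 \<le> j then B2 i (j - 1) else 0"])
    fix y x assume x: "real i * h < x" "x < real i * h + h"
    then have x': "x < (real i + 1) * h" by (simp add: algebra_simps)
    {
      assume y: "real j * h < y" "y < real j * h + h"
      show "(case (y, x) of (x, y) \<Rightarrow> P2 (y, x))
          = H_up i j + (if j < m2 then B2 i j else 0) * (y - real j * h)"
      proof (cases "j < m2")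
        case True
        then show ?thesis using on[OF i True, of x y] x x' y by (simp add: H_up_def algebra_simps)
      next
        case False
        then show ?thesis using off[of x y] y j by (simp add: H_up_def)
      qed
    next
      assume y: "real j * h - h < y" "y < real j * h"
      show "(case (y, x) of (x, y) \<Rightarrow> P2 (y, x))
          = H_down i j + (if 1 \<le> j then B2 i (j - 1) else 0) * (y - real j * h)"
      proof (cases "1 \<le> j")
        case True
        then have "j - 1 < m2" "real (j - 1) = real j - 1" using j by auto
        then show ?thesis using on[of i "j - 1" x y] x x' y True i
          by (simp add: H_down_def algebra_simps)
      next
        case False
        then have "j = 0" by simp
        then show ?thesis using off[of x y] y by (simp add: H_down_def)
      qed
    }
  qed (rule product_weak_divergence_swap[OF div P1 P2 G])
  let ?z = "zero_boundary m1 m2 (edge_value h p)"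
  have zV: "?z (VEdge i j) = V_right i j" if "i \<le> m1" "j < m2" for i j
  proof (cases "1 \<le> i \<and> i < m1")
    case True
    have "edge_value h p (VEdge i j) = V_right i j"
    proof (rule edge_value_VEdge[OF h])
      fix y assume "real j * h \<le> y" "y < (real j + 1) * h"
      then have "(real i * h, y) \<in> elem h (i, j)" using h by (simp add: elem_def)
      then show "fst (p (real i * h, y)) = V_right i j"
        using p_elem[of i j] True that by (simp add: V_right_def)
    qed
    then show ?thesis using True that by (simp add: zero_boundary_def)
  next
    case False
    then show ?thesis using V[OF that] that by (auto simp: zero_boundary_def V_left_def V_right_def)
  qed
  have zH: "?z (HEdge i j) = H_up i j" if "i < m1" "j \<le> m2" for i j
  proof (cases "1 \<le> j \<and> j < m2")
    case True
    have "edge_value h p (HEdge i j) = H_up i j"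
    proof (rule edge_value_HEdge[OF h])
      fix x assume "real i * h \<le> x" "x < (real i + 1) * h"
      then have "(x, real j * h) \<in> elem h (i, j)" using h by (simp add: elem_def)
      then show "snd (p (x, real j * h)) = H_up i j"
        using p_elem[of i j] True that by (simp add: H_up_def)
    qed
    then show ?thesis using True that by (simp add: zero_boundary_def)
  next
    case False
    then show ?thesis using H[OF that] that by (auto simp: zero_boundary_def H_down_def H_up_def)
  qed
  show ?thesis
  proof
    fix x
    show "p x = RT_field m1 m2 h (edge_value h p) x"
    proof (cases "x \<in> (\<Union>T\<in>elements m1 m2. elem h T)")
      case True
      then obtain i j where ij: "i < m1" "j < m2" "x \<in> elem h (i, j)" by (auto simp: elements_def)
      obtain x1 x2 where x: "x = (x1, x2)" by (cases x)
      \<comment> \<open>The right and upper sides of a half-open element belong to its neighbor or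
        to no element at all; the equations \<open>V\<close> and \<open>H\<close> carry the values
        over to this element.\<close>
      have "V_right (Suc i) j = A1 i j + B1 i j * (real i * h + h)"
        using V[of "Suc i" j] ij by (simp add: V_left_def algebra_simps)
      moreover have "H_up i (Suc j) = A2 i j + B2 i j * (real j * h + h)"
        using H[of i "Suc j"] ij by (simp add: H_down_def algebra_simps)
      ultimately show ?thesis
        using ij h p_elem[of i j x1 x2] unfolding x
        by (simp add: RT_field_on_elem[OF h] zV zH V_right_def H_up_def field_simps)
    next
      case False
      have "RT_field m1 m2 h (edge_value h p) \<in> Y_h m1 m2 h" by (rule RT_field_in_Y_h[OF h])
      then have "RT_field m1 m2 h (edge_value h p) x = 0"
        using False unfolding Y_h_def RT_space_def by blast
      then show ?thesis using p0[OF False] by simp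
    qed
  qed
qed

section \<open>Partition of unity\<close>

text \<open>The distance from x to the interval [s H, (s + 1) H].\<close>

definition gap :: "real \<Rightarrow> nat \<Rightarrow> real \<Rightarrow> real" where
  "gap H s x = max 0 (max (real s * H - x) (x - (real s + 1) * H))"

text \<open>A cut-off that is one on the closed subdomain and decays linearly in the maximum-norm
  distance, the distance that fits square enlargements by \<delta>.\<close>

definition weight :: "real \<Rightarrow> real \<Rightarrow> nat \<times> nat \<Rightarrow> real \<times> real \<Rightarrow> real" where
  "weight H \<delta> s z = max 0 (1 - max (gap H (fst s) (fst z)) (gap H (snd s) (snd z)) / \<delta>)"

text \<open>A maximum inherits the Lipschitz constant of the weights however many subdomains enter.
  The inserted 0 gives the empty maximum at k = 0 a value.\<close>

definition cover :: "real \<Rightarrow> real \<Rightarrow> (nat \<times> nat) set \<Rightarrow> (nat \<times> nat \<Rightarrow> nat) \<Rightarrow> nat \<Rightarrow> real \<times> real \<Rightarrow> real" where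
  "cover H \<delta> A col k z = Max (insert 0 ((\<lambda>s. weight H \<delta> s z) ` {s \<in> A. col s \<le> k}))"

text \<open>
  The successive differences of the increasing family \<open>cover\<close> form a partition of unity by
  telescoping.
\<close>

definition hat :: "real \<Rightarrow> real \<Rightarrow> (nat \<times> nat) set \<Rightarrow> (nat \<times> nat \<Rightarrow> nat) \<Rightarrow> nat \<Rightarrow> real \<times> real \<Rightarrow> real" where
  "hat H \<delta> A col k z = cover H \<delta> A col k z - cover H \<delta> A col (k - 1) z"

fun midpoint_edge :: "real \<Rightarrow> edge \<Rightarrow> real \<times> real" where
  "midpoint_edge h (VEdge i j) = (real i * h, (real j + 1 / 2) * h)"
| "midpoint_edge h (HEdge i j) = ((real i + 1 / 2) * h, real j * h)"

definition center :: "real \<Rightarrow> nat \<times> nat \<Rightarrow> real \<times> real" where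
  "center h T = ((real (fst T) + 1 / 2) * h, (real (snd T) + 1 / 2) * h)"

lemma gap_Lipschitz: "\<bar>gap H s x - gap H s y\<bar> \<le> \<bar>x - y\<bar>"
  by (auto simp: gap_def max_def)

lemma weight_Lipschitz:
  assumes \<delta>: "0 < \<delta>" and r: "\<bar>fst z - fst w\<bar> \<le> r" "\<bar>snd z - snd w\<bar> \<le> r"
  shows "\<bar>weight H \<delta> s z - weight H \<delta> s w\<bar> \<le> r / \<delta>"
proof -
  let ?g = "\<lambda>z. max (gap H (fst s) (fst z)) (gap H (snd s) (snd z))"
  have "\<bar>?g z - ?g w\<bar> \<le> r"
    using gap_Lipschitz[of H "fst s" "fst z" "fst w"] gap_Lipschitz[of H "snd s" "snd z" "snd w"] r
    by (auto simp: max_def)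
  then have "\<bar>?g z / \<delta> - ?g w / \<delta>\<bar> \<le> r / \<delta>"
    using \<delta> by (simp add: divide_right_mono flip: diff_divide_distrib)
  moreover have "\<bar>max 0 (1 - a) - max 0 (1 - b)\<bar> \<le> \<bar>a - b\<bar>" for a b :: real
    by (auto simp: max_def)
  ultimately show ?thesis unfolding weight_def by (rule order_trans[rotated])
qed

lemma Max_image_le_add:
  fixes f g :: "'a \<Rightarrow> real"
  assumes "finite A" "0 \<le> r" "\<And>s. s \<in> A \<Longrightarrow> f s \<le> g s + r"
  shows "Max (insert 0 (f ` A)) \<le> Max (insert 0 (g ` A)) + r"
proof (rule Max.boundedI)
  fix y assume "y \<in> insert 0 (f ` A)"
  then consider "y = 0" | s where "s \<in> A" "y = f s" by auto
  then show "y \<le> Max (insert 0 (g ` A)) + r"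
  proof cases
    case 1
    have "0 \<le> Max (insert 0 (g ` A))" using assms(1) by (intro Max_ge) auto
    then show ?thesis using 1 assms(2) by simp
  next
    case 2
    then have "g s \<le> Max (insert 0 (g ` A))" using assms(1) by (intro Max_ge) auto
    then show ?thesis using 2 assms(3)[of s] by simp
  qed
qed (use assms(1) in auto)

context
  fixes H \<delta> :: real and A :: "(nat \<times> nat) set" and col :: "nat \<times> nat \<Rightarrow> nat"
  assumes \<delta>: "0 < \<delta>" and A: "finite A"
begin

lemma weight_bounds: "0 \<le> weight H \<delta> s z" "weight H \<delta> s z \<le> 1"
  using \<delta> by (auto simp: weight_def gap_def max_def)

lemma cover_ge_weight: "s \<in> A \<Longrightarrow> col s \<le> k \<Longrightarrow> weight H \<delta> s z \<le> cover H \<delta> A col k z"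
  unfolding cover_def using A by (intro Max_ge) auto

lemma cover_bounds: "0 \<le> cover H \<delta> A col k z" "cover H \<delta> A col k z \<le> 1"
proof -
  show "0 \<le> cover H \<delta> A col k z" unfolding cover_def using A by (intro Max_ge) auto
  show "cover H \<delta> A col k z \<le> 1" unfolding cover_def using A by (intro Max.boundedI) (auto simp: weight_bounds)
qed

lemma cover_mono: "k \<le> l \<Longrightarrow> cover H \<delta> A col k z \<le> cover H \<delta> A col l z"
  unfolding cover_def using A by (intro Max_mono) auto

lemma cover_Lipschitz:
  assumes "\<bar>fst z - fst w\<bar> \<le> r" "\<bar>snd z - snd w\<bar> \<le> r"
  shows "\<bar>cover H \<delta> A col k z - cover H \<delta> A col k w\<bar> \<le> r / \<delta>"
proof -
  have r: "0 \<le> r / \<delta>" using assms \<delta> by (auto intro!: divide_nonneg_pos)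
  have w: "weight H \<delta> s z \<le> weight H \<delta> s w + r / \<delta>" "weight H \<delta> s w \<le> weight H \<delta> s z + r / \<delta>" for s
    using weight_Lipschitz[OF \<delta> assms, of H s] by auto
  have "cover H \<delta> A col k z \<le> cover H \<delta> A col k w + r / \<delta>"
    unfolding cover_def by (rule Max_image_le_add[OF _ r w(1)]) (use A in simp)
  moreover have "cover H \<delta> A col k w \<le> cover H \<delta> A col k z + r / \<delta>"
    unfolding cover_def by (rule Max_image_le_add[OF _ r w(2)]) (use A in simp)
  ultimately show ?thesis by linarith
qed

lemma hat_bounds: "0 \<le> hat H \<delta> A col k z" "hat H \<delta> A col k z \<le> 1"
proof -
  show "0 \<le> hat H \<delta> A col k z" unfolding hat_def using cover_mono[of "k - 1" k z] by simp
  show "hat H \<delta> A col k z \<le> 1"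
    unfolding hat_def using cover_bounds(2)[of k z] cover_bounds(1)[of "k - 1" z] by linarith
qed

lemma hat_Lipschitz:
  assumes "\<bar>fst z - fst w\<bar> \<le> r" "\<bar>snd z - snd w\<bar> \<le> r"
  shows "\<bar>hat H \<delta> A col k z - hat H \<delta> A col k w\<bar> \<le> 2 * r / \<delta>"
proof -
  have "2 * r / \<delta> = r / \<delta> + r / \<delta>" by simp
  then show ?thesis
    using cover_Lipschitz[OF assms, of k] cover_Lipschitz[OF assms, of "k - 1"]
    unfolding hat_def by linarith
qed

lemma sum_hat:
  assumes "\<And>s. s \<in> A \<Longrightarrow> 1 \<le> col s" "s \<in> A" "col s \<le> N" "weight H \<delta> s z = 1"
  shows "(\<Sum>k = 1..N. hat H \<delta> A col k z) = 1"
proof -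
  have "(\<Sum>k = 1..N. hat H \<delta> A col k z) = cover H \<delta> A col N z - cover H \<delta> A col 0 z"
    unfolding hat_def using sum_telescope''[of 0 N "\<lambda>k. cover H \<delta> A col k z"] by simp
  moreover have "{s \<in> A. col s \<le> 0} = {}" using assms(1) by force
  then have "cover H \<delta> A col 0 z = 0" unfolding cover_def by (simp only: image_empty Max_singleton)
  moreover have "cover H \<delta> A col N z = 1"
    using cover_ge_weight[OF assms(2,3), of z] cover_bounds(2)[of N z] assms(4) by simp
  ultimately show ?thesis by simp
qed

text \<open>The maximum over colors up to k exceeds the one up to k - 1 only where a subdomain of
  color exactly k attains it.\<close>

lemma hat_nonzero:
  assumes "hat H \<delta> A col k z \<noteq> 0"
  obtains s where "s \<in> A" "col s = k" "0 < weight H \<delta> s z"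
proof -
  have lt: "cover H \<delta> A col (k - 1) z < cover H \<delta> A col k z"
    using assms hat_bounds(1)[of k z] unfolding hat_def by linarith
  have "cover H \<delta> A col k z \<in> insert 0 ((\<lambda>s. weight H \<delta> s z) ` {s \<in> A. col s \<le> k})"
    unfolding cover_def using A by (intro Max_in) auto
  moreover have pos: "0 < cover H \<delta> A col k z" using lt cover_bounds(1)[of "k - 1" z] by linarith
  ultimately obtain s where s: "s \<in> A" "col s \<le> k" "cover H \<delta> A col k z = weight H \<delta> s z" by auto
  have "\<not> col s \<le> k - 1" using cover_ge_weight[OF s(1), of "k - 1" z] lt s(3) by linarith
  then have "col s = k" using s(2) by linarith
  then show ?thesis using that[of s] s pos by simp
qed

end

section \<open>Edges and elements inside the colored regions\<close>

lemma weight_posD: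
  assumes "0 < \<delta>" "0 < weight H \<delta> s z"
  shows "real (fst s) * H - \<delta> < fst z" "fst z < (real (fst s) + 1) * H + \<delta>"
    and "real (snd s) * H - \<delta> < snd z" "snd z < (real (snd s) + 1) * H + \<delta>"
proof -
  have "max (gap H (fst s) (fst z)) (gap H (snd s) (snd z)) / \<delta> < 1"
    using assms(2) by (simp add: weight_def less_max_iff_disj)
  then have "max (gap H (fst s) (fst z)) (gap H (snd s) (snd z)) < \<delta>"
    using assms(1) by (simp add: divide_less_eq)
  then show "real (fst s) * H - \<delta> < fst z" "fst z < (real (fst s) + 1) * H + \<delta>"
    "real (snd s) * H - \<delta> < snd z" "snd z < (real (snd s) + 1) * H + \<delta>"
    unfolding gap_def by (auto simp: algebra_simps)
qed

lemma weight_eq_1: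
  assumes "real (fst s) * H \<le> fst z" "fst z \<le> (real (fst s) + 1) * H"
    and "real (snd s) * H \<le> snd z" "snd z \<le> (real (snd s) + 1) * H"
  shows "weight H \<delta> s z = 1"
  using assms by (simp add: weight_def gap_def)

lemma open_enlarged_subdomain: "open (enlarged_subdomain m1 m2 h H \<delta> s)"
  by (cases s) (auto simp: enlarged_subdomain_def open_Omega intro!: open_Int open_Times)

lemma colored_region_open_finite:
  shows "open (colored_region m1 m2 h n1 n2 H \<delta> col k)"
    and "emeasure lborel (colored_region m1 m2 h n1 n2 H \<delta> col k) < \<infinity>"
proof -
  show "open (colored_region m1 m2 h n1 n2 H \<delta> col k)"
    unfolding colored_region_def by (intro open_UN ballI open_enlarged_subdomain)
  have "colored_region m1 m2 h n1 n2 H \<delta> col k \<subseteq> Omega m1 m2 h"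
    unfolding colored_region_def enlarged_subdomain_def by auto
  then have "emeasure lborel (colored_region m1 m2 h n1 n2 H \<delta> col k) \<le> emeasure lborel (Omega m1 m2 h)"
    by (rule emeasure_mono) (simp add: open_Omega borel_open)
  then show "emeasure lborel (colored_region m1 m2 h n1 n2 H \<delta> col k) < \<infinity>"
    using emeasure_Omega le_less_trans by blast
qed

text \<open>
  Since \<open>H\<close> and \<open>\<delta>\<close> are multiples of \<open>h\<close>, the midpoint of an edge can only lie inside an enlarged
  subdomain together with both elements adjacent to the edge.
\<close>

lemma patch_subset_enlarged_subdomain:
  fixes M d :: nat
  assumes h: "0 < h" and H: "H = real M * h" and \<delta>: "\<delta> = real d * h" "0 < d"
    and e: "e \<in> interior_edges m1 m2" and w: "0 < weight H \<delta> s (midpoint_edge h e)"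
  shows "patch h e \<subseteq> enlarged_subdomain m1 m2 h H \<delta> s"
proof -
  have "0 < \<delta>" using h \<delta> by simp
  note w = weight_posD[OF this w]
  obtain s1 s2 where s: "s = (s1, s2)" by (cases s)
  \<comment> \<open>Normal direction: the midpoint has a coordinate that is a multiple of h, so a
    strict inequality between grid points leaves room for a full mesh width.\<close>
  have int: "real a * h - \<delta> \<le> real k * h - h" "real k * h + h \<le> real b * h + \<delta>"
    if "real a * h - \<delta> < real k * h" "real k * h < real b * h + \<delta>" for a b k
  proof -
    have "real a * h < real (k + d) * h" "real k * h < real (b + d) * h"
      using that by (simp_all add: \<delta> algebra_simps)
    then have "a < k + d" "k < b + d" using h by (auto simp only: mult_less_cancel_right of_nat_less_iff dest: less_asym)
    then have "real (a + 1) * h \<le> real (k + d) * h" "real (k + 1) * h \<le> real (b + d) * h"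
      using h by (intro mult_right_mono; simp)+
    then show "real a * h - \<delta> \<le> real k * h - h" "real k * h + h \<le> real b * h + \<delta>"
      by (simp_all add: \<delta> algebra_simps)
  qed
  \<comment> \<open>Tangential direction: the coordinate is an odd multiple of h / 2. Doubling gives
    natural numbers, and parity yields the missing half mesh width.\<close>
  have half: "real a * h - \<delta> \<le> real k * h" "(real k + 1) * h \<le> real b * h + \<delta>"
    if "real a * h - \<delta> < (real k + 1 / 2) * h" "(real k + 1 / 2) * h < real b * h + \<delta>" for a b k
  proof -
    have "real (2 * a) * h < real (2 * (k + d) + 1) * h" "real (2 * k + 1) * h < real (2 * (b + d)) * h"
      using that by (simp_all add: \<delta> algebra_simps)
    then have "2 * a < 2 * (k + d) + 1" "2 * k + 1 < 2 * (b + d)"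
      using h by (auto simp only: mult_less_cancel_right of_nat_less_iff dest: less_asym)
    then have "a \<le> k + d" "k + 1 \<le> b + d" by auto
    then have "real a * h \<le> real (k + d) * h" "real (k + 1) * h \<le> real (b + d) * h"
      using h by (intro mult_right_mono; simp only: of_nat_le_iff)+
    then show "real a * h - \<delta> \<le> real k * h" "(real k + 1) * h \<le> real b * h + \<delta>"
      by (simp_all add: \<delta> algebra_simps)
  qed
  have S: "real r * H = real (r * M) * h" "(real r + 1) * H = real ((r + 1) * M) * h" for r
    by (simp_all add: H algebra_simps)
  have "patch h e \<subseteq> {real s1 * H - \<delta><..<(real s1 + 1) * H + \<delta>} \<times> {real s2 * H - \<delta><..<(real s2 + 1) * H + \<delta>}"
  proof (cases e)
    case (VEdge i j)
    note b = int[OF w(1,2)[unfolded s VEdge midpoint_edge.simps fst_conv snd_conv S]]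
      half[OF w(3,4)[unfolded s VEdge midpoint_edge.simps fst_conv snd_conv S]]
    show ?thesis
    proof
      fix x assume "x \<in> patch h e"
      note x = this[unfolded VEdge patch.simps mem_Times_iff greaterThanLessThan_iff]
      show "x \<in> {real s1 * H - \<delta><..<(real s1 + 1) * H + \<delta>} \<times> {real s2 * H - \<delta><..<(real s2 + 1) * H + \<delta>}"
        unfolding S mem_Times_iff greaterThanLessThan_iff using x b by linarith
    qed
  next
    case (HEdge i j)
    note b = half[OF w(1,2)[unfolded s HEdge midpoint_edge.simps fst_conv snd_conv S]]
      int[OF w(3,4)[unfolded s HEdge midpoint_edge.simps fst_conv snd_conv S]]
    show ?thesis
    proof
      fix x assume "x \<in> patch h e"
      note x = this[unfolded HEdge patch.simps mem_Times_iff greaterThanLessThan_iff]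
      show "x \<in> {real s1 * H - \<delta><..<(real s1 + 1) * H + \<delta>} \<times> {real s2 * H - \<delta><..<(real s2 + 1) * H + \<delta>}"
        unfolding S mem_Times_iff greaterThanLessThan_iff using x b by linarith
    qed
  qed
  then show ?thesis
    using patch_subset_Omega[OF h e] by (simp add: enlarged_subdomain_def s)
qed

lemma interior_elem:
  "interior (elem h (i, j)) = {real i * h<..<(real i + 1) * h} \<times> {real j * h<..<(real j + 1) * h}"
  by (simp add: elem_def interior_Times)

lemma interior_elem_subset_patch:
  assumes h: "0 < h" and e: "e \<in> interior_edges m1 m2" and T: "T \<in> edge_elems e"
  shows "interior (elem h T) \<subseteq> patch h e"
proof -
  have pred: "real (i - 1) * h = real i * h - h" if "1 \<le> i" for i
    using that by (simp add: of_nat_diff algebra_simps)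
  show ?thesis
    using e T h by (cases e; cases T) (auto simp: interior_elem pred algebra_simps)
qed

lemma RT_field_in_W_k:
  assumes h: "0 < h" and a: "\<And>e. e \<in> interior_edges m1 m2 \<Longrightarrow> a e \<noteq> 0 \<Longrightarrow>
      patch h e \<subseteq> colored_region m1 m2 h n1 n2 H \<delta> col k"
  shows "RT_field m1 m2 h a \<in> W_k m1 m2 h n1 n2 H \<delta> col k"
  unfolding W_k_def
proof (rule RT_field_in_RT_space[OF h colored_region_open_finite])
  fix e assume e: "e \<in> interior_edges m1 m2" "a e \<noteq> 0"
  let ?S = "colored_region m1 m2 h n1 n2 H \<delta> col k"
  have "edge_elems e \<subseteq> elements_in m1 m2 h ?S"
    using interior_elem_subset_patch[OF h e(1)] a[OF e] edge_elems_interior[OF h e(1)]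
    unfolding elements_in_def by blast
  then show "patch h e \<subseteq> ?S \<and> edge_elems e \<subseteq> elements_in m1 m2 h ?S" using a[OF e] by blast
qed

text \<open>The chosen representatives already vanish off the elements of the region.\<close>

lemma extend_by_zero_W_k:
  "r \<in> W_k m1 m2 h n1 n2 H \<delta> col k \<Longrightarrow> extend_by_zero m1 m2 h n1 n2 H \<delta> col k r = r"
  unfolding W_k_def RT_space_def extend_by_zero_def by fastforce

section \<open>Convergence\<close>

lemma RT_field_add_mult:
  "RT_field m1 m2 h (\<lambda>e. a e + t * b e) x = RT_field m1 m2 h a x + t *\<^sub>R RT_field m1 m2 h b x"
  by (simp add: RT_field_def scaleR_left_distrib sum.distrib scaleR_sum_right)

lemma RT_field_sum:
  "RT_field m1 m2 h (\<lambda>e. \<Sum>k\<in>I. c k * a k e) x = (\<Sum>k\<in>I. c k *\<^sub>R RT_field m1 m2 h (a k) x)"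
  unfolding RT_field_def scaleR_sum_left scaleR_sum_right
  by (subst sum.swap) simp

lemma RT_div_add_mult:
  "RT_div m1 m2 h (\<lambda>e. a e + t * b e) x = RT_div m1 m2 h a x + t * RT_div m1 m2 h b x"
  by (simp add: RT_div_def distrib_right sum.distrib sum_distrib_left mult.assoc)

lemma RT_div_sum:
  "RT_div m1 m2 h (\<lambda>e. \<Sum>k\<in>I. c k * a k e) x = (\<Sum>k\<in>I. c k * RT_div m1 m2 h (a k) x)"
  unfolding RT_div_def sum_distrib_left sum_distrib_right
  by (subst sum.swap) (simp add: mult.assoc)

text \<open>From here on feasibility is a box constraint on coefficients, without reference to
  H(div).\<close>

lemma C_h_iff:
  assumes h: "0 < h"
  shows "p \<in> C_h m1 m2 h \<longleftrightarrow>
    (\<exists>a. p = RT_field m1 m2 h a \<and> (\<forall>e\<in>interior_edges m1 m2. \<bar>a e\<bar> \<le> 1))"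
proof
  assume "p \<in> C_h m1 m2 h"
  then show "\<exists>a. p = RT_field m1 m2 h a \<and> (\<forall>e\<in>interior_edges m1 m2. \<bar>a e\<bar> \<le> 1)"
    using Y_h_eq_RT_field[OF h] unfolding C_h_def by blast
next
  assume "\<exists>a. p = RT_field m1 m2 h a \<and> (\<forall>e\<in>interior_edges m1 m2. \<bar>a e\<bar> \<le> 1)"
  then show "p \<in> C_h m1 m2 h"
    unfolding C_h_def using RT_field_in_Y_h[OF h] edge_value_RT_field[OF h] by auto
qed

lemma convex_combination_abs_le:
  fixes a :: "'i \<Rightarrow> real"
  assumes "\<And>i. i \<in> I \<Longrightarrow> 0 \<le> w i" "sum w I = 1" "\<And>i. i \<in> I \<Longrightarrow> \<bar>a i\<bar> \<le> B"
  shows "\<bar>\<Sum>i\<in>I. w i * a i\<bar> \<le> B"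
proof -
  have "\<bar>\<Sum>i\<in>I. w i * a i\<bar> \<le> (\<Sum>i\<in>I. w i * B)"
    using assms by (intro sum_abs[THEN order_trans] sum_mono) (simp add: abs_mult mult_left_mono)
  then show ?thesis using assms(2) by (simp flip: sum_distrib_right)
qed

text \<open>
  The quadratic term can be made as small as needed by the choice of \<open>t\<close>, which gives convergence,
  while \<open>t = t\<^sub>0\<close> gives the rate.
\<close>

lemma pseudo_linear_recursion:
  fixes e :: "nat \<Rightarrow> real"
  assumes e: "\<And>n. 0 \<le> e n" and \<tau>: "0 < \<tau>" "\<tau> \<le> 1" and t0: "0 < t\<^sub>0" "t\<^sub>0 \<le> 1 / 2" and K: "0 < K"
    and rec: "\<And>n t. 0 < t \<Longrightarrow> t \<le> t\<^sub>0 \<Longrightarrow> e (Suc n) \<le> (1 - \<tau> * t) * e n + \<tau> * t\<^sup>2 * K"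
  shows "converges_pseudo_linearly e (max (1 / 2) (1 - \<tau> * t\<^sub>0)) (t\<^sub>0 * K)"
proof -
  have g: "0 < 1 - \<tau> * t" "1 - \<tau> * t < 1" if "0 < t" "t \<le> t\<^sub>0" for t
    using mult_mono[of \<tau> 1 t "1 / 2"] \<tau> t0 that by auto
  \<comment> \<open>\<open>t * K\<close> is the fixed point of the affine map on the right-hand side
    of the recursion.\<close>
  have bound: "e n \<le> (1 - \<tau> * t) ^ n * e 0 + t * K" if t: "0 < t" "t \<le> t\<^sub>0" for n t
  proof (induction n)
    case 0
    then show ?case using t K by simp
  next
    case (Suc n)
    have "e (Suc n) \<le> (1 - \<tau> * t) * e n + \<tau> * t\<^sup>2 * K" by (rule rec[OF t])
    also have "\<dots> \<le> (1 - \<tau> * t) * ((1 - \<tau> * t) ^ n * e 0 + t * K) + \<tau> * t\<^sup>2 * K"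
      using Suc g[OF t] by simp
    also have "\<dots> = (1 - \<tau> * t) ^ Suc n * e 0 + t * K"
      by (simp add: power2_eq_square algebra_simps)
    finally show ?case .
  qed
  have "e \<longlonglongrightarrow> 0"
  proof (rule LIMSEQ_I)
    fix r :: real assume r: "0 < r"
    define t where "t = min t\<^sub>0 (r / (2 * K))"
    have t: "0 < t" "t \<le> t\<^sub>0" using t0 r K by (auto simp: t_def)
    have "t * K \<le> r / (2 * K) * K" using K by (intro mult_right_mono) (auto simp: t_def)
    then have tK: "t * K \<le> r / 2" using K by simp
    have "(\<lambda>n. (1 - \<tau> * t) ^ n * e 0) \<longlonglongrightarrow> 0 * e 0"
      using g[OF t] by (intro tendsto_mult LIMSEQ_power_zero tendsto_const) simp
    then have "\<forall>\<^sub>F n in sequentially. (1 - \<tau> * t) ^ n * e 0 < r / 2"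
      using r by (intro order_tendstoD(2)[of _ 0]) auto
    then obtain n0 where n0: "\<And>n. n0 \<le> n \<Longrightarrow> (1 - \<tau> * t) ^ n * e 0 < r / 2"
      unfolding eventually_sequentially by blast
    show "\<exists>n0. \<forall>n\<ge>n0. norm (e n - 0) < r"
    proof (intro exI allI impI)
      fix n assume "n0 \<le> n"
      then have "e n < r" using bound[OF t, of n] n0 tK by fastforce
      then show "norm (e n - 0) < r" using e by simp
    qed
  qed
  moreover have "e n \<le> max (1 / 2) (1 - \<tau> * t\<^sub>0) ^ n * (e 0 + 1) + t\<^sub>0 * K" for n
  proof -
    have "(1 - \<tau> * t\<^sub>0) ^ n * e 0 \<le> max (1 / 2) (1 - \<tau> * t\<^sub>0) ^ n * (e 0 + 1)"
      using g(1)[OF t0(1) order_refl] e[of 0] by (intro mult_mono power_mono) auto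
    then show ?thesis using bound[OF t0(1) order_refl, of n] by linarith
  qed
  moreover have "0 < e 0 + 1" using e[of 0] by linarith
  ultimately show ?thesis
    unfolding converges_pseudo_linearly_def using e t0 K g(2)[OF t0(1) order_refl] by auto
qed

lemma measure_Omega: "0 < h \<Longrightarrow> measure lebesgue (Omega m1 m2 h) = h\<^sup>2 * (real m1 * real m2)"
proof -
  assume h: "0 < h"
  have "Omega m1 m2 h = box (0, 0) (real m1 * h, real m2 * h)"
    unfolding Omega_def by (simp add: box_prod box_real)
  then have "measure lebesgue (Omega m1 m2 h) = measure lborel (box (0, 0) (real m1 * h, real m2 * h))"
    by simp
  also have "\<dots> = measure lborel (cbox (0, 0) (real m1 * h, real m2 * h))"
    by (simp only: measure_lborel_box_eq measure_lborel_cbox_eq)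
  also have "\<dots> = real m1 * h * (real m2 * h)"
    using h by (simp add: content_Pair)
  finally show ?thesis by (simp add: power2_eq_square)
qed

section \<open>The Schwarz method on a fixed decomposition\<close>

context
  fixes m1 m2 :: nat and h :: real and n1 n2 :: nat and H \<delta> :: real and N :: nat and col
  assumes dec: "overlapping_decomposition m1 m2 h n1 n2 H \<delta> N col"
begin

private abbreviation (input) "\<theta> \<equiv> hat H \<delta> (subdomains n1 n2) col"

lemma decomposition_pos: "0 < h" "0 < \<delta>" "1 \<le> N" "N \<le> 4" "0 < m1" "0 < m2"
  using dec unfolding overlapping_decomposition_def by auto

lemma finite_subdomains: "finite (subdomains n1 n2)"
  by (simp add: subdomains_def)

lemma sum_hat_interior_edge:
  assumes e: "e \<in> interior_edges m1 m2"
  shows "(\<Sum>k = 1..N. \<theta> k (midpoint_edge h e)) = 1"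
proof -
  obtain M where M: "0 < M" "H = real M * h" "m1 = n1 * M" "m2 = n2 * M"
    using dec unfolding overlapping_decomposition_def by blast
  define i j where ij: "i = (case e of VEdge i j \<Rightarrow> i | HEdge i j \<Rightarrow> i)"
    "j = (case e of VEdge i j \<Rightarrow> j | HEdge i j \<Rightarrow> j)"
  have lt: "i < m1" "j < m2" using e by (cases e; simp add: ij)+
  have mid: "real i * h \<le> fst (midpoint_edge h e)" "fst (midpoint_edge h e) \<le> (real i + 1) * h"
    "real j * h \<le> snd (midpoint_edge h e)" "snd (midpoint_edge h e) \<le> (real j + 1) * h"
    using decomposition_pos(1) by (cases e; auto simp: ij intro!: mult_right_mono)+
  \<comment> \<open>The subdomain of the element to the right of, or above, the edge; its closure
    contains the midpoint, so its weight there is one.\<close>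
  let ?s = "(i div M, j div M)"
  have s: "?s \<in> subdomains n1 n2"
    using lt M by (auto simp: subdomains_def less_mult_imp_div_less)
  have cell: "real (k div M) * H \<le> real k * h" "(real k + 1) * h \<le> (real (k div M) + 1) * H" for k
  proof -
    have "k div M * M \<le> k" "k + 1 \<le> (k div M + 1) * M"
      using M(1) by (simp_all add: dividend_less_times_div Suc_le_eq mult.commute)
    then have "real (k div M * M) * h \<le> real k * h" "real (k + 1) * h \<le> real ((k div M + 1) * M) * h"
      using decomposition_pos(1) by (intro mult_right_mono; simp only: of_nat_le_iff)+
    then show "real (k div M) * H \<le> real k * h" "(real k + 1) * h \<le> (real (k div M) + 1) * H"
      by (simp_all add: M(2) algebra_simps)
  qed
  have "weight H \<delta> ?s (midpoint_edge h e) = 1"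
    using cell[of i] cell[of j] mid by (intro weight_eq_1) (simp_all only: fst_conv snd_conv)
  then show ?thesis
    using dec s decomposition_pos(2) finite_subdomains unfolding overlapping_decomposition_def
    by (intro sum_hat[of _ _ _ ?s]) auto
qed

lemma hat_nonzero_patch:
  assumes e: "e \<in> interior_edges m1 m2" and nz: "\<theta> k (midpoint_edge h e) \<noteq> 0"
  shows "patch h e \<subseteq> colored_region m1 m2 h n1 n2 H \<delta> col k"
proof -
  obtain s where s: "s \<in> subdomains n1 n2" "col s = k" "0 < weight H \<delta> s (midpoint_edge h e)"
    using hat_nonzero[OF decomposition_pos(2) finite_subdomains nz] by blast
  obtain M d :: nat where "H = real M * h" "\<delta> = real d * h" "0 < d"
    using dec unfolding overlapping_decomposition_def by blast
  then have "patch h e \<subseteq> enlarged_subdomain m1 m2 h H \<delta> s"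
    using decomposition_pos(1) e s(3) by (intro patch_subset_enlarged_subdomain)
  then show ?thesis using s unfolding colored_region_def by blast
qed

lemma local_field_in_W_k:
  defines "r \<equiv> \<lambda>t k c. RT_field m1 m2 h (\<lambda>e. t * (\<theta> k (midpoint_edge h e) * c e))"
  shows "r t k c \<in> W_k m1 m2 h n1 n2 H \<delta> col k"
    and "extend_by_zero m1 m2 h n1 n2 H \<delta> col k (r t k c) = r t k c"
proof -
  show r: "r t k c \<in> W_k m1 m2 h n1 n2 H \<delta> col k"
    unfolding r_def using hat_nonzero_patch by (intro RT_field_in_W_k decomposition_pos) auto
  show "extend_by_zero m1 m2 h n1 n2 H \<delta> col k (r t k c) = r t k c"
    by (rule extend_by_zero_W_k[OF r])
qed

text \<open>
  The cut-off \<open>\<theta>\<close> varies by at most \<open>h / \<delta>\<close> within an element, so that freezing it at the center of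
  each element changes the discrete divergence by \<open>O(1 / \<delta>)\<close>.
\<close>

lemma local_div_norm:
  fixes k :: nat and c :: "edge \<Rightarrow> real"
  assumes c: "\<And>e. e \<in> interior_edges m1 m2 \<Longrightarrow> \<bar>c e\<bar> \<le> 2"
  defines "u \<equiv> RT_div m1 m2 h (\<lambda>e. \<theta> k (midpoint_edge h e) * c e)" and "w \<equiv> RT_div m1 m2 h c"
  shows "inner_X m1 m2 h u u \<le> 2 * inner_X m1 m2 h w w + 128 * (measure lebesgue (Omega m1 m2 h) / \<delta>\<^sup>2)"
proof -
  note h = decomposition_pos(1) and \<delta> = decomposition_pos(2)
  have elem: "(elem_value h u T)\<^sup>2 \<le> 2 * (elem_value h w T)\<^sup>2 + 128 / \<delta>\<^sup>2" for T
  proof -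
    obtain i j where T: "T = (i, j)" by (cases T)
    let ?z = "zero_boundary m1 m2 c" and ?c = "center h T"
    let ?m = "\<lambda>e. \<theta> k (midpoint_edge h e)"
    define D where "D e = (?m e - \<theta> k ?c) * ?z e" for e
    have D: "\<bar>D e\<bar> \<le> 2 * (h / \<delta>)" if "e \<in> elem_edges T" for e
    proof -
      have "\<bar>fst (midpoint_edge h e) - fst ?c\<bar> \<le> h / 2" "\<bar>snd (midpoint_edge h e) - snd ?c\<bar> \<le> h / 2"
        using that h by (auto simp: T center_def algebra_simps)
      from hat_Lipschitz[OF \<delta> finite_subdomains this]
      have "\<bar>?m e - \<theta> k ?c\<bar> \<le> h / \<delta>" by simp
      moreover have "\<bar>?z e\<bar> \<le> 2" using c by (simp add: zero_boundary_def)
      ultimately have "\<bar>D e\<bar> \<le> h / \<delta> * 2" unfolding D_def by (rule abs_mult_le)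
      then show ?thesis by (simp add: mult.commute)
    qed
    define r where "r = (D (VEdge (Suc i) j) - D (VEdge i j) + (D (HEdge i (Suc j)) - D (HEdge i j))) / h"
    have z: "zero_boundary m1 m2 (\<lambda>e. ?m e * c e) e = \<theta> k ?c * ?z e + D e" for e
      by (simp add: zero_boundary_def D_def algebra_simps)
    have "elem_value h u T = \<theta> k ?c * elem_value h w T + r"
      unfolding u_def w_def T elem_value_RT_div[OF h] z r_def
      by (simp add: T[symmetric] algebra_simps add_divide_distrib diff_divide_distrib)
    also have "(\<theta> k ?c * elem_value h w T + r)\<^sup>2 \<le> 2 * (\<theta> k ?c * elem_value h w T)\<^sup>2 + 2 * r\<^sup>2"
      using sum_squares_bound[of "\<theta> k ?c * elem_value h w T" r] by (simp add: power2_sum)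
    also have "(\<theta> k ?c * elem_value h w T)\<^sup>2 \<le> 1 * (elem_value h w T)\<^sup>2"
      unfolding power_mult_distrib
      using hat_bounds[OF \<delta> finite_subdomains] by (intro mult_right_mono power_le_one) auto
    \<comment> \<open>Each of the four edges contributes at most (2 / \<delta>) (h / 2) times the
      bound 2 on \<open>c\<close>, that is 2 h / \<delta>; division by h leaves 8 / \<delta>. The
      square, doubled when splitting the sum, is the constant 128.\<close>
    also have "r\<^sup>2 \<le> 64 / \<delta>\<^sup>2"
    proof -
      have "\<bar>D (VEdge (Suc i) j) - D (VEdge i j) + (D (HEdge i (Suc j)) - D (HEdge i j))\<bar> \<le> 8 * (h / \<delta>)"
        using D[of "VEdge (Suc i) j"] D[of "VEdge i j"] D[of "HEdge i (Suc j)"] D[of "HEdge i j"]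
        by (simp add: T)
      then have "\<bar>r\<bar> \<le> 8 / \<delta>" using h by (simp add: r_def abs_divide divide_le_eq)
      then have "\<bar>r\<bar>\<^sup>2 \<le> (8 / \<delta>)\<^sup>2" by (intro power_mono) auto
      then show ?thesis by (simp add: power_divide)
    qed
    finally show ?thesis by simp
  qed
  have "inner_X m1 m2 h u u \<le> h\<^sup>2 * (\<Sum>T\<in>elements m1 m2. 2 * (elem_value h w T)\<^sup>2 + 128 / \<delta>\<^sup>2)"
    unfolding inner_X_def power2_eq_square[symmetric]
    by (intro mult_left_mono sum_mono elem) simp
  also have "\<dots> = 2 * inner_X m1 m2 h w w + 128 * (measure lebesgue (Omega m1 m2 h) / \<delta>\<^sup>2)"
    by (simp add: inner_X_def measure_Omega[OF h] sum.distrib sum_distrib_left elements_def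
        power2_eq_square algebra_simps)
  finally show ?thesis .
qed

context
  fixes F \<alpha> \<beta> \<tau> p r pstar
  assumes \<alpha>: "0 < \<alpha>" and \<beta>: "0 < \<beta>" and \<tau>: "0 < \<tau>" "\<tau> \<le> 1 / real N"
    and sc: "strongly_convex_X m1 m2 h \<alpha> F" and Lip: "Lipschitz_differentiable_X m1 m2 h \<beta> F"
    and as: "additive_schwarz m1 m2 h n1 n2 H \<delta> N col F \<tau> p r"
begin

private abbreviation (input) "R \<equiv> extend_by_zero m1 m2 h n1 n2 H \<delta> col"
private abbreviation (input) "E \<equiv> dual_energy m1 m2 h F"
private abbreviation (input) "Fc \<equiv> conjugate_X m1 m2 h F"
private abbreviation (input) "D \<equiv> RT_div m1 m2 h"

lemma energy_RT_field: "E (RT_field m1 m2 h a) = Fc (D a)"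
  by (simp add: dual_energy_def div_h_RT_field decomposition_pos)

text \<open>The new iterate is a convex combination of the old one, with weight 1 - \<tau> N, and of
  the N locally corrected fields, with weight \<tau> each; this is where \<tau> \<le> 1 / N
  enters.\<close>

lemma schwarz_step:
  assumes "p n \<in> C_h m1 m2 h"
  shows "p (Suc n) \<in> C_h m1 m2 h"
    and "E (p (Suc n)) \<le> (1 - \<tau> * real N) * E (p n) + \<tau> * (\<Sum>k = 1..N. E (\<lambda>x. p n x + R k (r n k) x))"
proof -
  note h = decomposition_pos(1)
  obtain a where a: "p n = RT_field m1 m2 h a" "\<forall>e\<in>interior_edges m1 m2. \<bar>a e\<bar> \<le> 1"
    using assms unfolding C_h_iff[OF h] by blast
  have "\<forall>k\<in>{1..N}. \<exists>b. (\<lambda>x. p n x + R k (r n k) x) = RT_field m1 m2 h b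
      \<and> (\<forall>e\<in>interior_edges m1 m2. \<bar>b e\<bar> \<le> 1)"
    using as unfolding additive_schwarz_def Let_def C_h_iff[OF h, symmetric] by blast
  from bchoice[OF this] obtain b where b: "\<And>k. k \<in> {1..N} \<Longrightarrow> (\<lambda>x. p n x + R k (r n k) x) = RT_field m1 m2 h (b k)"
    "\<And>k e. k \<in> {1..N} \<Longrightarrow> e \<in> interior_edges m1 m2 \<Longrightarrow> \<bar>b k e\<bar> \<le> 1" by blast
  \<comment> \<open>Index 0, which is not a color, stands for the current iterate.\<close>
  define c where "c k = (if k = 0 then a else b k)" for k
  define w where "w k = (if k = 0 then 1 - \<tau> * real N else \<tau>)" for k :: nat
  have split: "(\<Sum>k\<in>{0..N}. f k) = f 0 + (\<Sum>k = 1..N. f k)" for f :: "nat \<Rightarrow> 'z::comm_monoid_add"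
    by (simp add: sum.atLeast_Suc_atMost)
  have "\<tau> * real N \<le> 1" using \<tau> decomposition_pos(3) by (simp add: le_divide_eq)
  then have w: "\<And>k. k \<in> {0..N} \<Longrightarrow> 0 \<le> w k" "sum w {0..N} = 1"
    using \<tau> by (auto simp: w_def) (simp add: split)
  have wsum: "(\<Sum>k\<in>{0..N}. w k *\<^sub>R f k) = (1 - \<tau> * real N) *\<^sub>R f 0 + \<tau> *\<^sub>R (\<Sum>k = 1..N. f k)"
    for f :: "nat \<Rightarrow> 'z::real_vector"
    unfolding split scaleR_sum_right by (simp add: w_def)
  have eq: "p (Suc n) = RT_field m1 m2 h (\<lambda>e. \<Sum>k\<in>{0..N}. w k * c k e)"
  proof
    fix x
    have bx: "R k (r n k) x = RT_field m1 m2 h (b k) x - p n x" if "k \<in> {1..N}" for k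
      using fun_cong[OF b(1)[OF that], of x] by (simp add: algebra_simps)
    have "p (Suc n) x = p n x + \<tau> *\<^sub>R (\<Sum>k = 1..N. R k (r n k) x)"
      using as unfolding additive_schwarz_def Let_def by simp
    also have "(\<Sum>k = 1..N. R k (r n k) x) = (\<Sum>k = 1..N. RT_field m1 m2 h (b k) x - p n x)"
      using bx by (intro sum.cong) auto
    also have "\<dots> = (\<Sum>k = 1..N. RT_field m1 m2 h (c k) x) - real N *\<^sub>R p n x"
      by (simp add: sum_subtractf sum_constant_scaleR c_def)
    also have "p n x + \<tau> *\<^sub>R \<dots> = (\<Sum>k\<in>{0..N}. w k *\<^sub>R RT_field m1 m2 h (c k) x)"
      unfolding wsum by (simp add: c_def a(1) scaleR_left_diff_distrib scaleR_right_diff_distrib)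
    finally show "p (Suc n) x = RT_field m1 m2 h (\<lambda>e. \<Sum>k\<in>{0..N}. w k * c k e) x"
      unfolding RT_field_sum .
  qed
  have "\<bar>\<Sum>k\<in>{0..N}. w k * c k e\<bar> \<le> 1" if "e \<in> interior_edges m1 m2" for e
    using w a(2) b(2) that by (intro convex_combination_abs_le) (auto simp: c_def)
  then show "p (Suc n) \<in> C_h m1 m2 h" unfolding C_h_iff[OF h] eq by blast
  have "E (p (Suc n)) = Fc (\<lambda>x. \<Sum>k\<in>{0..N}. w k * D (c k) x)"
    unfolding eq energy_RT_field by (simp only: RT_div_sum[abs_def])
  also have "\<dots> \<le> (\<Sum>k\<in>{0..N}. w k * Fc (D (c k)))"
    by (intro convex_on_X_sum[OF conjugate_X_convex[OF \<alpha> \<beta> sc Lip]] w RT_div_in_X_h[OF h]) simp_all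
  also have "\<dots> = (1 - \<tau> * real N) * E (p n) + \<tau> * (\<Sum>k = 1..N. Fc (D (c k)))"
    using wsum[of "\<lambda>k. Fc (D (c k))"] by (simp add: c_def a(1) energy_RT_field)
  also have "(\<Sum>k = 1..N. Fc (D (c k))) = (\<Sum>k = 1..N. E (\<lambda>x. p n x + R k (r n k) x))"
    using b(1) by (intro sum.cong) (auto simp: c_def energy_RT_field)
  finally show "E (p (Suc n)) \<le> (1 - \<tau> * real N) * E (p n)
      + \<tau> * (\<Sum>k = 1..N. E (\<lambda>x. p n x + R k (r n k) x))" .
qed

lemma iterates_in_C_h: "p n \<in> C_h m1 m2 h"
proof (induction n)
  case 0
  then show ?case using as unfolding additive_schwarz_def Let_def by blast
next
  case (Suc n)
  then show ?case by (rule schwarz_step(1))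
qed

text \<open>The bounds on \<open>t\<close> involve \<alpha> and \<beta> only, so a rate derived from
  them depends neither on the mesh nor on the decomposition.\<close>

lemma energy_decrease:
  assumes q: "q \<in> C_h m1 m2 h" and t: "0 < t" "t \<le> 1 / 2" "t \<le> \<alpha> / (16 * \<beta>)"
  shows "E (p (Suc n)) - E q
    \<le> (1 - \<tau> * t) * (E (p n) - E q) + \<tau> * t\<^sup>2 * (256 / \<alpha> * (measure lebesgue (Omega m1 m2 h) / \<delta>\<^sup>2))"
proof -
  note h = decomposition_pos(1)
  let ?I = "interior_edges m1 m2"
  define K where "K = measure lebesgue (Omega m1 m2 h) / \<delta>\<^sup>2"
  have K: "0 \<le> K" by (simp add: K_def)
  obtain a where a: "p n = RT_field m1 m2 h a" "\<And>e. e \<in> ?I \<Longrightarrow> \<bar>a e\<bar> \<le> 1"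
    using iterates_in_C_h[of n] unfolding C_h_iff[OF h] by blast
  obtain b where b: "q = RT_field m1 m2 h b" "\<And>e. e \<in> ?I \<Longrightarrow> \<bar>b e\<bar> \<le> 1"
    using q unfolding C_h_iff[OF h] by blast
  define c where "c e = b e - a e" for e
  have c: "\<bar>c e\<bar> \<le> 2" if "e \<in> ?I" for e
    using a(2)[OF that] b(2)[OF that] by (simp add: c_def)
  let ?m = "\<lambda>k e. \<theta> k (midpoint_edge h e) * c e"
  let ?d = "\<lambda>x. D b x - D a x"
  have dc: "D c = ?d" using RT_div_add_mult[of m1 m2 h b "-1" a] by (simp add: c_def[abs_def] fun_eq_iff)
  define Q where "Q = inner_X m1 m2 h ?d ?d"
  have Q: "0 \<le> Q" unfolding Q_def by (rule inner_X_ge_zero)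
  have N: "1 \<le> real N" "real N \<le> 4" using decomposition_pos by auto
  have local: "E (\<lambda>x. p n x + R k (r n k) x) \<le> Fc (\<lambda>x. D a x + t * D (?m k) x)" if k: "k \<in> {1..N}" for k
  proof -
    let ?s = "RT_field m1 m2 h (\<lambda>e. t * ?m k e)"
    have eq: "(\<lambda>x. p n x + R k ?s x) = RT_field m1 m2 h (\<lambda>e. a e + t * ?m k e)"
      unfolding local_field_in_W_k(2) a(1)
      using RT_field_add_mult[of m1 m2 h a 1 "\<lambda>e. t * ?m k e"] by (simp add: fun_eq_iff)
    \<comment> \<open>The constraint is edgewise and hence survives a different convex combination
      on each edge; this is why the cut-off multiplies edge values and not the field itself.\<close>
    have "\<bar>a e + t * ?m k e\<bar> \<le> 1" if e: "e \<in> ?I" for e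
    proof -
      define s where "s = t * \<theta> k (midpoint_edge h e)"
      have s: "0 \<le> s" "s \<le> 1"
        using hat_bounds[OF decomposition_pos(2) finite_subdomains, of H col k "midpoint_edge h e"] t
        unfolding s_def by (auto intro!: mult_le_one)
      have "a e + t * ?m k e = (1 - s) * a e + s * b e" by (simp add: s_def c_def algebra_simps)
      also have "\<bar>\<dots>\<bar> \<le> \<bar>(1 - s) * a e\<bar> + \<bar>s * b e\<bar>" by (rule abs_triangle_ineq)
      also have "\<dots> \<le> (1 - s) * 1 + s * 1"
        using s a(2)[OF e] b(2)[OF e] by (intro add_mono abs_mult_le) simp_all
      finally show ?thesis by simp
    qed
    then have "(\<lambda>x. p n x + R k ?s x) \<in> C_h m1 m2 h" unfolding eq C_h_iff[OF h] by blast
    then have "E (\<lambda>x. p n x + R k (r n k) x) \<le> E (\<lambda>x. p n x + R k ?s x)"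
      using as k local_field_in_W_k(1) unfolding additive_schwarz_def Let_def by blast
    then show ?thesis unfolding eq energy_RT_field by (simp only: RT_div_add_mult[abs_def])
  qed
  have sum_d: "(\<Sum>k = 1..N. D (?m k) x) = D b x - D a x" for x
  proof -
    have "(\<Sum>k = 1..N. D (?m k) x) = D (\<lambda>e. \<Sum>k = 1..N. 1 * ?m k e) x"
      unfolding RT_div_sum by simp
    also have "\<dots> = D c x"
      unfolding RT_div_def using sum_hat_interior_edge
      by (intro sum.cong) (simp_all flip: sum_distrib_right)
    finally show ?thesis by (simp add: dc)
  qed
  have "(\<Sum>k = 1..N. Fc (\<lambda>x. D a x + t * D (?m k) x))
      \<le> real (card {1..N}) * Fc (D a) + t * (Fc (D b) - Fc (D a))
        - t * (1 - t / real (card {1..N})) / (2 * \<beta>) * inner_X m1 m2 h ?d ?d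
        + t\<^sup>2 / (2 * \<alpha>) * (\<Sum>k = 1..N. inner_X m1 m2 h (D (?m k)) (D (?m k)))"
    using decomposition_pos(3) t
    by (intro conjugate_X_parallel_step[OF \<alpha> \<beta> sc Lip] RT_div_in_X_h[OF h] sum_d) auto
  also have "\<dots> = real N * Fc (D a) + t * (Fc (D b) - Fc (D a)) - t * (1 - t / real N) / (2 * \<beta>) * Q
        + t\<^sup>2 / (2 * \<alpha>) * (\<Sum>k = 1..N. inner_X m1 m2 h (D (?m k)) (D (?m k)))"
    by (simp add: Q_def)
  also have "(\<Sum>k = 1..N. inner_X m1 m2 h (D (?m k)) (D (?m k))) \<le> (\<Sum>k = 1..N. 2 * Q + 128 * K)"
  proof (rule sum_mono)
    show "inner_X m1 m2 h (D (?m k)) (D (?m k)) \<le> 2 * Q + 128 * K" for k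
      using local_div_norm[where c = c and k = k] c unfolding dc Q_def K_def by blast
  qed
  also have "(\<Sum>k = 1..N. 2 * Q + 128 * K) = real N * (2 * Q + 128 * K)" by simp
  \<comment> \<open>At most four colors: 4 times 128 times the factor 1 / (2 \<alpha>) is the
    constant 256 / \<alpha>.\<close>
  also have "real N * (2 * Q + 128 * K) \<le> 4 * (2 * Q + 128 * K)"
    using N Q K by (intro mult_right_mono) auto
  finally have 1: "(\<Sum>k = 1..N. Fc (\<lambda>x. D a x + t * D (?m k) x))
      \<le> real N * Fc (D a) + t * (Fc (D b) - Fc (D a)) - t * (1 - t / real N) / (2 * \<beta>) * Q
        + t\<^sup>2 / (2 * \<alpha>) * (4 * (2 * Q + 128 * K))"
    using \<alpha> t by (simp add: mult_left_mono divide_right_mono)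
  \<comment> \<open>At least half of the quadratic gain survives. It covers
    \<open>t\<^sup>2 / (2 * \<alpha>) * 8 * Q\<close> as soon as
    \<open>16 * \<beta> * t \<le> \<alpha>\<close>, the origin of the second bound on
    \<open>t\<close>.\<close>
  have "t / real N \<le> 1 / 2" using N t by (simp add: divide_le_eq)
  then have "t * (1 / 2) / (2 * \<beta>) * Q \<le> t * (1 - t / real N) / (2 * \<beta>) * Q"
    using t \<beta> Q by (intro mult_right_mono divide_right_mono mult_left_mono) auto
  moreover have "t\<^sup>2 / (2 * \<alpha>) * 8 * Q \<le> t * (1 / 2) / (2 * \<beta>) * Q"
  proof (intro mult_right_mono Q)
    have "t * (16 * \<beta>) \<le> \<alpha>" using t(3) \<beta> by (simp add: pos_le_divide_eq)
    then have "t * (t * (16 * \<beta>)) \<le> t * \<alpha>" using t(1) by simp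
    then show "t\<^sup>2 / (2 * \<alpha>) * 8 \<le> t * (1 / 2) / (2 * \<beta>)"
      using \<alpha> \<beta> by (simp add: field_simps power2_eq_square)
  qed
  moreover have "t\<^sup>2 / (2 * \<alpha>) * (4 * (2 * Q + 128 * K)) = t\<^sup>2 / (2 * \<alpha>) * 8 * Q + t\<^sup>2 * (256 / \<alpha> * K)"
    using \<alpha> by (simp add: field_simps)
  ultimately have "(\<Sum>k = 1..N. Fc (\<lambda>x. D a x + t * D (?m k) x))
      \<le> real N * Fc (D a) + t * (Fc (D b) - Fc (D a)) + t\<^sup>2 * (256 / \<alpha> * K)"
    using 1 by linarith
  moreover have "(\<Sum>k = 1..N. E (\<lambda>x. p n x + R k (r n k) x)) \<le> (\<Sum>k = 1..N. Fc (\<lambda>x. D a x + t * D (?m k) x))"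
    by (intro sum_mono local)
  ultimately have "\<tau> * (\<Sum>k = 1..N. E (\<lambda>x. p n x + R k (r n k) x))
      \<le> \<tau> * (real N * E (p n) + t * (E q - E (p n)) + t\<^sup>2 * (256 / \<alpha> * K))"
    using \<tau> by (intro mult_left_mono) (auto simp: a(1) b(1) energy_RT_field)
  then have "E (p (Suc n)) \<le> (1 - \<tau> * real N) * E (p n)
      + \<tau> * (real N * E (p n) + t * (E q - E (p n)) + t\<^sup>2 * (256 / \<alpha> * K))"
    using schwarz_step(2)[OF iterates_in_C_h, of n] by linarith
  then show ?thesis unfolding K_def[symmetric] by (simp add: algebra_simps)
qed

end

end

theorem corollary4p4:
  fixes \<alpha> \<beta> \<tau> :: real
  assumes "0 < \<alpha>" and "0 < \<beta>" and "0 < \<tau>"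
  shows "\<exists>\<gamma> c. 0 < \<gamma> \<and> \<gamma> < 1 \<and> 0 < c \<and>
    (\<forall>m1 m2 h n1 n2 H \<delta> N col F p r pstar.
       overlapping_decomposition m1 m2 h n1 n2 H \<delta> N col \<longrightarrow>
       \<tau> \<le> 1 / real N \<longrightarrow>
       strongly_convex_X m1 m2 h \<alpha> F \<longrightarrow>
       Lipschitz_differentiable_X m1 m2 h \<beta> F \<longrightarrow>
       additive_schwarz m1 m2 h n1 n2 H \<delta> N col F \<tau> p r \<longrightarrow>
       dual_solution m1 m2 h F pstar \<longrightarrow>
       (\<exists>\<epsilon>>0. \<epsilon> \<le> c * (measure lebesgue (Omega m1 m2 h) / \<delta>\<^sup>2) \<and>
          converges_pseudo_linearly
            (\<lambda>n. \<alpha> * (dual_energy m1 m2 h F (p n) - dual_energy m1 m2 h F pstar)) \<gamma> \<epsilon>))"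
proof -
  define t\<^sub>0 where "t\<^sub>0 = min (1 / 2) (\<alpha> / (16 * \<beta>))"
  have t0: "0 < t\<^sub>0" "t\<^sub>0 \<le> 1 / 2" "t\<^sub>0 \<le> \<alpha> / (16 * \<beta>)" using assms by (auto simp: t\<^sub>0_def)
  show ?thesis
  \<comment> \<open>The rate is fixed before \<open>N\<close>, when \<tau> may still be large and
    \<open>1 - \<tau> * t\<^sub>0\<close> negative; the maximum keeps it positive. Once \<tau> \<le>
    1 / N is known, the maximum is \<open>1 - \<tau> * t\<^sub>0\<close>.\<close>
  proof (rule exI[of _ "max (1 / 2) (1 - \<tau> * t\<^sub>0)"], rule exI[of _ "t\<^sub>0 * 256"], intro conjI allI impI)
    fix m1 m2 h n1 n2 H \<delta> N col F p r pstar
    assume dec: "overlapping_decomposition m1 m2 h n1 n2 H \<delta> N col"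
      and \<tau>: "\<tau> \<le> 1 / real N"
      and F: "strongly_convex_X m1 m2 h \<alpha> F" "Lipschitz_differentiable_X m1 m2 h \<beta> F"
      and as: "additive_schwarz m1 m2 h n1 n2 H \<delta> N col F \<tau> p r"
      and sol: "dual_solution m1 m2 h F pstar"
    note pos = decomposition_pos[OF dec]
    let ?E = "dual_energy m1 m2 h F"
    define K where "K = measure lebesgue (Omega m1 m2 h) / \<delta>\<^sup>2"
    have K: "0 < K" using pos by (simp add: K_def measure_Omega)
    have "1 / real N \<le> 1" using pos(3) by simp
    then have \<tau>1: "\<tau> \<le> 1" using \<tau> by linarith
    have "converges_pseudo_linearly (\<lambda>n. \<alpha> * (?E (p n) - ?E pstar))
        (max (1 / 2) (1 - \<tau> * t\<^sub>0)) (t\<^sub>0 * (256 * K))"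
    proof (rule pseudo_linear_recursion[OF _ assms(3) \<tau>1 t0(1,2)])
      show "0 \<le> \<alpha> * (?E (p n) - ?E pstar)" for n
        using sol iterates_in_C_h[OF dec assms \<tau> F as, of n] assms(1)
        unfolding dual_solution_def by simp
      show "0 < 256 * K" using K by simp
      fix n t assume t: "0 < t" "t \<le> t\<^sub>0"
      have "pstar \<in> C_h m1 m2 h" using sol unfolding dual_solution_def by blast
      then have "?E (p (Suc n)) - ?E pstar
          \<le> (1 - \<tau> * t) * (?E (p n) - ?E pstar) + \<tau> * t\<^sup>2 * (256 / \<alpha> * K)"
        unfolding K_def using t t0
        by (intro energy_decrease[OF dec assms \<tau> F as]) auto
      then have "\<alpha> * (?E (p (Suc n)) - ?E pstar)
          \<le> \<alpha> * ((1 - \<tau> * t) * (?E (p n) - ?E pstar) + \<tau> * t\<^sup>2 * (256 / \<alpha> * K))"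
        using assms(1) by (intro mult_left_mono) auto
      also have "\<dots> = (1 - \<tau> * t) * (\<alpha> * (?E (p n) - ?E pstar)) + \<tau> * t\<^sup>2 * (256 * K)"
        using assms(1) by (simp add: distrib_left)
      finally show "\<alpha> * (?E (p (Suc n)) - ?E pstar)
          \<le> (1 - \<tau> * t) * (\<alpha> * (?E (p n) - ?E pstar)) + \<tau> * t\<^sup>2 * (256 * K)" .
    qed
    moreover have "0 < t\<^sub>0 * (256 * K)" "t\<^sub>0 * (256 * K) \<le> t\<^sub>0 * 256 * K" using K t0(1) by simp_all
    ultimately show "\<exists>\<epsilon>>0. \<epsilon> \<le> t\<^sub>0 * 256 * (measure lebesgue (Omega m1 m2 h) / \<delta>\<^sup>2) \<and>
        converges_pseudo_linearly (\<lambda>n. \<alpha> * (?E (p n) - ?E pstar)) (max (1 / 2) (1 - \<tau> * t\<^sub>0)) \<epsilon>"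
      unfolding K_def[symmetric] by blast
  qed (use assms t0 in auto)
qed

end
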